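(* Let $G$ be a connected Milnor regular Lie group (possibly infinite-dimensional) with Lie algebra $\mathfrak{g}$, and let $\mathfrak{a} = \mathfrak{g}/\overline{[\mathfrak{g},\mathfrak{g}]}$ be the topological abelianisation of $\mathfrak{g}$. Then there is a vector space isomorphism $\Omega^2_I(G) \simeq \bigwedge^2 \mathfrak{a}^*$, where $\Omega^2_I(G)$ is the space of bi-invariant differential 2-forms on $G$ and $\bigwedge^2\mathfrak{a}^*$ is the space of continuous alternating bilinear forms on $\mathfrak{a}$.
   Context: "Lie group" means a group object in smooth manifolds modelled on real (Hausdorff) locally convex topological vector spaces, with smoothness in the usual sense for locally convex spaces (iterated directional derivatives exist and are jointly continuous). The Lie algebra $\mathfrak{g}=T_eG$ is a locally convex space with continuous Lie bracket. $G$ is Milnor regular if for every smooth curve $c\colon[0,1]\to\mathfrak{g}$ there is a (necessarily unique) smooth curve $\gamma_c\colon[0,1]\to G$ with $\gamma_c(0)=e$ and left logarithmic derivative $c$, and the map $C^\infty([0,1],\mathfrak{g})\to G$, $c\mapsto\gamma_c(1)$, is smooth. $[\mathfrak{g},\mathfrak{g}]$ is the linear span of all brackets, $\overline{[\mathfrak{g},\mathfrak{g}]}$ is its closure in $\mathfrak{g}$, and $\mathfrak{a}$ carries the quotient topology. Differential forms are smooth and real-valued. A differential 2-form $\eta$ on $G$ is bi-invariant if $L_g^*\eta=\eta=R_g^*\eta$ for all $g\in G$, where $L_g,R_g$ are left and right translation by $g$. The isomorphism is one of real vector spaces; no topology on these spaces is considered. *)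

theory Defs
  imports
    "HOL-Analysis.Analysis"
    "HOL-Algebra.Group"
    "HOL-Library.Function_Algebras"
begin

section \<open>Locally convex spaces\<close>

class locally_convex_space = real_vector + topological_ab_group_add + t2_space +
  assumes tendsto_scaleR_nhds:
    "filterlim (\<lambda>p. fst p *\<^sub>R snd p) (nhds (r *\<^sub>R x)) (nhds r \<times>\<^sub>F nhds x)"
  assumes locally_convex_nhds:
    "open U \<Longrightarrow> 0 \<in> U \<Longrightarrow>
     \<exists>C. (\<forall>x\<in>C. \<forall>y\<in>C. \<forall>u\<ge>0. \<forall>v\<ge>0. u + v = 1 \<longrightarrow> u *\<^sub>R x + v *\<^sub>R y \<in> C) \<and>
         open C \<and> 0 \<in> C \<and> C \<subseteq> U"

lemma locally_convex:
  fixes U :: "'a::locally_convex_space set"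
  assumes "open U" "0 \<in> U"
  shows "\<exists>C. convex C \<and> open C \<and> 0 \<in> C \<and> C \<subseteq> U"
  using locally_convex_nhds[OF assms] unfolding convex_def .

instance real :: locally_convex_space
proof
  fix r x :: real
  show "filterlim (\<lambda>p. fst p *\<^sub>R snd p) (nhds (r *\<^sub>R x)) (nhds r \<times>\<^sub>F nhds x)"
    using tendsto_mult_Pair by simp
next
  fix U :: "real set" assume "open U" "0 \<in> U"
  then obtain e where "e > 0" "ball 0 e \<subseteq> U"
    by (meson open_contains_ball)
  then have "\<exists>C. convex C \<and> open C \<and> 0 \<in> C \<and> C \<subseteq> U"
    by (metis centre_in_ball convex_ball open_ball)
  then show "\<exists>C. (\<forall>x\<in>C. \<forall>y\<in>C. \<forall>u\<ge>0. \<forall>v\<ge>0. u + v = 1 \<longrightarrow> u *\<^sub>R x + v *\<^sub>R y \<in> C) \<and>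
         open C \<and> 0 \<in> C \<and> C \<subseteq> U"
    unfolding convex_def .
qed

text \<open>Pointwise scalar multiplication on function spaces; their topology is the product topology
  of \<^theory>\<open>HOL-Analysis.Function_Topology\<close>.\<close>

instantiation "fun" :: (type, real_vector) real_vector
begin

definition scaleR_fun :: "real \<Rightarrow> ('a \<Rightarrow> 'b) \<Rightarrow> 'a \<Rightarrow> 'b"
  where "r *\<^sub>R f = (\<lambda>x. r *\<^sub>R f x)"

instance
  by standard (auto simp: scaleR_fun_def fun_eq_iff scaleR_add_right scaleR_add_left)

end

lemma scaleR_fun_apply [simp]: "(r *\<^sub>R f) x = r *\<^sub>R f x"
  by (simp add: scaleR_fun_def)


section \<open>Smooth maps between locally convex spaces\<close>

text \<open>In the following, a locally convex space occurring as a domain is given by a topology \<open>E\<close>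
  whose underlying set \<open>topspace E\<close> is a linear subspace of the ambient type; this covers the
  space of smooth curves below. \<open>D [v\<^sub>k, \<dots>, v\<^sub>1] x\<close> is the iterated directional
  derivative of order \<open>k\<close> at \<open>x\<close> in directions \<open>v\<^sub>1, \<dots>, v\<^sub>k\<close>.\<close>

definition smooth_on ::
  "'v::real_vector topology \<Rightarrow> 'v set \<Rightarrow> ('v \<Rightarrow> 'w::{real_vector, t2_space}) \<Rightarrow> bool" where
  "smooth_on E U f \<longleftrightarrow>
     openin E U \<and>
     (\<exists>D :: 'v list \<Rightarrow> 'v \<Rightarrow> 'w.
        (\<forall>x\<in>U. D [] x = f x) \<and>
        (\<forall>vs v x. set vs \<subseteq> topspace E \<longrightarrow> v \<in> topspace E \<longrightarrow> x \<in> U \<longrightarrow>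
           ((\<lambda>t. (D vs (x + t *\<^sub>R v) - D vs x) /\<^sub>R t) \<longlongrightarrow> D (v # vs) x) (at 0)) \<and>
        (\<forall>k. continuous_map
               (prod_topology (subtopology E U) (product_topology (\<lambda>_. E) {..<k})) euclidean
               (\<lambda>(x, v). D (map v [0..<k]) x)))"

definition dir_deriv :: "('v::real_vector \<Rightarrow> 'w::{real_vector, t2_space}) \<Rightarrow> 'v \<Rightarrow> 'v \<Rightarrow> 'w" where
  "dir_deriv f x v = Lim (at 0) (\<lambda>t. (f (x + t *\<^sub>R v) - f x) /\<^sub>R t)"

text \<open>Curves on an interval or on a relatively open subset of one; derivatives at end points are
  one-sided. The codomain may be a function type, which is Hausdorff under the product topology but
  not an instance of class \<open>t2_space\<close>; hence the explicit limit instead of \<^const>\<open>Lim\<close>.\<close>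

definition curve_deriv :: "real set \<Rightarrow> (real \<Rightarrow> 'w::{real_vector, topological_space}) \<Rightarrow> real \<Rightarrow> 'w" where
  "curve_deriv I c t = (THE l. ((\<lambda>s. (c s - c t) /\<^sub>R (s - t)) \<longlongrightarrow> l) (at t within I))"

definition smooth_curve_on :: "real set \<Rightarrow> (real \<Rightarrow> 'w::{real_vector, topological_space}) \<Rightarrow> bool" where
  "smooth_curve_on I c \<longleftrightarrow>
     (\<exists>D :: nat \<Rightarrow> real \<Rightarrow> 'w.
        (\<forall>t\<in>I. D 0 t = c t) \<and>
        (\<forall>k. continuous_on I (D k) \<and>
             (\<forall>t\<in>I. ((\<lambda>s. (D k s - D k t) /\<^sub>R (s - t)) \<longlongrightarrow> D (Suc k) t) (at t within I))))"

text \<open>The space of smooth curves from \<open>[0,1]\<close> into a linear subspace \<open>V\<close>, normalised to vanish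
  outside \<open>[0,1]\<close>, with the topology of compact convergence of all derivatives.\<close>

definition smooth_curves :: "'w::{real_vector, topological_space} set \<Rightarrow> (real \<Rightarrow> 'w) set" where
  "smooth_curves V =
     {c. smooth_curve_on {0..1} c \<and> (\<forall>t\<in>{0..1}. c t \<in> V) \<and> (\<forall>t. t \<notin> {0..1} \<longrightarrow> c t = 0)}"

definition smooth_curves_topology ::
  "'w::{real_vector, topological_space} set \<Rightarrow> (real \<Rightarrow> 'w) topology" where
  "smooth_curves_topology V =
     topology_generated_by
       {{c \<in> smooth_curves V. \<forall>t\<in>K. (curve_deriv {0..1} ^^ k) c t \<in> W} | k K W.
          compact K \<and> K \<subseteq> {0..1} \<and> open W}"


section \<open>Manifolds modelled on locally convex spaces\<close>

type_synonym ('m, 'e) chart = "'m set \<times> ('m \<Rightarrow> 'e)"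

abbreviation chart_inv :: "('m, 'e) chart \<Rightarrow> 'e \<Rightarrow> 'm" where
  "chart_inv c \<equiv> inv_into (fst c) (snd c)"

definition smooth_manifold :: "'m topology \<Rightarrow> ('m, 'e::locally_convex_space) chart set \<Rightarrow> bool" where
  "smooth_manifold T A \<longleftrightarrow>
     Hausdorff_space T \<and>
     \<Union> (fst ` A) = topspace T \<and>
     (\<forall>c\<in>A. openin T (fst c) \<and> open (snd c ` fst c) \<and>
        homeomorphic_map (subtopology T (fst c)) (top_of_set (snd c ` fst c)) (snd c)) \<and>
     (\<forall>c\<in>A. \<forall>d\<in>A. smooth_on euclidean (snd c ` (fst c \<inter> fst d)) (snd d \<circ> chart_inv c))"

definition prod_atlas :: "('m, 'e) chart set \<Rightarrow> ('n, 'f) chart set \<Rightarrow> ('m \<times> 'n, 'e \<times> 'f) chart set"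
  where "prod_atlas A B = {(fst c \<times> fst d, map_prod (snd c) (snd d)) | c d. c \<in> A \<and> d \<in> B}"

text \<open>Smooth maps from an open subset \<open>U\<close> of a locally convex space \<open>E\<close> to a manifold, smooth maps
  between manifolds, and smooth curves \<open>[0,1] \<rightarrow> M\<close>.\<close>

definition smooth_into ::
  "'v::real_vector topology \<Rightarrow> 'v set \<Rightarrow> 'm topology \<Rightarrow> ('m, 'e::{real_vector, t2_space}) chart set \<Rightarrow>
    ('v \<Rightarrow> 'm) \<Rightarrow> bool" where
  "smooth_into E U T A f \<longleftrightarrow>
     continuous_map (subtopology E U) T f \<and>
     (\<forall>d\<in>A. smooth_on E {x \<in> U. f x \<in> fst d} (snd d \<circ> f))"

definition smooth_map ::
  "'m topology \<Rightarrow> ('m, 'e::{real_vector, t2_space}) chart set \<Rightarrow>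
    'n topology \<Rightarrow> ('n, 'f::{real_vector, t2_space}) chart set \<Rightarrow> ('m \<Rightarrow> 'n) \<Rightarrow> bool" where
  "smooth_map S A T B f \<longleftrightarrow>
     continuous_map S T f \<and>
     (\<forall>c\<in>A. smooth_into euclidean (snd c ` fst c) T B (f \<circ> chart_inv c))"

definition smooth_path ::
  "'m topology \<Rightarrow> ('m, 'e::{real_vector, t2_space}) chart set \<Rightarrow> (real \<Rightarrow> 'm) \<Rightarrow> bool" where
  "smooth_path T A \<gamma> \<longleftrightarrow>
     continuous_map (top_of_set {0..1}) T \<gamma> \<and>
     (\<forall>d\<in>A. smooth_curve_on {t \<in> {0..1}. \<gamma> t \<in> fst d} (snd d \<circ> \<gamma>))"


section \<open>Tangent vectors\<close>

text \<open>A tangent vector at \<open>p\<close> is a family of coordinate vectors, one for each chart around \<open>p\<close>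
  (and 0 at all other pairs), that transforms under changes of charts by the derivative of the
  transition map. The topology that a tangent space inherits from the product topology on the
  function type is the one for which each coordinate map to the model space is a homeomorphism.\<close>

type_synonym ('m, 'e) tvec = "('m, 'e) chart \<Rightarrow> 'e"

definition tangent_space ::
  "('m, 'e::{real_vector, t2_space}) chart set \<Rightarrow> 'm \<Rightarrow> ('m, 'e) tvec set" where
  "tangent_space A p =
     {v. (\<forall>c. \<not> (c \<in> A \<and> p \<in> fst c) \<longrightarrow> v c = 0) \<and>
         (\<forall>c\<in>A. \<forall>d\<in>A. p \<in> fst c \<longrightarrow> p \<in> fst d \<longrightarrow>
            v d = dir_deriv (snd d \<circ> chart_inv c) (snd c p) (v c))}"

text \<open>The tangent vector at \<open>p\<close> with coordinate vector \<open>u\<close> in the chart \<open>c\<close>.\<close>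

definition tvec_of ::
  "('m, 'e::{real_vector, t2_space}) chart set \<Rightarrow> ('m, 'e) chart \<Rightarrow> 'm \<Rightarrow> 'e \<Rightarrow> ('m, 'e) tvec" where
  "tvec_of A c p u =
     (\<lambda>d. if d \<in> A \<and> p \<in> fst d then dir_deriv (snd d \<circ> chart_inv c) (snd c p) u else 0)"

definition tangent_map ::
  "('m, 'e::{real_vector, t2_space}) chart set \<Rightarrow> ('n, 'f::{real_vector, t2_space}) chart set \<Rightarrow>
    ('m \<Rightarrow> 'n) \<Rightarrow> 'm \<Rightarrow> ('m, 'e) tvec \<Rightarrow> ('n, 'f) tvec" where
  "tangent_map A B f p v =
     (let c = (SOME c. c \<in> A \<and> p \<in> fst c) in
      (\<lambda>d. if d \<in> B \<and> f p \<in> fst d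
           then dir_deriv (snd d \<circ> f \<circ> chart_inv c) (snd c p) (v c) else 0))"

definition velocity ::
  "('m, 'e::{real_vector, t2_space}) chart set \<Rightarrow> (real \<Rightarrow> 'm) \<Rightarrow> real \<Rightarrow> ('m, 'e) tvec" where
  "velocity A \<gamma> t =
     (\<lambda>d. if d \<in> A \<and> \<gamma> t \<in> fst d then curve_deriv {0..1} (snd d \<circ> \<gamma>) t else 0)"

text \<open>In a chart, the bracket of vector fields is \<open>[X,Y] = dY \<cdot> X - dX \<cdot> Y\<close>.\<close>

definition vf_bracket ::
  "('m, 'e::{real_vector, t2_space}) chart set \<Rightarrow> ('m \<Rightarrow> ('m, 'e) tvec) \<Rightarrow> ('m \<Rightarrow> ('m, 'e) tvec) \<Rightarrow>
    'm \<Rightarrow> ('m, 'e) tvec" where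
  "vf_bracket A X Y p =
     (\<lambda>c. if c \<in> A \<and> p \<in> fst c
          then dir_deriv (\<lambda>x. Y (chart_inv c x) c) (snd c p) (X p c)
             - dir_deriv (\<lambda>x. X (chart_inv c x) c) (snd c p) (Y p c)
          else 0)"


section \<open>Alternating forms and differential 2-forms\<close>

text \<open>Forms are normalised to vanish outside their domain, so that they form a linear subspace of
  the function type.\<close>

definition alternating_bilinear_on ::
  "'v set \<Rightarrow> ('v \<Rightarrow> 'v \<Rightarrow> 'v) \<Rightarrow> (real \<Rightarrow> 'v \<Rightarrow> 'v) \<Rightarrow> ('v \<Rightarrow> 'v \<Rightarrow> real) \<Rightarrow> bool" where
  "alternating_bilinear_on V plus' scale' B \<longleftrightarrow>
     (\<forall>x\<in>V. \<forall>y\<in>V. \<forall>z\<in>V. B (plus' x y) z = B x z + B y z \<and> B z (plus' x y) = B z x + B z y) \<and>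
     (\<forall>r. \<forall>x\<in>V. \<forall>y\<in>V. B (scale' r x) y = r * B x y \<and> B x (scale' r y) = r * B x y) \<and>
     (\<forall>x\<in>V. B x x = 0) \<and>
     (\<forall>x y. \<not> (x \<in> V \<and> y \<in> V) \<longrightarrow> B x y = 0)"

definition two_forms ::
  "'m topology \<Rightarrow> ('m, 'e::{real_vector, t2_space}) chart set \<Rightarrow>
    ('m \<Rightarrow> ('m, 'e) tvec \<Rightarrow> ('m, 'e) tvec \<Rightarrow> real) set" where
  "two_forms T A =
     {\<eta>. (\<forall>p\<in>topspace T. alternating_bilinear_on (tangent_space A p) (+) (*\<^sub>R) (\<eta> p)) \<and>
         (\<forall>p. p \<notin> topspace T \<longrightarrow> \<eta> p = 0) \<and>
         (\<forall>c\<in>A. smooth_on euclidean ((snd c ` fst c) \<times> UNIV \<times> UNIV)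
            (\<lambda>(x, u, w). \<eta> (chart_inv c x)
               (tvec_of A c (chart_inv c x) u) (tvec_of A c (chart_inv c x) w)))}"

text \<open>Pullback along a smooth self-map.\<close>

definition pullback ::
  "'m topology \<Rightarrow> ('m, 'e::{real_vector, t2_space}) chart set \<Rightarrow> ('m \<Rightarrow> 'm) \<Rightarrow>
    ('m \<Rightarrow> ('m, 'e) tvec \<Rightarrow> ('m, 'e) tvec \<Rightarrow> real) \<Rightarrow>
    ('m \<Rightarrow> ('m, 'e) tvec \<Rightarrow> ('m, 'e) tvec \<Rightarrow> real)" where
  "pullback T A f \<eta> =
     (\<lambda>p v w. if p \<in> topspace T \<and> v \<in> tangent_space A p \<and> w \<in> tangent_space A p
              then \<eta> (f p) (tangent_map A A f p v) (tangent_map A A f p w) else 0)"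


section \<open>Lie groups\<close>

definition lie_group ::
  "('g, 'x) monoid_scheme \<Rightarrow> 'g topology \<Rightarrow> ('g, 'e::locally_convex_space) chart set \<Rightarrow> bool" where
  "lie_group G T A \<longleftrightarrow>
     group G \<and> carrier G = topspace T \<and> smooth_manifold T A \<and>
     smooth_map (prod_topology T T) (prod_atlas A A) T A (\<lambda>(x, y). x \<otimes>\<^bsub>G\<^esub> y) \<and>
     smooth_map T A T A (\<lambda>x. inv\<^bsub>G\<^esub> x)"

definition lie_algebra ::
  "('g, 'x) monoid_scheme \<Rightarrow> ('g, 'e::locally_convex_space) chart set \<Rightarrow> ('g, 'e) tvec set" where
  "lie_algebra G A = tangent_space A \<one>\<^bsub>G\<^esub>"

definition left_invariant_field ::
  "('g, 'x) monoid_scheme \<Rightarrow> ('g, 'e::locally_convex_space) chart set \<Rightarrow>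
    ('g, 'e) tvec \<Rightarrow> 'g \<Rightarrow> ('g, 'e) tvec" where
  "left_invariant_field G A v g = tangent_map A A (\<lambda>x. g \<otimes>\<^bsub>G\<^esub> x) \<one>\<^bsub>G\<^esub> v"

definition lie_bracket ::
  "('g, 'x) monoid_scheme \<Rightarrow> ('g, 'e::locally_convex_space) chart set \<Rightarrow>
    ('g, 'e) tvec \<Rightarrow> ('g, 'e) tvec \<Rightarrow> ('g, 'e) tvec" where
  "lie_bracket G A v w =
     vf_bracket A (left_invariant_field G A v) (left_invariant_field G A w) \<one>\<^bsub>G\<^esub>"

definition left_log_deriv ::
  "('g, 'x) monoid_scheme \<Rightarrow> ('g, 'e::locally_convex_space) chart set \<Rightarrow>
    (real \<Rightarrow> 'g) \<Rightarrow> real \<Rightarrow> ('g, 'e) tvec" where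
  "left_log_deriv G A \<gamma> t =
     tangent_map A A (\<lambda>x. inv\<^bsub>G\<^esub> (\<gamma> t) \<otimes>\<^bsub>G\<^esub> x) (\<gamma> t) (velocity A \<gamma> t)"

text \<open>\<open>\<Gamma> c\<close> is the curve with left logarithmic derivative \<open>c\<close> starting at the identity. It is
  uniquely determined on \<open>[0,1]\<close>.\<close>

definition milnor_regular ::
  "('g, 'x) monoid_scheme \<Rightarrow> 'g topology \<Rightarrow> ('g, 'e::locally_convex_space) chart set \<Rightarrow> bool" where
  "milnor_regular G T A \<longleftrightarrow>
     (\<exists>\<Gamma> :: (real \<Rightarrow> ('g, 'e) tvec) \<Rightarrow> real \<Rightarrow> 'g.
        (\<forall>c \<in> smooth_curves (lie_algebra G A).
           smooth_path T A (\<Gamma> c) \<and> \<Gamma> c 0 = \<one>\<^bsub>G\<^esub> \<and>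
           (\<forall>t\<in>{0..1}. left_log_deriv G A (\<Gamma> c) t = c t)) \<and>
        smooth_into (smooth_curves_topology (lie_algebra G A)) (smooth_curves (lie_algebra G A))
          T A (\<lambda>c. \<Gamma> c 1))"

definition bi_invariant_two_forms ::
  "('g, 'x) monoid_scheme \<Rightarrow> 'g topology \<Rightarrow> ('g, 'e::locally_convex_space) chart set \<Rightarrow>
    ('g \<Rightarrow> ('g, 'e) tvec \<Rightarrow> ('g, 'e) tvec \<Rightarrow> real) set" where
  "bi_invariant_two_forms G T A =
     {\<eta> \<in> two_forms T A. \<forall>g\<in>carrier G.
        pullback T A (\<lambda>x. g \<otimes>\<^bsub>G\<^esub> x) \<eta> = \<eta> \<and> pullback T A (\<lambda>x. x \<otimes>\<^bsub>G\<^esub> g) \<eta> = \<eta>}"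


section \<open>The topological abelianisation\<close>

definition derived_ideal ::
  "('g, 'x) monoid_scheme \<Rightarrow> ('g, 'e::locally_convex_space) chart set \<Rightarrow> ('g, 'e) tvec set" where
  "derived_ideal G A =
     Abstract_Topology.closure_of (top_of_set (lie_algebra G A))
       (span {lie_bracket G A v w | v w. v \<in> lie_algebra G A \<and> w \<in> lie_algebra G A})"

definition quotient_topology :: "'a topology \<Rightarrow> ('a \<Rightarrow> 'b) \<Rightarrow> 'b topology" where
  "quotient_topology X q =
     topology (\<lambda>U. U \<subseteq> q ` topspace X \<and> openin X {x \<in> topspace X. q x \<in> U})"

lemma openin_quotient_topology:
  "openin (quotient_topology X q) U \<longleftrightarrow>
     U \<subseteq> q ` topspace X \<and> openin X {x \<in> topspace X. q x \<in> U}"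
proof -
  let ?P = "\<lambda>U. U \<subseteq> q ` topspace X \<and> openin X {x \<in> topspace X. q x \<in> U}"
  have "istopology ?P"
    unfolding istopology_def
  proof (intro conjI allI impI)
    fix S T assume S: "?P S" and T: "?P T"
    have eq: "{x \<in> topspace X. q x \<in> S \<inter> T} =
        {x \<in> topspace X. q x \<in> S} \<inter> {x \<in> topspace X. q x \<in> T}" by auto
    show "openin X {x \<in> topspace X. q x \<in> S \<inter> T}"
      unfolding eq by (rule openin_Int[OF conjunct2[OF S] conjunct2[OF T]])
    from S show "S \<inter> T \<subseteq> q ` topspace X" by auto
  next
    fix \<K> assume \<K>: "\<forall>K\<in>\<K>. ?P K"
    have "{x \<in> topspace X. q x \<in> \<Union> \<K>} = (\<Union>K\<in>\<K>. {x \<in> topspace X. q x \<in> K})"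
      by auto
    with \<K> show "openin X {x \<in> topspace X. q x \<in> \<Union> \<K>}" by auto
    from \<K> show "\<Union> \<K> \<subseteq> q ` topspace X" by auto
  qed
  then show ?thesis
    by (simp add: quotient_topology_def topology_inverse')
qed

lemma topspace_quotient_topology [simp]: "topspace (quotient_topology X q) = q ` topspace X"
proof -
  have "{x \<in> topspace X. q x \<in> q ` topspace X} = topspace X" by auto
  then have "openin (quotient_topology X q) (q ` topspace X)"
    by (simp add: openin_quotient_topology)
  moreover have "topspace (quotient_topology X q) \<subseteq> q ` topspace X"
    using openin_topspace[of "quotient_topology X q"] unfolding openin_quotient_topology
    by (rule conjunct1)
  ultimately show ?thesis
    by (intro equalityI openin_subset)
qed

lemma quotient_map_quotient_topology: "quotient_map X (quotient_topology X q) q"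
  unfolding quotient_map_def openin_quotient_topology by simp

text \<open>Cosets of a linear subspace \<open>N\<close> and the vector space operations on them. The summand in \<open>N\<close>
  in the scalar multiple matters only for the scalar 0.\<close>

definition vcoset :: "'v::real_vector set \<Rightarrow> 'v \<Rightarrow> 'v set" where
  "vcoset N x = {x + n | n. n \<in> N}"

definition vcoset_add :: "'v::real_vector set \<Rightarrow> 'v set \<Rightarrow> 'v set" where
  "vcoset_add X Y = {x + y | x y. x \<in> X \<and> y \<in> Y}"

definition vcoset_scale :: "'v::real_vector set \<Rightarrow> real \<Rightarrow> 'v set \<Rightarrow> 'v set" where
  "vcoset_scale N r X = {r *\<^sub>R x + n | x n. x \<in> X \<and> n \<in> N}"

lemma vcoset_add_vcoset:
  assumes "subspace N"
  shows "vcoset_add (vcoset N x) (vcoset N y) = vcoset N (x + y)"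
proof (intro equalityI subsetI)
  fix z assume "z \<in> vcoset_add (vcoset N x) (vcoset N y)"
  then obtain m n where "m \<in> N" "n \<in> N" "z = (x + m) + (y + n)"
    by (auto simp: vcoset_def vcoset_add_def)
  then have "z = (x + y) + (m + n)" "m + n \<in> N"
    using assms by (auto simp: algebra_simps subspace_add)
  then show "z \<in> vcoset N (x + y)" by (auto simp: vcoset_def)
next
  fix z assume "z \<in> vcoset N (x + y)"
  then obtain n where "n \<in> N" "z = (x + 0) + (y + n)"
    by (auto simp: vcoset_def algebra_simps)
  then show "z \<in> vcoset_add (vcoset N x) (vcoset N y)"
    using subspace_0[OF assms] unfolding vcoset_def vcoset_add_def by blast
qed

lemma vcoset_scale_vcoset:
  assumes "subspace N"
  shows "vcoset_scale N r (vcoset N x) = vcoset N (r *\<^sub>R x)"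
proof (intro equalityI subsetI)
  fix z assume "z \<in> vcoset_scale N r (vcoset N x)"
  then obtain m n where "m \<in> N" "n \<in> N" "z = r *\<^sub>R (x + m) + n"
    by (auto simp: vcoset_def vcoset_scale_def)
  then have "z = r *\<^sub>R x + (r *\<^sub>R m + n)" "r *\<^sub>R m + n \<in> N"
    using assms by (auto simp: algebra_simps subspace_add subspace_scale)
  then show "z \<in> vcoset N (r *\<^sub>R x)" by (auto simp: vcoset_def)
next
  fix z assume "z \<in> vcoset N (r *\<^sub>R x)"
  then obtain n where "n \<in> N" "z = r *\<^sub>R (x + 0) + n"
    by (auto simp: vcoset_def)
  then show "z \<in> vcoset_scale N r (vcoset N x)"
    using subspace_0[OF assms] unfolding vcoset_def vcoset_scale_def by blast
qed

definition abelianisation ::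
  "('g, 'x) monoid_scheme \<Rightarrow> ('g, 'e::locally_convex_space) chart set \<Rightarrow>
    ('g, 'e) tvec set topology" where
  "abelianisation G A =
     quotient_topology (top_of_set (lie_algebra G A)) (vcoset (derived_ideal G A))"

text \<open>Continuous alternating bilinear forms on \<open>\<aa> = \<gg> / closure [\<gg>,\<gg>]\<close>.\<close>

definition abelianisation_two_forms ::
  "('g, 'x) monoid_scheme \<Rightarrow> ('g, 'e::locally_convex_space) chart set \<Rightarrow>
    (('g, 'e) tvec set \<Rightarrow> ('g, 'e) tvec set \<Rightarrow> real) set" where
  "abelianisation_two_forms G A =
     {B. alternating_bilinear_on (topspace (abelianisation G A))
           vcoset_add (vcoset_scale (derived_ideal G A)) B \<and>
         continuous_map (prod_topology (abelianisation G A) (abelianisation G A)) euclideanreal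
           (\<lambda>(X, Y). B X Y)}"


section \<open>Isomorphism of vector spaces\<close>

definition isomorphic_subspaces :: "'v::real_vector set \<Rightarrow> 'w::real_vector set \<Rightarrow> bool" where
  "isomorphic_subspaces V W \<longleftrightarrow>
     subspace V \<and> subspace W \<and>
     (\<exists>\<Phi>. bij_betw \<Phi> V W \<and>
          (\<forall>x\<in>V. \<forall>y\<in>V. \<Phi> (x + y) = \<Phi> x + \<Phi> y) \<and>
          (\<forall>r. \<forall>x\<in>V. \<Phi> (r *\<^sub>R x) = r *\<^sub>R \<Phi> x))"

end

theory Submission
  imports Defs
begin

text \<open>
A left-invariant 2-form \<open>\<eta>\<close> is determined by its value \<open>\<omega>\<close> at the identity, a continuous alternating
form on the Lie algebra, and every such \<open>\<omega>\<close> extends to a left-invariant form. The theorem says that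
the extension is right-invariant exactly if \<open>\<omega>\<close> vanishes when one argument is a bracket; by continuity
\<open>\<omega>\<close> then vanishes on the closed derived ideal, so that it is a form on the abelianisation.

The link between the two conditions is the function \<open>h \<mapsto> \<eta>\<^sub>h(dR\<^sub>h v, dR\<^sub>h w)\<close> on the group, called
\<open>right_transport\<close> below: a left-invariant \<open>\<eta>\<close> is right-invariant if and only if this function is constant
for all \<open>v, w\<close>. Its derivative at the identity in direction \<open>u\<close> is \<open>\<omega>([v,u], w) + \<omega>(v, [w,u])\<close>
(\<open>right_transport_strict_deriv\<close>). To see this, work in a chart around the identity and compare with
\<open>\<eta>\<^sub>h(dL\<^sub>h v, dL\<^sub>h w)\<close>, which is constant because \<open>\<eta>\<close> is left-invariant. In the difference of
the two derivatives the derivative of \<open>\<eta>\<close> in the base point cancels, and what remains are mixed second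
derivatives of the multiplication, which combine to brackets because second derivatives are symmetric.

If \<open>\<eta>\<close> is bi-invariant, then \<open>\<omega>([v,u], w) + \<omega>(v, [w,u]) = 0\<close>. Hence \<open>\<omega>([x,y], z)\<close> is
symmetric under exchange of \<open>x\<close> and \<open>z\<close>; it is antisymmetric in \<open>x\<close> and \<open>y\<close>, and only zero has both
properties (\<open>bi_invariant_kills_brackets\<close>). Conversely, let \<open>\<omega>\<close> vanish on brackets. Then
all the functions \<open>right_transport\<close> have derivative zero at the identity. Left invariance expresses the function
for \<open>v, w\<close> near \<open>g\<close> by the one for \<open>Ad(g\<^sup>-\<^sup>1) v, Ad(g\<^sup>-\<^sup>1) w\<close> near the identity, so the
derivative is zero everywhere, and the functions are constant on the connected group
(\<open>left_invariant_imp_bi_invariant\<close>).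

The model space is only locally convex, so there are no norm estimates. Their place is taken by a mean
value theorem for open convex sets (\<open>convex_mean_value\<close>) and by the notion \<open>strict_deriv\<close>, in which base
point and direction of a difference quotient may move; both the chain rule and the linearity of the
derivative are then immediate. Smoothness of the left-invariant extension needs
the composition of smooth maps to be smooth, which is Faa di Bruno's formula (\<open>smooth_on_compose\<close>).\<close>

section \<open>Locally convex spaces\<close>

lemma tendsto_scaleR_lcs:
  fixes g :: "'a \<Rightarrow> 'b::locally_convex_space"
  assumes "(f \<longlongrightarrow> r) F" "(g \<longlongrightarrow> x) F"
  shows "((\<lambda>z. f z *\<^sub>R g z) \<longlongrightarrow> r *\<^sub>R x) F"
  using filterlim_compose[OF tendsto_scaleR_nhds filterlim_Pair[OF assms]] by simp

lemma continuous_on_scaleR_lcs: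
  fixes g :: "'a::topological_space \<Rightarrow> 'b::locally_convex_space"
  assumes "continuous_on S f" "continuous_on S g"
  shows "continuous_on S (\<lambda>z. f z *\<^sub>R g z)"
  using assms unfolding continuous_on_def by (auto intro: tendsto_scaleR_lcs)

lemma open_translation_lcs:
  fixes U :: "'a::locally_convex_space set"
  assumes "open U"
  shows "open ((\<lambda>x. a + x) ` U)"
proof -
  have "(\<lambda>x. a + x) ` U = (\<lambda>x. x - a) -` U"
    by (force simp: image_iff algebra_simps)
  moreover have "open ((\<lambda>x. x - a) -` U)"
    by (intro open_vimage assms continuous_intros)
  ultimately show ?thesis by simp
qed

lemma convex_nhd:
  fixes U :: "'a::locally_convex_space set"
  assumes "open U" "x \<in> U"
  obtains C where "convex C" "open C" "x \<in> C" "C \<subseteq> U"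
proof -
  have op: "open ((\<lambda>y. - x + y) ` U)"
    by (rule open_translation_lcs[OF assms(1)])
  have mem: "0 \<in> (\<lambda>y. - x + y) ` U"
    using assms(2) by (intro image_eqI[of _ _ x]) auto
  obtain C where C: "convex C" "open C" "0 \<in> C" "C \<subseteq> (\<lambda>y. - x + y) ` U"
    using locally_convex[OF op mem] by blast
  show ?thesis
  proof
    show "convex ((\<lambda>y. x + y) ` C)" using C(1) by (simp add: convex_translation)
    show "open ((\<lambda>y. x + y) ` C)" using C(2) by (rule open_translation_lcs)
    show "x \<in> (\<lambda>y. x + y) ` C" using C(3) by force
    show "(\<lambda>y. x + y) ` C \<subseteq> U" using C(4) by force
  qed
qed

text \<open>The closure of the span of the brackets has to be a linear subspace for the cosets of the derived
  ideal to form a vector space.\<close>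

lemma closure_subspace_lcs:
  fixes S :: "'v::locally_convex_space set"
  assumes S: "subspace S"
  shows "subspace (closure S)"
proof (rule subspaceI)
  show "0 \<in> closure S" using closure_subset subspace_0[OF S] by blast
  have "(\<lambda>p. fst p + snd p) ` closure (S \<times> S) \<subseteq> closure S"
    using subspace_add[OF S]
    by (intro image_closure_subset continuous_intros) (auto intro!: subsetD[OF closure_subset])
  then show "x + y \<in> closure S" if "x \<in> closure S" "y \<in> closure S" for x y
    using that by (force simp: closure_Times)
  have "(\<lambda>x. r *\<^sub>R x) ` closure S \<subseteq> closure S" for r
    using subspace_scale[OF S]
    by (intro image_closure_subset continuous_on_scaleR_lcs continuous_intros) (auto intro!: subsetD[OF closure_subset])
  then show "r *\<^sub>R x \<in> closure S" if "x \<in> closure S" for r x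
    using that by blast
qed

text \<open>Group multiplication in a chart is a map on a product of two copies of the model space, and 2-forms
  in a chart are functions on a product of three; the calculus below is applied to these products.\<close>

instance prod :: (topological_monoid_add, topological_monoid_add) topological_monoid_add
proof
  fix a b :: "'a \<times> 'b"
  let ?F = "nhds a \<times>\<^sub>F nhds b"
  have 1: "(fst \<longlongrightarrow> a) ?F" "(snd \<longlongrightarrow> b) ?F"
    by (auto intro: filterlim_fst filterlim_snd)
  have "((\<lambda>x. (fst (fst x) + fst (snd x), snd (fst x) + snd (snd x)))
      \<longlongrightarrow> (fst a + fst b, snd a + snd b)) ?F"
    by (intro tendsto_intros 1)
  then show "LIM x ?F. fst x + snd x :> nhds (a + b)"
    by (simp add: plus_prod_def)
qed

instance prod :: (topological_group_add, topological_group_add) topological_group_add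
proof
  fix a :: "'a \<times> 'b"
  have "((\<lambda>x. (- fst x, - snd x)) \<longlongrightarrow> (- fst a, - snd a)) (nhds a)"
    by (intro tendsto_intros filterlim_ident)
  then have "((\<lambda>x. (- fst x, - snd x)) \<longlongrightarrow> - a) (nhds a)"
    by (simp add: uminus_prod_def)
  then show "(uminus \<longlongrightarrow> - a) (nhds a)"
    by (rule Lim_transform_eventually) (simp add: uminus_prod_def)
qed

instance prod :: (topological_ab_group_add, topological_ab_group_add) topological_ab_group_add ..

instance prod :: (locally_convex_space, locally_convex_space) locally_convex_space
proof
  fix r :: real and x :: "'a \<times> 'b"
  let ?F = "nhds r \<times>\<^sub>F nhds x"
  have 1: "(fst \<longlongrightarrow> r) ?F" "(snd \<longlongrightarrow> x) ?F"
    by (auto intro: filterlim_fst filterlim_snd)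
  have "((\<lambda>p. (fst p *\<^sub>R fst (snd p), fst p *\<^sub>R snd (snd p)))
      \<longlongrightarrow> (r *\<^sub>R fst x, r *\<^sub>R snd x)) ?F"
    by (intro tendsto_Pair tendsto_scaleR_lcs 1 tendsto_fst[OF 1(2)] tendsto_snd[OF 1(2)])
  then show "filterlim (\<lambda>p. fst p *\<^sub>R snd p) (nhds (r *\<^sub>R x)) ?F"
    by (simp only: scaleR_prod_def)
next
  fix U :: "('a \<times> 'b) set" assume U: "open U" "0 \<in> U"
  then obtain A B where AB: "open A" "open B" "(0::'a) \<in> A" "(0::'b) \<in> B" "A \<times> B \<subseteq> U"
    by (metis open_prod_elim mem_Sigma_iff zero_prod_def)
  obtain C D where C: "convex C" "open C" "0 \<in> C" "C \<subseteq> A"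
    and D: "convex D" "open D" "0 \<in> D" "D \<subseteq> B"
    using locally_convex AB by metis
  have "convex (C \<times> D)" "open (C \<times> D)" "0 \<in> C \<times> D" "C \<times> D \<subseteq> U"
    using C D AB(5) by (auto intro!: convex_Times open_Times simp: zero_prod_def)
  then show "\<exists>C. (\<forall>x\<in>C. \<forall>y\<in>C. \<forall>u\<ge>0. \<forall>v\<ge>0. u + v = 1 \<longrightarrow> u *\<^sub>R x + v *\<^sub>R y \<in> C) \<and>
         open C \<and> 0 \<in> C \<and> C \<subseteq> U"
    unfolding convex_def by (intro exI[of _ "C \<times> D"] conjI)
qed

abbreviation diff_quot :: "('v::real_vector \<Rightarrow> 'w::real_vector) \<Rightarrow> 'v \<Rightarrow> 'v \<Rightarrow> real \<Rightarrow> 'w"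
  where "diff_quot f x v t \<equiv> (f (x + t *\<^sub>R v) - f x) /\<^sub>R t"

text \<open>The difference quotient over an interval is a convex combination of the quotients over its two
  parts. So membership in \<open>W\<close> passes from short intervals to long ones, and by compactness only short
  intervals around a point matter. There it holds since \<open>W\<close> is a neighbourhood of the derivative.\<close>

lemma convex_mean_value:
  fixes f :: "real \<Rightarrow> 'a::locally_convex_space"
  assumes W: "open W" "convex W" and "a < b"
    and der: "\<And>t. t \<in> {a..b} \<Longrightarrow> ((\<lambda>s. (f (t + s) - f t) /\<^sub>R s) \<longlongrightarrow> f' t) (at 0)"
    and W': "\<And>t. t \<in> {a..b} \<Longrightarrow> f' t \<in> W"
  shows "(f b - f a) /\<^sub>R (b - a) \<in> W"
proof -
  let ?q = "\<lambda>x y. (f y - f x) /\<^sub>R (y - x)"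
  define P where "P x y \<longleftrightarrow> (a \<le> x \<longrightarrow> y \<le> b \<longrightarrow> x < y \<longrightarrow> ?q x y \<in> W)" for x y
  have comb: "?q x z \<in> W" if "?q x y \<in> W" "?q y z \<in> W" "x < y" "y < z" for x y z
  proof -
    have "((y - x) / (z - x)) *\<^sub>R ?q x y + ((z - y) / (z - x)) *\<^sub>R ?q y z \<in> W"
      using that by (intro convexD[OF W(2)]) (simp_all add: add_divide_distrib[symmetric])
    also have "((y - x) / (z - x)) *\<^sub>R ?q x y + ((z - y) / (z - x)) *\<^sub>R ?q y z
        = (f y - f x) /\<^sub>R (z - x) + (f z - f y) /\<^sub>R (z - x)"
    proof -
      have "(y - x) / (z - x) * inverse (y - x) = inverse (z - x)"
        "(z - y) / (z - x) * inverse (z - y) = inverse (z - x)"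
        using that by (simp_all add: divide_simps)
      then show ?thesis by simp
    qed
    also have "\<dots> = ?q x z"
      by (simp flip: scaleR_add_right)
    finally show ?thesis .
  qed
  have "P a b"
  proof (rule Bolzano)
    show "a \<le> b" using \<open>a < b\<close> by simp
  next
    fix x y z assume "P x y" "P y z" "x \<le> y" "y \<le> z"
    then consider "x = y" | "y = z" | "x < y" "y < z" by linarith
    then show "P x z"
    proof cases
      case 3
      then show ?thesis
        using \<open>P x y\<close> \<open>P y z\<close> comb[OF _ _ 3] unfolding P_def by auto
    qed (use \<open>P x y\<close> \<open>P y z\<close> in simp_all)
  next
    fix x assume "a \<le> x" "x \<le> b"
    then have "\<forall>\<^sub>F s in at 0. (f (x + s) - f x) /\<^sub>R s \<in> W"
      using topological_tendstoD[OF der W(1) W'] by auto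
    then obtain d where d: "d > 0" "\<And>s. s \<noteq> 0 \<Longrightarrow> \<bar>s\<bar> < d \<Longrightarrow> (f (x + s) - f x) /\<^sub>R s \<in> W"
      unfolding eventually_at by (auto simp: dist_real_def)
    have r: "?q x y \<in> W" if "x < y" "y - x < d" for y
      using d(2)[of "y - x"] that by simp
    have l: "?q y x \<in> W" if "y < x" "x - y < d" for y
    proof -
      have "?q y x = (f y - f x) /\<^sub>R (y - x)"
      proof -
        have "inverse (x - y) = - inverse (y - x)"
          by (metis inverse_minus_eq minus_diff_eq)
        then show ?thesis by (simp add: scaleR_diff_right)
      qed
      then show ?thesis using d(2)[of "y - x"] that by simp
    qed
    show "\<exists>d>0. \<forall>y z. y \<le> x \<and> x \<le> z \<and> z - y < d \<longrightarrow> P y z"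
    proof (intro exI[of _ d] conjI allI impI)
      fix y z assume yz: "y \<le> x \<and> x \<le> z \<and> z - y < d"
      then consider "y = x" | "z = x" | "y < x" "x < z" by linarith
      then show "P y z"
      proof cases
        case 3
        then show ?thesis
          using r[of z] l[of y] comb[OF _ _ 3] yz unfolding P_def by auto
      qed (use yz r[of z] l[of y] in \<open>auto simp: P_def\<close>)
    qed (use d in simp)
  qed
  then show ?thesis using \<open>a < b\<close> by (simp add: P_def)
qed

text \<open>Base point and direction of a difference quotient may converge simultaneously, since the mean
  value theorem encloses the quotient by values of the derivative near the limit point. The function \<open>g z\<close>
  may vary as well: below it is a derivative in directions that depend on \<open>z\<close>, or itself
  a difference quotient with increment \<open>z\<close>.\<close>

lemma strict_difference_quotient:
  fixes g :: "'z \<Rightarrow> 'v::locally_convex_space \<Rightarrow> 'w::locally_convex_space"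
  assumes der: "\<forall>\<^sub>F (z, y) in F \<times>\<^sub>F nhds x.
      ((\<lambda>s. diff_quot (g z) y (v z) s) \<longlongrightarrow> g' z y) (at 0)"
    and lim: "((\<lambda>(z, y). g' z y) \<longlongrightarrow> L) (F \<times>\<^sub>F nhds x)"
    and p: "(p \<longlongrightarrow> x) F" and v: "(v \<longlongrightarrow> w) F" and t: "filterlim t (at 0) F"
  shows "((\<lambda>z. (g z (p z + t z *\<^sub>R v z) - g z (p z)) /\<^sub>R t z) \<longlongrightarrow> L) F"
proof (rule topological_tendstoI)
  fix S assume "open S" "L \<in> S"
  then obtain W where W: "convex W" "open W" "L \<in> W" "W \<subseteq> S" by (rule convex_nhd)
  let ?d = "\<lambda>z y. ((\<lambda>s. diff_quot (g z) y (v z) s) \<longlongrightarrow> g' z y) (at 0)"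
  have "\<forall>\<^sub>F (z, y) in F \<times>\<^sub>F nhds x. g' z y \<in> W"
    using topological_tendstoD[OF lim W(2,3)] by (simp add: case_prod_unfold)
  from eventually_conj[OF der this] obtain Pf Pg where
    Pf: "eventually Pf F" and Pg: "eventually Pg (nhds x)"
    and PP: "\<And>z y. Pf z \<Longrightarrow> Pg y \<Longrightarrow> ?d z y \<and> g' z y \<in> W"
    unfolding eventually_prod_filter by auto
  obtain V where V: "open V" "x \<in> V" "\<And>y. y \<in> V \<Longrightarrow> Pg y"
    using Pg unfolding eventually_nhds by auto
  obtain C where C: "convex C" "open C" "x \<in> C" "C \<subseteq> V"
    using convex_nhd[OF V(1,2)] by auto
  have t0: "(t \<longlongrightarrow> 0) F" using t by (simp add: filterlim_at)
  have "((\<lambda>z. p z + t z *\<^sub>R v z) \<longlongrightarrow> x + 0 *\<^sub>R w) F"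
    by (intro tendsto_add tendsto_scaleR_lcs p t0 v)
  then have "\<forall>\<^sub>F z in F. p z + t z *\<^sub>R v z \<in> C"
    using topological_tendstoD C by force
  moreover have "\<forall>\<^sub>F z in F. p z \<in> C" using topological_tendstoD[OF p C(2,3)] .
  moreover have "\<forall>\<^sub>F z in F. t z \<noteq> 0" using t by (simp add: filterlim_at)
  ultimately show "\<forall>\<^sub>F z in F. (g z (p z + t z *\<^sub>R v z) - g z (p z)) /\<^sub>R t z \<in> S"
    using Pf
  proof eventually_elim
    case (elim z)
    define h where "h s = g z (p z + s *\<^sub>R v z)" for s
    have seg: "p z + s *\<^sub>R v z \<in> C" if "s = r * t z" "r \<in> {0..1}" for s r
    proof -
      have "(1 - r) *\<^sub>R p z + r *\<^sub>R (p z + t z *\<^sub>R v z) \<in> C"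
        using that elim(1,2) by (intro convexD[OF C(1)]) auto
      also have "(1 - r) *\<^sub>R p z + r *\<^sub>R (p z + t z *\<^sub>R v z) = p z + s *\<^sub>R v z"
        using that by (simp add: algebra_simps)
      finally show ?thesis .
    qed
    have mv: "(h b - h a) /\<^sub>R (b - a) \<in> W"
      if ab: "a < b" and cl: "\<And>s. s \<in> {a..b} \<Longrightarrow> p z + s *\<^sub>R v z \<in> C" for a b
    proof (rule convex_mean_value[OF W(2,1) ab])
      fix s assume s: "s \<in> {a..b}"
      have "((\<lambda>r. (g z (p z + s *\<^sub>R v z + r *\<^sub>R v z) - g z (p z + s *\<^sub>R v z)) /\<^sub>R r)
          \<longlongrightarrow> g' z (p z + s *\<^sub>R v z)) (at 0)"
        using cl[OF s] C(4) V(3) PP elim(4) by blast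
      then show "((\<lambda>r. (h (s + r) - h s) /\<^sub>R r) \<longlongrightarrow> g' z (p z + s *\<^sub>R v z)) (at 0)"
        by (simp add: h_def scaleR_add_left add.assoc)
      show "g' z (p z + s *\<^sub>R v z) \<in> W"
        using cl[OF s] C(4) V(3) PP elim(4) by blast
    qed
    have "(h (t z) - h 0) /\<^sub>R t z \<in> W"
    proof (cases "t z > 0")
      case True
      have "p z + s *\<^sub>R v z \<in> C" if "s \<in> {0..t z}" for s
        using that True by (intro seg[of s "s / t z"]) auto
      then show ?thesis using mv[of 0 "t z"] True by simp
    next
      case False
      then have neg: "t z < 0" using elim(3) by simp
      have "p z + s *\<^sub>R v z \<in> C" if "s \<in> {t z..0}" for s
        using that neg by (intro seg[of s "s / t z"]) (auto simp: divide_simps)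
      then have "(h 0 - h (t z)) /\<^sub>R (0 - t z) \<in> W" using mv[of "t z" 0] neg by simp
      also have "(h 0 - h (t z)) /\<^sub>R (0 - t z) = (h (t z) - h 0) /\<^sub>R t z"
        by (simp add: scaleR_diff_right)
      finally show ?thesis .
    qed
    then show ?case using W(4) by (auto simp: h_def)
  qed
qed

section \<open>Families of iterated derivatives\<close>

text \<open>The system of iterated derivatives that witnesses smoothness, detached from the function, so that
  it can be manipulated as a whole.\<close>

definition smooth_family ::
  "'v::locally_convex_space set \<Rightarrow> ('v list \<Rightarrow> 'v \<Rightarrow> 'w::locally_convex_space) \<Rightarrow> bool" where
  "smooth_family U D \<longleftrightarrow> open U \<and>
     (\<forall>vs v. \<forall>x\<in>U. ((\<lambda>t. diff_quot (D vs) x v t) \<longlongrightarrow> D (v # vs) x) (at 0)) \<and>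
     (\<forall>k. continuous_map (prod_topology (top_of_set U) (product_topology (\<lambda>_. euclidean) {..<k}))
        euclidean (\<lambda>(x, v). D (map v [0..<k]) x))"

abbreviation smooth :: "'v::locally_convex_space set \<Rightarrow> ('v \<Rightarrow> 'w::locally_convex_space) \<Rightarrow> bool"
  where "smooth U f \<equiv> smooth_on euclidean U f"

lemma smooth_on_iff_family:
  "smooth U f \<longleftrightarrow> (\<exists>D. smooth_family U D \<and> (\<forall>x\<in>U. D [] x = f x))"
  unfolding smooth_on_def smooth_family_def by (simp add: Ball_def conj_commute conj_left_commute ex_simps cong: conj_cong)

lemma smooth_family_open: "smooth_family U D \<Longrightarrow> open U"
  by (simp add: smooth_family_def)

lemma smooth_family_deriv:
  "smooth_family U D \<Longrightarrow> x \<in> U \<Longrightarrow>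
    ((\<lambda>t. diff_quot (D vs) x v t) \<longlongrightarrow> D (v # vs) x) (at 0)"
  by (simp add: smooth_family_def)

text \<open>Joint continuity of the derivatives in terms of limits along an arbitrary filter. This form is
  easier to use than the product topology of the definition, and \<open>smooth_familyI\<close> is its converse.\<close>

lemma smooth_family_tendsto:
  assumes D: "smooth_family U D" and "x \<in> U" and y: "(y \<longlongrightarrow> x) F"
    and len: "\<And>z. length (us z) = length vs"
    and us: "\<And>i. i < length vs \<Longrightarrow> ((\<lambda>z. us z ! i) \<longlongrightarrow> vs ! i) F"
  shows "((\<lambda>z. D (us z) (y z)) \<longlongrightarrow> D vs x) F"
proof -
  let ?k = "length vs"
  let ?X = "prod_topology (top_of_set U) (product_topology (\<lambda>_. euclidean) {..<?k})"
  let ?p = "\<lambda>z. (y z, restrict ((!) (us z)) {..<?k})"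
  have cm: "continuous_map ?X euclidean (\<lambda>(x, v). D (map v [0..<?k]) x)"
    using D by (simp add: smooth_family_def)
  have "limitin ?X ?p (x, restrict ((!) vs) {..<?k}) F"
    unfolding limitin_pairwise limitin_componentwise
    using assms smooth_family_open[OF D] by (auto simp: o_def)
  from continuous_map_limit[OF cm this]
  have "((\<lambda>z. D (map (restrict ((!) (us z)) {..<?k}) [0..<?k]) (y z))
      \<longlongrightarrow> D (map (restrict ((!) vs) {..<?k}) [0..<?k]) x) F"
    by (simp add: o_def)
  moreover have "map (restrict ((!) ws) {..<?k}) [0..<?k] = ws" if "length ws = ?k" for ws :: "'a list"
    using that by (intro nth_equalityI) auto
  ultimately show ?thesis using len by simp
qed

lemma smooth_familyI:
  fixes D :: "'v::locally_convex_space list \<Rightarrow> 'v \<Rightarrow> 'w::locally_convex_space"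
  assumes "open U"
    and "\<And>vs v x. x \<in> U \<Longrightarrow>
      ((\<lambda>t. diff_quot (D vs) x v t) \<longlongrightarrow> D (v # vs) x) (at 0)"
    and lim: "\<And>k x v (F :: ('v \<times> (nat \<Rightarrow> 'v)) filter). x \<in> U \<Longrightarrow> (fst \<longlongrightarrow> x) F \<Longrightarrow>
      \<forall>\<^sub>F z in F. fst z \<in> U \<Longrightarrow> (\<And>i. i < k \<Longrightarrow> ((\<lambda>z. snd z i) \<longlongrightarrow> v i) F) \<Longrightarrow>
      ((\<lambda>z. D (map (snd z) [0..<k]) (fst z)) \<longlongrightarrow> D (map v [0..<k]) x) F"
  shows "smooth_family U D"
  unfolding smooth_family_def
proof (intro conjI allI ballI)
  fix k :: nat
  let ?X = "prod_topology (top_of_set U) (product_topology (\<lambda>_. euclidean :: 'v topology) {..<k})"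
  show "continuous_map ?X euclidean (\<lambda>(x, v). D (map v [0..<k]) x)"
    unfolding continuous_map_atin
  proof
    fix p assume p: "p \<in> topspace ?X"
    have "limitin ?X (\<lambda>z. z) p (atin ?X p)"
      using continuous_map_id[of ?X] p unfolding continuous_map_atin id_def by blast
    then have "limitin (top_of_set U) (\<lambda>z. fst z) (fst p) (atin ?X p)"
      and 2: "\<And>i. i < k \<Longrightarrow> ((\<lambda>z. snd z i) \<longlongrightarrow> snd p i) (atin ?X p)"
      unfolding limitin_pairwise limitin_componentwise by (auto simp: o_def)
    then have "fst p \<in> U" "\<forall>\<^sub>F z in atin ?X p. fst z \<in> U" "(fst \<longlongrightarrow> fst p) (atin ?X p)"
      unfolding limitin_subtopology by auto
    then have "((\<lambda>z. D (map (snd z) [0..<k]) (fst z)) \<longlongrightarrow> D (map (snd p) [0..<k]) (fst p))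
        (atin ?X p)"
      by (intro lim) (auto intro: 2)
    then show "limitin euclidean (\<lambda>(x, v). D (map v [0..<k]) x)
        (case p of (x, v) \<Rightarrow> D (map v [0..<k]) x) (atin ?X p)"
      by (simp add: case_prod_unfold)
  qed
qed (use assms in auto)

lemma smooth_family_strict:
  assumes D: "smooth_family U D" and "x \<in> U" and p: "(p \<longlongrightarrow> x) F"
    and v: "(v \<longlongrightarrow> w) F" and t: "filterlim t (at 0) F"
    and len: "\<And>z. length (us z) = length vs"
    and us: "\<And>i. i < length vs \<Longrightarrow> ((\<lambda>z. us z ! i) \<longlongrightarrow> vs ! i) F"
  shows "((\<lambda>z. (D (us z) (p z + t z *\<^sub>R v z) - D (us z) (p z)) /\<^sub>R t z) \<longlongrightarrow> D (w # vs) x) F"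
proof (rule strict_difference_quotient[OF _ _ p v t])
  have "\<forall>\<^sub>F y in nhds x. y \<in> U"
    using smooth_family_open[OF D] \<open>x \<in> U\<close> by (rule eventually_nhds_in_open)
  then have "\<forall>\<^sub>F z in F \<times>\<^sub>F nhds x. snd z \<in> U"
    unfolding eventually_prod_filter by (intro exI[of _ "\<lambda>_. True"] exI[of _ "\<lambda>y. y \<in> U"]) simp
  then show "\<forall>\<^sub>F (z, y) in F \<times>\<^sub>F nhds x.
      ((\<lambda>s. diff_quot (D (us z)) y (v z) s) \<longlongrightarrow> D (v z # us z) y) (at 0)"
    by eventually_elim (auto intro: smooth_family_deriv[OF D])
  have f: "filterlim fst F (F \<times>\<^sub>F nhds x)" by (rule filterlim_fst)
  have "((\<lambda>z. D (v (fst z) # us (fst z)) (snd z)) \<longlongrightarrow> D (w # vs) x) (F \<times>\<^sub>F nhds x)"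
  proof (rule smooth_family_tendsto[OF D \<open>x \<in> U\<close>])
    show "(snd \<longlongrightarrow> x) (F \<times>\<^sub>F nhds x)" by (rule filterlim_snd)
    show "length (v (fst z) # us (fst z)) = length (w # vs)" for z :: "'c \<times> 'a"
      using len by simp
    show "((\<lambda>z. (v (fst z) # us (fst z)) ! i) \<longlongrightarrow> (w # vs) ! i) (F \<times>\<^sub>F nhds x)"
      if "i < length (w # vs)" for i
      using that filterlim_compose[OF v f] filterlim_compose[OF us f] by (cases i) auto
  qed
  then show "((\<lambda>(z, y). D (v z # us z) y) \<longlongrightarrow> D (w # vs) x) (F \<times>\<^sub>F nhds x)"
    by (simp add: case_prod_unfold)
qed

section \<open>Strict directional derivatives\<close>

text \<open>Base point and direction vary in the difference quotient. Directional derivatives at a single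
  point need not be linear in the direction and need not obey the chain rule; strict derivatives are
  linear and obey it, and smooth maps have them (\<open>smooth_on_strict_deriv\<close>).\<close>

definition strict_deriv ::
  "('v::locally_convex_space \<Rightarrow> 'w::locally_convex_space) \<Rightarrow> ('v \<Rightarrow> 'w) \<Rightarrow> 'v \<Rightarrow> bool"
  where "strict_deriv f f' x \<longleftrightarrow> isCont f x \<and>
     (\<forall>w. ((\<lambda>(t, p, v). diff_quot f p v t) \<longlongrightarrow> f' w) (at 0 \<times>\<^sub>F (nhds x \<times>\<^sub>F nhds w)))"

lemma strict_deriv_isCont: "strict_deriv f f' x \<Longrightarrow> isCont f x"
  by (simp add: strict_deriv_def)

lemma strict_deriv_tendsto:
  assumes "strict_deriv f f' x" "filterlim t (at 0) F" "(p \<longlongrightarrow> x) F" "(v \<longlongrightarrow> w) F"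
  shows "((\<lambda>z. (f (p z + t z *\<^sub>R v z) - f (p z)) /\<^sub>R t z) \<longlongrightarrow> f' w) F"
proof -
  have "((\<lambda>(t, p, v). diff_quot f p v t) \<longlongrightarrow> f' w) (at 0 \<times>\<^sub>F (nhds x \<times>\<^sub>F nhds w))"
    using assms(1) by (simp add: strict_deriv_def)
  from filterlim_compose[OF this filterlim_Pair[OF assms(2) filterlim_Pair[OF assms(3,4)]]]
  show ?thesis by simp
qed

lemma at_zero_ident: "filterlim (\<lambda>t. t) (at 0) (at (0::real))"
  by (simp add: filterlim_ident)

lemma strict_derivI:
  assumes "isCont f x"
    and "\<And>w. ((\<lambda>z. diff_quot f (fst (snd z)) (snd (snd z)) (fst z)) \<longlongrightarrow> f' w)
      (at 0 \<times>\<^sub>F (nhds x \<times>\<^sub>F nhds w))"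
  shows "strict_deriv f f' x"
  unfolding strict_deriv_def using assms by (simp add: case_prod_unfold)

lemma triple_filter_tendsto:
  "filterlim fst (at 0) (at 0 \<times>\<^sub>F (nhds x \<times>\<^sub>F nhds w))"
  "((\<lambda>z. fst (snd z)) \<longlongrightarrow> x) (at 0 \<times>\<^sub>F (nhds x \<times>\<^sub>F nhds w))"
  "((\<lambda>z. snd (snd z)) \<longlongrightarrow> w) (at 0 \<times>\<^sub>F (nhds x \<times>\<^sub>F nhds w))"
  by (auto intro: filterlim_fst filterlim_compose[OF filterlim_fst filterlim_snd]
      filterlim_compose[OF filterlim_snd filterlim_snd])

lemma strict_deriv_dir:
  assumes "strict_deriv f f' x"
  shows "((\<lambda>t. diff_quot f x v t) \<longlongrightarrow> f' v) (at 0)"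
  by (rule strict_deriv_tendsto[OF assms at_zero_ident]) auto

lemma dir_deriv_eq:
  fixes f :: "'v::locally_convex_space \<Rightarrow> 'w::locally_convex_space"
  assumes "((\<lambda>t. diff_quot f x v t) \<longlongrightarrow> l) (at 0)"
  shows "dir_deriv f x v = l"
  unfolding dir_deriv_def by (rule tendsto_Lim[OF _ assms]) simp

lemma strict_deriv_dir_deriv:
  assumes "strict_deriv f f' x"
  shows "dir_deriv f x v = f' v"
  by (rule dir_deriv_eq[OF strict_deriv_dir[OF assms]])

lemma tendsto_add_scaled:
  fixes x w :: "'v::locally_convex_space"
  assumes "filterlim t (at 0) F" "(p \<longlongrightarrow> x) F" "(v \<longlongrightarrow> w) F"
  shows "((\<lambda>z. p z + t z *\<^sub>R v z) \<longlongrightarrow> x) F"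
proof -
  have "(t \<longlongrightarrow> 0) F" using assms(1) by (simp add: filterlim_at)
  then have "((\<lambda>z. p z + t z *\<^sub>R v z) \<longlongrightarrow> x + 0 *\<^sub>R w) F"
    by (intro tendsto_add tendsto_scaleR_lcs assms)
  then show ?thesis by simp
qed

lemma strict_deriv_cong:
  fixes f :: "'v::locally_convex_space \<Rightarrow> 'w::locally_convex_space"
  assumes "strict_deriv f f' x" and U: "open U" "x \<in> U" and eq: "\<And>y. y \<in> U \<Longrightarrow> f y = g y"
  shows "strict_deriv g f' x"
proof (rule strict_derivI)
  have "(f \<longlongrightarrow> g x) (nhds x)"
    using strict_deriv_isCont[OF assms(1)] U eq
    by (metis continuous_at tendsto_at_iff_tendsto_nhds)
  moreover have "\<forall>\<^sub>F y in nhds x. f y = g y"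
    using eventually_nhds_in_open[OF U] by eventually_elim (rule eq)
  ultimately have "(g \<longlongrightarrow> g x) (nhds x)" by (rule Lim_transform_eventually)
  then show "isCont g x"
    by (simp add: continuous_at tendsto_at_iff_tendsto_nhds)
next
  fix w :: 'v
  let ?F = "at (0::real) \<times>\<^sub>F (nhds x \<times>\<^sub>F nhds w)"
  note tr = triple_filter_tendsto[where x = x and w = w]
  have "((\<lambda>z. diff_quot f (fst (snd z)) (snd (snd z)) (fst z)) \<longlongrightarrow> f' w) ?F"
    by (rule strict_deriv_tendsto[OF assms(1) tr])
  moreover have "\<forall>\<^sub>F z in ?F. diff_quot f (fst (snd z)) (snd (snd z)) (fst z)
      = diff_quot g (fst (snd z)) (snd (snd z)) (fst z)"
    using topological_tendstoD[OF tr(2) U] topological_tendstoD[OF tendsto_add_scaled[OF tr] U]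
    by eventually_elim (simp add: eq)
  ultimately show "((\<lambda>z. diff_quot g (fst (snd z)) (snd (snd z)) (fst z)) \<longlongrightarrow> f' w) ?F"
    by (rule Lim_transform_eventually)
qed

text \<open>A difference quotient of \<open>g \<circ> f\<close> is a difference quotient of \<open>g\<close> whose base point
  \<open>f p\<close> and direction, a difference quotient of \<open>f\<close>, both converge.\<close>

lemma strict_deriv_compose:
  fixes f :: "'v::locally_convex_space \<Rightarrow> 'w::locally_convex_space"
    and g :: "'w \<Rightarrow> 'u::locally_convex_space"
  assumes f: "strict_deriv f f' x" and g: "strict_deriv g g' (f x)"
  shows "strict_deriv (\<lambda>y. g (f y)) (\<lambda>v. g' (f' v)) x"
proof (rule strict_derivI)
  show "isCont (\<lambda>y. g (f y)) x"
    by (rule isCont_o2[OF strict_deriv_isCont[OF f] strict_deriv_isCont[OF g]])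
next
  fix w :: 'v
  let ?F = "at (0::real) \<times>\<^sub>F (nhds x \<times>\<^sub>F nhds w)"
  note tr = triple_filter_tendsto[where x = x and w = w]
  let ?p = "\<lambda>z :: real \<times> 'v \<times> 'v. fst (snd z)" and ?v = "\<lambda>z :: real \<times> 'v \<times> 'v. snd (snd z)"
  let ?q = "\<lambda>z. (f (?p z + fst z *\<^sub>R ?v z) - f (?p z)) /\<^sub>R fst z"
  have q: "(?q \<longlongrightarrow> f' w) ?F"
    by (rule strict_deriv_tendsto[OF f tr])
  have fp: "((\<lambda>z. f (?p z)) \<longlongrightarrow> f x) ?F"
    using strict_deriv_isCont[OF f] tr(2) by (rule isCont_tendsto_compose)
  have "((\<lambda>z. (g (f (?p z) + fst z *\<^sub>R ?q z) - g (f (?p z))) /\<^sub>R fst z) \<longlongrightarrow> g' (f' w)) ?F"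
    by (rule strict_deriv_tendsto[OF g tr(1) fp q])
  moreover have "\<forall>\<^sub>F z in ?F. fst z \<noteq> 0"
    using tr(1) by (auto simp: filterlim_at)
  then have "\<forall>\<^sub>F z in ?F. (g (f (?p z) + fst z *\<^sub>R ?q z) - g (f (?p z))) /\<^sub>R fst z
      = (g (f (?p z + fst z *\<^sub>R ?v z)) - g (f (?p z))) /\<^sub>R fst z"
    by eventually_elim simp
  ultimately show "((\<lambda>z. (g (f (?p z + fst z *\<^sub>R ?v z)) - g (f (?p z))) /\<^sub>R fst z) \<longlongrightarrow> g' (f' w)) ?F"
    by (rule Lim_transform_eventually)
qed

text \<open>For additivity, go from \<open>x\<close> to \<open>x + t v\<close> and from there to \<open>x + t v + t w\<close>. The second step is
  a difference quotient with moving base point.\<close>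

lemma strict_deriv_linear:
  assumes f: "strict_deriv f f' x"
  shows "linear f'"
proof (rule linearI)
  fix v w
  have "((\<lambda>t. diff_quot f (x + t *\<^sub>R v) w t + diff_quot f x v t)
      \<longlongrightarrow> f' w + f' v) (at 0)"
    by (rule tendsto_add[OF strict_deriv_tendsto[OF f at_zero_ident
            tendsto_add_scaled[OF at_zero_ident tendsto_const tendsto_const] tendsto_const]
          strict_deriv_dir[OF f]])
  then have "((\<lambda>t. (f (x + t *\<^sub>R (v + w)) - f x) /\<^sub>R t) \<longlongrightarrow> f' w + f' v) (at 0)"
    by (simp add: scaleR_add_right algebra_simps)
  from tendsto_unique[OF _ strict_deriv_dir[OF f] this] show "f' (v + w) = f' v + f' w"
    by (simp add: add.commute)
next
  fix r v
  show "f' (r *\<^sub>R v) = r *\<^sub>R f' v"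
  proof (cases "r = 0")
    case True
    have "((\<lambda>t::real. 0) \<longlongrightarrow> f' 0) (at 0)"
      using strict_deriv_dir[OF f, of 0] by simp
    from tendsto_unique[OF trivial_limit_at this tendsto_const] have "f' 0 = 0" .
    then show ?thesis using True by simp
  next
    case False
    have "filterlim (\<lambda>t. t * r) (at 0) (at (0::real))"
      unfolding filterlim_at using False
      by (auto simp: eventually_at_filter intro!: tendsto_eq_intros)
    from strict_deriv_tendsto[OF f this tendsto_const tendsto_const]
    have "((\<lambda>t. (f (x + (t * r) *\<^sub>R v) - f x) /\<^sub>R (t * r)) \<longlongrightarrow> f' v) (at 0)" .
    from tendsto_scaleR_lcs[OF tendsto_const[of r] this]
    have "((\<lambda>t. (f (x + t *\<^sub>R (r *\<^sub>R v)) - f x) /\<^sub>R t) \<longlongrightarrow> r *\<^sub>R f' v) (at 0)"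
      using False by (simp add: field_simps)
    from tendsto_unique[OF _ strict_deriv_dir[OF f] this] show ?thesis by simp
  qed
qed

lemma strict_deriv_const: "strict_deriv (\<lambda>_. c) (\<lambda>_. 0) x"
  by (rule strict_derivI) auto

lemma strict_deriv_ident: "strict_deriv (\<lambda>x. x) (\<lambda>v. v) (x :: 'v::locally_convex_space)"
proof (rule strict_derivI)
  fix w :: 'v
  note tr = triple_filter_tendsto[where x = x and w = w]
  have "\<forall>\<^sub>F z in at 0 \<times>\<^sub>F (nhds x \<times>\<^sub>F nhds w). fst z \<noteq> 0"
    using tr(1) by (auto simp: filterlim_at)
  then have "\<forall>\<^sub>F z in at 0 \<times>\<^sub>F (nhds x \<times>\<^sub>F nhds w).
      snd (snd z) = (fst (snd z) + fst z *\<^sub>R snd (snd z) - fst (snd z)) /\<^sub>R fst z"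
    by eventually_elim simp
  with tr(3) show "((\<lambda>z. (fst (snd z) + fst z *\<^sub>R snd (snd z) - fst (snd z)) /\<^sub>R fst z) \<longlongrightarrow> w)
      (at 0 \<times>\<^sub>F (nhds x \<times>\<^sub>F nhds w))"
    by (rule Lim_transform_eventually)
qed simp

lemma strict_deriv_Pair:
  fixes f :: "'v::locally_convex_space \<Rightarrow> 'w::locally_convex_space"
    and g :: "'v \<Rightarrow> 'u::locally_convex_space"
  assumes f: "strict_deriv f f' x" and g: "strict_deriv g g' x"
  shows "strict_deriv (\<lambda>y. (f y, g y)) (\<lambda>v. (f' v, g' v)) x"
proof (rule strict_derivI)
  show "isCont (\<lambda>y. (f y, g y)) x"
    by (intro continuous_Pair strict_deriv_isCont[OF f] strict_deriv_isCont[OF g])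
  fix w :: 'v
  note tr = triple_filter_tendsto[where x = x and w = w]
  show "((\<lambda>z. ((f (fst (snd z) + fst z *\<^sub>R snd (snd z)), g (fst (snd z) + fst z *\<^sub>R snd (snd z)))
      - (f (fst (snd z)), g (fst (snd z)))) /\<^sub>R fst z) \<longlongrightarrow> (f' w, g' w)) (at 0 \<times>\<^sub>F (nhds x \<times>\<^sub>F nhds w))"
    using tendsto_Pair[OF strict_deriv_tendsto[OF f tr] strict_deriv_tendsto[OF g tr]] by simp
qed

section \<open>Derivatives of smooth maps\<close>

lemma smooth_family_strict_deriv:
  assumes D: "smooth_family U D" and "x \<in> U"
  shows "strict_deriv (D vs) (\<lambda>v. D (v # vs) x) x"
proof (rule strict_derivI)
  show "isCont (D vs) x"
    unfolding continuous_at
    by (rule smooth_family_tendsto[OF D \<open>x \<in> U\<close>, where us = "\<lambda>_. vs"]) auto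
  fix w
  note tr = triple_filter_tendsto[where x = x and w = w]
  show "((\<lambda>z. diff_quot (D vs) (fst (snd z)) (snd (snd z)) (fst z))
      \<longlongrightarrow> D (w # vs) x) (at 0 \<times>\<^sub>F (nhds x \<times>\<^sub>F nhds w))"
    by (rule smooth_family_strict[OF D \<open>x \<in> U\<close> tr(2,3,1), where us = "\<lambda>_. vs"]) auto
qed

lemma smooth_on_open: "smooth U f \<Longrightarrow> open U"
  by (simp add: smooth_on_def)

lemma smooth_on_strict_deriv:
  assumes "smooth U f" "x \<in> U"
  shows "strict_deriv f (dir_deriv f x) x"
proof -
  obtain D where D: "smooth_family U D" "\<forall>x\<in>U. D [] x = f x"
    using assms smooth_on_iff_family by blast
  have "strict_deriv f (\<lambda>v. D [v] x) x"
    by (rule strict_deriv_cong[OF smooth_family_strict_deriv[OF D(1) assms(2)]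
        smooth_family_open[OF D(1)] assms(2)]) (use D(2) in simp)
  moreover from strict_deriv_dir_deriv[OF this] have "dir_deriv f x = (\<lambda>v. D [v] x)"
    by auto
  ultimately show ?thesis by simp
qed

lemma dir_deriv_cong:
  fixes f :: "'v::locally_convex_space \<Rightarrow> 'w::locally_convex_space"
  assumes U: "open U" "x \<in> U" and eq: "\<And>y. y \<in> U \<Longrightarrow> f y = g y"
  shows "dir_deriv f x v = dir_deriv g x v"
proof -
  have "((\<lambda>t. x + t *\<^sub>R v) \<longlongrightarrow> x) (at 0)"
    by (rule tendsto_add_scaled[OF at_zero_ident]) auto
  from topological_tendstoD[OF this U]
  have "\<forall>\<^sub>F t in at 0. diff_quot f x v t = diff_quot g x v t"
    by eventually_elim (simp add: eq U)
  then have "((\<lambda>t. diff_quot f x v t) \<longlongrightarrow> l) (at 0) \<longleftrightarrow>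
      ((\<lambda>t. diff_quot g x v t) \<longlongrightarrow> l) (at 0)" for l
    by (rule tendsto_cong)
  then show ?thesis by (simp add: dir_deriv_def Topological_Spaces.Lim_def)
qed

text \<open>Limits are unique, so a smooth map has only one family of derivatives on its domain. Naming it
  makes it possible to glue families that are known locally.\<close>

definition iter_deriv :: "('v::locally_convex_space \<Rightarrow> 'w::locally_convex_space) \<Rightarrow> 'v list \<Rightarrow> 'v \<Rightarrow> 'w"
  where "iter_deriv f vs = foldr (\<lambda>v g x. dir_deriv g x v) vs f"

lemma iter_deriv_simps [simp]:
  "iter_deriv f [] = f" "iter_deriv f (v # vs) = (\<lambda>x. dir_deriv (iter_deriv f vs) x v)"
  by (simp_all add: iter_deriv_def)

lemma smooth_family_cong:
  assumes D: "smooth_family U D" and eq: "\<And>vs x. x \<in> U \<Longrightarrow> D vs x = E vs x"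
  shows "smooth_family U E"
proof (rule smooth_familyI)
  show "open U" using D by (rule smooth_family_open)
  fix vs v x assume x: "x \<in> U"
  have "strict_deriv (E vs) (\<lambda>v. D (v # vs) x) x"
    by (rule strict_deriv_cong[OF smooth_family_strict_deriv[OF D x] smooth_family_open[OF D] x eq])
  from strict_deriv_dir[OF this]
  show "((\<lambda>t. diff_quot (E vs) x v t) \<longlongrightarrow> E (v # vs) x) (at 0)"
    by (simp add: eq x)
next
  fix k x v and F :: "('a \<times> (nat \<Rightarrow> 'a)) filter"
  assume *: "x \<in> U" "(fst \<longlongrightarrow> x) F" "\<forall>\<^sub>F z in F. fst z \<in> U"
    "\<And>i. i < k \<Longrightarrow> ((\<lambda>z. snd z i) \<longlongrightarrow> v i) F"
  have "((\<lambda>z. D (map (snd z) [0..<k]) (fst z)) \<longlongrightarrow> D (map v [0..<k]) x) F"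
    by (rule smooth_family_tendsto[OF D *(1,2)]) (use * in auto)
  moreover have "\<forall>\<^sub>F z in F. D (map (snd z) [0..<k]) (fst z) = E (map (snd z) [0..<k]) (fst z)"
    using *(3) by eventually_elim (rule eq)
  ultimately show "((\<lambda>z. E (map (snd z) [0..<k]) (fst z)) \<longlongrightarrow> E (map v [0..<k]) x) F"
    unfolding eq[OF *(1), symmetric] by (rule Lim_transform_eventually)
qed

lemma smooth_on_iter_deriv:
  "smooth U f \<longleftrightarrow> smooth_family U (iter_deriv f)"
proof
  assume "smooth U f"
  then obtain D where D: "smooth_family U D" "\<forall>x\<in>U. D [] x = f x"
    using smooth_on_iff_family by blast
  have "D vs x = iter_deriv f vs x" if "x \<in> U" for vs x
    using that
  proof (induction vs arbitrary: x)
    case (Cons v vs)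
    have "dir_deriv (iter_deriv f vs) x v = dir_deriv (D vs) x v"
      using Cons by (intro dir_deriv_cong[OF smooth_family_open[OF D(1)]]) auto
    also have "\<dots> = D (v # vs) x"
      by (rule strict_deriv_dir_deriv[OF smooth_family_strict_deriv[OF D(1) Cons.prems]])
    finally show ?case by simp
  qed (use D in simp)
  with D(1) show "smooth_family U (iter_deriv f)" by (rule smooth_family_cong)
next
  assume "smooth_family U (iter_deriv f)"
  then show "smooth U f"
    unfolding smooth_on_iff_family by (intro exI[of _ "iter_deriv f"]) simp
qed

lemma smooth_on_cong:
  assumes "smooth U f" and "\<And>x. x \<in> U \<Longrightarrow> f x = g x"
  shows "smooth U g"
  using assms unfolding smooth_on_iff_family by metis

lemma smooth_on_locally:
  fixes f :: "'v::locally_convex_space \<Rightarrow> 'w::locally_convex_space"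
  assumes "open U"
    and loc: "\<And>x. x \<in> U \<Longrightarrow> \<exists>V. x \<in> V \<and> smooth V f"
  shows "smooth U f"
  unfolding smooth_on_iter_deriv
proof (rule smooth_familyI)
  fix vs v x assume "x \<in> U"
  then obtain V where V: "x \<in> V" "smooth_family V (iter_deriv f)"
    using loc smooth_on_iter_deriv by blast
  then show "((\<lambda>t. diff_quot (iter_deriv f vs) x v t)
      \<longlongrightarrow> iter_deriv f (v # vs) x) (at 0)"
    by (intro smooth_family_deriv[OF V(2,1)])
next
  fix k x v and F :: "('v \<times> (nat \<Rightarrow> 'v)) filter"
  assume *: "x \<in> U" "(fst \<longlongrightarrow> x) F" "\<And>i. i < k \<Longrightarrow> ((\<lambda>z. snd z i) \<longlongrightarrow> v i) F"
  then obtain V where V: "x \<in> V" "smooth_family V (iter_deriv f)"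
    using loc smooth_on_iter_deriv by blast
  then show "((\<lambda>z. iter_deriv f (map (snd z) [0..<k]) (fst z)) \<longlongrightarrow> iter_deriv f (map v [0..<k]) x) F"
    using * by (intro smooth_family_tendsto[OF V(2,1)]) auto
qed fact

lemma smooth_on_subset:
  assumes "smooth U f" "open V" "V \<subseteq> U"
  shows "smooth V f"
  by (rule smooth_on_locally) (use assms in auto)

lemma smooth_on_dir_deriv:
  fixes f :: "'v::locally_convex_space \<Rightarrow> 'w::locally_convex_space"
  assumes "smooth U f"
  shows "smooth U (\<lambda>x. dir_deriv f x v)"
proof -
  have D: "smooth_family U (iter_deriv f)" using assms smooth_on_iter_deriv by blast
  have "smooth_family U (\<lambda>vs. iter_deriv f (vs @ [v]))"
  proof (rule smooth_familyI)
    fix vs u x assume "x \<in> U"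
    from smooth_family_deriv[OF D this, of "vs @ [v]" u]
    show "((\<lambda>t. diff_quot (iter_deriv f (vs @ [v])) x u t)
        \<longlongrightarrow> iter_deriv f ((u # vs) @ [v]) x) (at 0)" by simp
  next
    fix k x and w :: "nat \<Rightarrow> 'v" and F :: "('v \<times> (nat \<Rightarrow> 'v)) filter"
    assume *: "x \<in> U" "(fst \<longlongrightarrow> x) F" "\<And>i. i < k \<Longrightarrow> ((\<lambda>z. snd z i) \<longlongrightarrow> w i) F"
    show "((\<lambda>z. iter_deriv f (map (snd z) [0..<k] @ [v]) (fst z))
        \<longlongrightarrow> iter_deriv f (map w [0..<k] @ [v]) x) F"
      by (rule smooth_family_tendsto[OF D *(1,2)]) (use *(3) in \<open>auto simp: nth_append\<close>)
  qed (rule smooth_family_open[OF D])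
  then show ?thesis unfolding smooth_on_iff_family by force
qed

lemma dir_deriv_tendsto:
  assumes "smooth U f" "x \<in> U" "(y \<longlongrightarrow> x) F" "(u \<longlongrightarrow> v) F"
  shows "((\<lambda>z. dir_deriv f (y z) (u z)) \<longlongrightarrow> dir_deriv f x v) F"
proof -
  have D: "smooth_family U (iter_deriv f)" using assms smooth_on_iter_deriv by blast
  have "((\<lambda>z. iter_deriv f [u z] (y z)) \<longlongrightarrow> iter_deriv f [v] x) F"
    by (rule smooth_family_tendsto[OF D assms(2,3)]) (use assms(4) in auto)
  then show ?thesis by simp
qed

lemma smooth_on_continuous_on:
  assumes "smooth U f"
  shows "continuous_on U f"
  by (intro continuous_at_imp_continuous_on ballI strict_deriv_isCont[OF smooth_on_strict_deriv[OF assms]])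

lemma dir_deriv_linear:
  assumes "smooth U f" "x \<in> U"
  shows "linear (dir_deriv f x)"
  using strict_deriv_linear[OF smooth_on_strict_deriv[OF assms]] .

text \<open>Both sides are limits of the second difference quotient
  \<open>(f(x + su + sv) - f(x + su) - f(x + sv) + f x) / s\<^sup>2\<close>, which is symmetric in \<open>u\<close> and \<open>v\<close>: it is the
  difference quotient in one direction of the difference quotient in the other, so
  \<open>strict_difference_quotient\<close> applies.\<close>

lemma dir_deriv_symmetric:
  assumes f: "smooth U f" and x: "x \<in> U"
  shows "dir_deriv (\<lambda>y. dir_deriv f y v) x u = dir_deriv (\<lambda>y. dir_deriv f y u) x v"
proof -
  have U: "open U" using f by (rule smooth_on_open)
  have lim: "((\<lambda>s. (diff_quot f (x + s *\<^sub>R v) u s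
        - diff_quot f x u s) /\<^sub>R s) \<longlongrightarrow> dir_deriv (\<lambda>y. dir_deriv f y v) x u) (at 0)"
    for u v
  proof (rule strict_difference_quotient[where
        g = "\<lambda>s y. diff_quot f y u s" and p = "\<lambda>_. x" and v = "\<lambda>_. v" and t = "\<lambda>s. s" and
        g' = "\<lambda>s y. (dir_deriv f (y + s *\<^sub>R u) v - dir_deriv f y v) /\<^sub>R s" and x = x and w = v])
    let ?F = "at (0::real) \<times>\<^sub>F nhds x"
    have tr: "filterlim fst (at 0) ?F" "(snd \<longlongrightarrow> x) ?F"
      by (auto intro: filterlim_fst filterlim_snd)
    have "\<forall>\<^sub>F z in ?F. snd z \<in> U" using topological_tendstoD[OF tr(2) U x] .
    moreover have "\<forall>\<^sub>F z in ?F. snd z + fst z *\<^sub>R u \<in> U"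
      using topological_tendstoD[OF tendsto_add_scaled[OF tr tendsto_const] U x] .
    ultimately show "\<forall>\<^sub>F (s, y) in ?F. ((\<lambda>r. (diff_quot f (y + r *\<^sub>R v) u s
        - diff_quot f y u s) /\<^sub>R r)
        \<longlongrightarrow> (dir_deriv f (y + s *\<^sub>R u) v - dir_deriv f y v) /\<^sub>R s) (at 0)"
    proof eventually_elim
      case (elim z)
      obtain s y where z: "z = (s, y)" by (cases z)
      have "((\<lambda>r. (diff_quot f (y + s *\<^sub>R u) v r - diff_quot f y v r) /\<^sub>R s)
        \<longlongrightarrow> (dir_deriv f (y + s *\<^sub>R u) v - dir_deriv f y v) /\<^sub>R s) (at 0)"
        using elim z
        by (intro tendsto_scaleR_lcs tendsto_diff tendsto_const
            strict_deriv_dir smooth_on_strict_deriv[OF f]) auto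
      then show ?case unfolding z
        by (simp add: scaleR_diff_right algebra_simps)
    qed
    have "strict_deriv (\<lambda>y. dir_deriv f y v) (dir_deriv (\<lambda>y. dir_deriv f y v) x) x"
      using smooth_on_strict_deriv[OF smooth_on_dir_deriv[OF f] x] .
    from strict_deriv_tendsto[OF this tr tendsto_const]
    show "((\<lambda>(s, y). (dir_deriv f (y + s *\<^sub>R u) v - dir_deriv f y v) /\<^sub>R s)
        \<longlongrightarrow> dir_deriv (\<lambda>y. dir_deriv f y v) x u) ?F"
      by (simp add: case_prod_unfold)
  qed (auto intro: at_zero_ident)
  have "(\<lambda>s. (diff_quot f (x + s *\<^sub>R v) u s
        - diff_quot f x u s) /\<^sub>R s) =
      (\<lambda>s. (diff_quot f (x + s *\<^sub>R u) v s
        - diff_quot f x v s) /\<^sub>R s)"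
    by (simp add: fun_eq_iff scaleR_diff_right algebra_simps)
  with lim[of u v] have "((\<lambda>s. (diff_quot f (x + s *\<^sub>R v) u s
        - diff_quot f x u s) /\<^sub>R s) \<longlongrightarrow> dir_deriv (\<lambda>y. dir_deriv f y u) x v) (at 0)"
    by simp
  from tendsto_unique[OF trivial_limit_at lim this] show ?thesis .
qed

text \<open>Restrict \<open>f\<close> to the segment from \<open>x\<close> to \<open>y\<close>.\<close>

lemma strict_deriv_zero_imp_constant:
  fixes f :: "'v::locally_convex_space \<Rightarrow> real"
  assumes "convex C" and zero: "\<And>x. x \<in> C \<Longrightarrow> strict_deriv f (\<lambda>_. 0) x"
    and x: "x \<in> C" and y: "y \<in> C"
  shows "f y = f x"
proof -
  define g where "g t = f (x + t *\<^sub>R (y - x))" for t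
  have seg: "x + t *\<^sub>R (y - x) \<in> C" if "0 \<le> t" "t \<le> 1" for t
  proof -
    have "(1 - t) *\<^sub>R x + t *\<^sub>R y \<in> C" using that by (intro convexD[OF assms(1) x y]) auto
    then show ?thesis by (simp add: algebra_simps)
  qed
  have der: "DERIV g t :> 0" if "0 \<le> t" "t \<le> 1" for t
  proof -
    have "((\<lambda>h. (f (x + t *\<^sub>R (y - x) + h *\<^sub>R (y - x)) - f (x + t *\<^sub>R (y - x))) /\<^sub>R h) \<longlongrightarrow> 0) (at 0)"
      by (rule strict_deriv_dir[OF zero[OF seg[OF that]]])
    then show ?thesis
      unfolding DERIV_def by (simp add: g_def scaleR_add_left add.assoc divide_inverse mult.commute)
  qed
  have "g 1 = g 0"
  proof (rule DERIV_isconst_end[where f = g and a = 0 and b = 1])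
    show "continuous_on {0..1} g"
      using DERIV_isCont[OF der] by (intro continuous_at_imp_continuous_on ballI) auto
  qed (use der in auto)
  then show ?thesis by (simp add: g_def)
qed

section \<open>Composition of smooth maps\<close>

lemma dir_deriv_add:
  assumes "strict_deriv f f' x" "strict_deriv g g' x"
  shows "dir_deriv (\<lambda>y. f y + g y) x v = f' v + g' v"
proof (rule dir_deriv_eq)
  have "((\<lambda>t. diff_quot f x v t + diff_quot g x v t)
      \<longlongrightarrow> f' v + g' v) (at 0)"
    by (intro tendsto_add strict_deriv_dir assms)
  then show "((\<lambda>t. (f (x + t *\<^sub>R v) + g (x + t *\<^sub>R v) - (f x + g x)) /\<^sub>R t) \<longlongrightarrow> f' v + g' v) (at 0)"
    by (simp add: add_diff_add scaleR_add_right)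
qed

lemma dir_deriv_scaleR:
  assumes "strict_deriv f f' x"
  shows "dir_deriv (\<lambda>y. r *\<^sub>R f y) x v = r *\<^sub>R f' v"
proof (rule dir_deriv_eq)
  have "((\<lambda>t. r *\<^sub>R (diff_quot f x v t)) \<longlongrightarrow> r *\<^sub>R f' v) (at 0)"
    by (intro tendsto_scaleR_lcs tendsto_const strict_deriv_dir assms)
  then show "((\<lambda>t. (r *\<^sub>R f (x + t *\<^sub>R v) - r *\<^sub>R f x) /\<^sub>R t) \<longlongrightarrow> r *\<^sub>R f' v) (at 0)"
    by (simp add: scaleR_diff_right mult.commute)
qed

text \<open>The most recent direction enters linearly because it is the argument of a strict derivative, and
  linearity in the earlier ones survives each further differentiation.\<close>

lemma smooth_family_linear:
  assumes D: "smooth_family U D" and "x \<in> U"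
  shows "linear (\<lambda>a. D (as @ a # bs) x)"
  using \<open>x \<in> U\<close>
proof (induction as arbitrary: x)
  case Nil
  then show ?case using strict_deriv_linear[OF smooth_family_strict_deriv[OF D]] by simp
next
  case (Cons c as)
  have U: "open U" using D by (rule smooth_family_open)
  have der: "D (c # as @ a # bs) x = dir_deriv (D (as @ a # bs)) x c" for a
    using strict_deriv_dir_deriv[OF smooth_family_strict_deriv[OF D Cons.prems]] by metis
  show ?case
  proof (rule linearI)
    fix a b
    have "dir_deriv (D (as @ (a + b) # bs)) x c
        = dir_deriv (\<lambda>y. D (as @ a # bs) y + D (as @ b # bs) y) x c"
      by (rule dir_deriv_cong[OF U Cons.prems]) (rule linear_add[OF Cons.IH])
    also have "\<dots> = D (c # as @ a # bs) x + D (c # as @ b # bs) x"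
      by (rule dir_deriv_add[OF smooth_family_strict_deriv[OF D Cons.prems]
            smooth_family_strict_deriv[OF D Cons.prems]])
    finally show "D ((c # as) @ (a + b) # bs) x = D ((c # as) @ a # bs) x + D ((c # as) @ b # bs) x"
      by (simp add: der)
  next
    fix r a
    have "dir_deriv (D (as @ (r *\<^sub>R a) # bs)) x c = dir_deriv (\<lambda>y. r *\<^sub>R D (as @ a # bs) y) x c"
      by (rule dir_deriv_cong[OF U Cons.prems]) (rule linear_scale[OF Cons.IH])
    also have "\<dots> = r *\<^sub>R D (c # as @ a # bs) x"
      by (rule dir_deriv_scaleR[OF smooth_family_strict_deriv[OF D Cons.prems]])
    finally show "D ((c # as) @ (r *\<^sub>R a) # bs) x = r *\<^sub>R D ((c # as) @ a # bs) x"
      by (simp add: der)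
  qed
qed

lemma difference_quotient_tendsto:
  fixes y :: "real \<Rightarrow> 'v::locally_convex_space"
  assumes "((\<lambda>t. (y t - x) /\<^sub>R t) \<longlongrightarrow> w) (at 0)"
  shows "(y \<longlongrightarrow> x) (at 0)"
proof (rule Lim_transform_eventually)
  show "((\<lambda>t. x + t *\<^sub>R ((y t - x) /\<^sub>R t)) \<longlongrightarrow> x) (at 0)"
    by (rule tendsto_add_scaled[OF at_zero_ident tendsto_const assms])
  show "\<forall>\<^sub>F t in at 0. x + t *\<^sub>R ((y t - x) /\<^sub>R t) = y t"
    by (simp add: eventually_at_filter)
qed

text \<open>The product rule for a function that is linear in each entry of a list: replace the entries one
  at a time, and telescope.\<close>

lemma smooth_family_slots_deriv:
  fixes us :: "real \<Rightarrow> 'v::locally_convex_space list"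
  assumes D: "smooth_family U D" and x: "x \<in> U"
    and len: "\<And>t. length (us t) = length vs"
    and us: "\<And>i. i < length vs \<Longrightarrow> ((\<lambda>t. (us t ! i - vs ! i) /\<^sub>R t) \<longlongrightarrow> ws i) (at 0)"
  shows "((\<lambda>t. (D (us t) x - D vs x) /\<^sub>R t) \<longlongrightarrow> (\<Sum>i<length vs. D (vs[i := ws i]) x)) (at 0)"
proof -
  define h where "h n t = D (take n (us t) @ drop n vs) x" for n t
  have "((\<lambda>t. (h (Suc n) t - h n t) /\<^sub>R t) \<longlongrightarrow> D (vs[n := ws n]) x) (at 0)"
    if n: "n < length vs" for n
  proof -
    have split: "vs[n := ws n] = take n vs @ ws n # drop (Suc n) vs"
      using n by (rule upd_conv_take_nth_drop)
    have "((\<lambda>t. D (take n (us t) @ ((us t ! n - vs ! n) /\<^sub>R t) # drop (Suc n) vs) x)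
        \<longlongrightarrow> D (vs[n := ws n]) x) (at 0)"
      unfolding split
    proof (rule smooth_family_tendsto[OF D x tendsto_const])
      fix i assume "i < length (take n vs @ ws n # drop (Suc n) vs)"
      then consider "i < n" | "i = n" | j where "i = Suc (n + j)" "Suc (n + j) < length vs"
        using n by (metis length_list_update linorder_less_linear less_iff_Suc_add split)
      then show "((\<lambda>t. (take n (us t) @ ((us t ! n - vs ! n) /\<^sub>R t) # drop (Suc n) vs) ! i)
          \<longlongrightarrow> (take n vs @ ws n # drop (Suc n) vs) ! i) (at 0)"
      proof cases
        case 1
        then show ?thesis
          using n len difference_quotient_tendsto[OF us[of i]] by (simp add: nth_append)
      next
        case 2
        then show ?thesis using n len us[of n] by (simp add: nth_append)
      next
        case 3
        then show ?thesis using n len by (simp add: nth_append)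
      qed
    qed (use n len in simp)
    moreover have "D (take n (us t) @ ((us t ! n - vs ! n) /\<^sub>R t) # drop (Suc n) vs) x
        = (h (Suc n) t - h n t) /\<^sub>R t" for t
      using n len
      by (simp add: h_def linear_diff[OF smooth_family_linear[OF D x]]
          linear_scale[OF smooth_family_linear[OF D x]] take_Suc_conv_app_nth Cons_nth_drop_Suc[symmetric])
    ultimately show ?thesis by simp
  qed
  then have "((\<lambda>t. \<Sum>n<length vs. (h (Suc n) t - h n t) /\<^sub>R t)
      \<longlongrightarrow> (\<Sum>i<length vs. D (vs[i := ws i]) x)) (at 0)"
    by (intro tendsto_sum) auto
  moreover have "(\<Sum>n<length vs. (h (Suc n) t - h n t) /\<^sub>R t) = (D (us t) x - D vs x) /\<^sub>R t" for t
  proof -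
    have "(\<Sum>n<length vs. h (Suc n) t - h n t) = h (length vs) t - h 0 t"
      by (rule sum_lessThan_telescope)
    also have "\<dots> = D (us t) x - D vs x" using len by (simp add: h_def)
    finally show ?thesis by (simp only: scaleR_sum_right[symmetric])
  qed
  ultimately show ?thesis by simp
qed

lemma smooth_family_chain:
  fixes us :: "real \<Rightarrow> 'v::locally_convex_space list"
  assumes D: "smooth_family U D" and x: "x \<in> U"
    and y: "((\<lambda>t. (y t - x) /\<^sub>R t) \<longlongrightarrow> w) (at 0)"
    and len: "\<And>t. length (us t) = length vs"
    and us: "\<And>i. i < length vs \<Longrightarrow> ((\<lambda>t. (us t ! i - vs ! i) /\<^sub>R t) \<longlongrightarrow> ws i) (at 0)"
  shows "((\<lambda>t. (D (us t) (y t) - D vs x) /\<^sub>R t)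
    \<longlongrightarrow> D (w # vs) x + (\<Sum>i<length vs. D (vs[i := ws i]) x)) (at 0)"
proof (rule Lim_transform_eventually)
  have "((\<lambda>t. (D (us t) (x + t *\<^sub>R ((y t - x) /\<^sub>R t)) - D (us t) x) /\<^sub>R t) \<longlongrightarrow> D (w # vs) x) (at 0)"
    by (rule smooth_family_strict[OF D x tendsto_const y at_zero_ident len
          difference_quotient_tendsto[OF us]])
  then show "((\<lambda>t. (D (us t) (x + t *\<^sub>R ((y t - x) /\<^sub>R t)) - D (us t) x) /\<^sub>R t
      + (D (us t) x - D vs x) /\<^sub>R t) \<longlongrightarrow> D (w # vs) x + (\<Sum>i<length vs. D (vs[i := ws i]) x)) (at 0)"
    by (intro tendsto_add smooth_family_slots_deriv[OF D x len us])
  show "\<forall>\<^sub>F t in at 0. (D (us t) (x + t *\<^sub>R ((y t - x) /\<^sub>R t)) - D (us t) x) /\<^sub>R t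
      + (D (us t) x - D vs x) /\<^sub>R t = (D (us t) (y t) - D vs x) /\<^sub>R t"
    unfolding eventually_at_filter by (simp add: scaleR_diff_right)
qed

text \<open>The summands of Faa di Bruno's formula. Each element of \<open>chain_blocks vs\<close> is a partition of the
  directions \<open>vs\<close> into blocks and stands for the term in which the outer map is differentiated once
  for each block, in the direction of the derivative of the inner map along that block. Differentiating
  in a new direction \<open>v\<close> hits the base point of the outer derivative, which opens the block \<open>[v]\<close>,
  or one of its directions, which adds \<open>v\<close> to that block.\<close>

fun chain_blocks :: "'a list \<Rightarrow> 'a list list list" where
  "chain_blocks [] = [[]]"
| "chain_blocks (v # vs) = concat (map (\<lambda>bs. ([v] # bs) #
     map (\<lambda>i. bs[i := v # bs ! i]) [0..<length bs]) (chain_blocks vs))"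

text \<open>The partitions depend on the positions of the directions only. Continuity in the directions is thus
  the continuity of a fixed finite sum.\<close>

lemma chain_blocks_map: "chain_blocks (map h vs) = map (map (map h)) (chain_blocks vs)"
  by (induction vs) (auto simp: map_concat o_def map_update intro!: arg_cong[where f = concat] map_cong)

lemma sum_list_concat_map:
  "(\<Sum>b\<leftarrow>concat (map F xs). T b) = (\<Sum>x\<leftarrow>xs. \<Sum>b\<leftarrow>F x. (T b :: 'a::comm_monoid_add))"
  by (induction xs) simp_all

lemma tendsto_sum_list_map:
  fixes h :: "'b \<Rightarrow> 'z \<Rightarrow> 'w::topological_comm_monoid_add"
  assumes "\<And>b. b \<in> set bs \<Longrightarrow> (h b \<longlongrightarrow> l b) F"
  shows "((\<lambda>z. \<Sum>b\<leftarrow>bs. h b z) \<longlongrightarrow> (\<Sum>b\<leftarrow>bs. l b)) F"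
  using assms by (induction bs) (auto intro: tendsto_add)

text \<open>Faa di Bruno's formula gives the whole family of iterated derivatives of \<open>g \<circ> f\<close>.\<close>

lemma smooth_on_compose:
  fixes f :: "'v::locally_convex_space \<Rightarrow> 'w::locally_convex_space"
    and g :: "'w \<Rightarrow> 'u::locally_convex_space"
  assumes f: "smooth U f" and g: "smooth V g" and fUV: "f ` U \<subseteq> V"
  shows "smooth U (\<lambda>x. g (f x))"
proof -
  define Df where "Df = iter_deriv f"
  define Dg where "Dg = iter_deriv g"
  have Df: "smooth_family U Df" "Df [] = f" and Dg: "smooth_family V Dg" "Dg [] = g"
    using f g smooth_on_iter_deriv by (auto simp: Df_def Dg_def)
  define T where "T bs x = Dg (map (\<lambda>b. Df b x) bs) (f x)" for bs x
  have "smooth_family U (\<lambda>vs x. \<Sum>bs\<leftarrow>chain_blocks vs. T bs x)"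
  proof (rule smooth_familyI)
    show "open U" by (rule smooth_on_open[OF f])
  next
    fix vs and v x :: 'v assume x: "x \<in> U"
    then have fx: "f x \<in> V" using fUV by auto
    let ?step = "\<lambda>bs. ([v] # bs) # map (\<lambda>i. bs[i := v # bs ! i]) [0..<length bs]"
    have T: "((\<lambda>t. diff_quot (T bs) x v t) \<longlongrightarrow> (\<Sum>cs\<leftarrow>?step bs. T cs x)) (at 0)" for bs
    proof -
      let ?vs = "map (\<lambda>b. Df b x) bs"
      have "((\<lambda>t. diff_quot f x v t) \<longlongrightarrow> Df [v] x) (at 0)"
        using smooth_family_deriv[OF Df(1) x, of "[]" v] by (simp add: Df(2))
      then have "((\<lambda>t. (Dg (map (\<lambda>b. Df b (x + t *\<^sub>R v)) bs) (f (x + t *\<^sub>R v)) - Dg ?vs (f x)) /\<^sub>R t)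
          \<longlongrightarrow> Dg (Df [v] x # ?vs) (f x) + (\<Sum>i<length ?vs. Dg (?vs[i := Df (v # bs ! i) x]) (f x))) (at 0)"
        by (rule smooth_family_chain[OF Dg(1) fx]) (auto intro: smooth_family_deriv[OF Df(1) x])
      moreover have "Dg (Df [v] x # ?vs) (f x) + (\<Sum>i<length ?vs. Dg (?vs[i := Df (v # bs ! i) x]) (f x))
          = (\<Sum>cs\<leftarrow>?step bs. T cs x)"
        by (simp add: T_def o_def map_update interv_sum_list_conv_sum_set_nat atLeast0LessThan)
      ultimately show ?thesis by (simp add: T_def)
    qed
    have "((\<lambda>t. \<Sum>bs\<leftarrow>chain_blocks vs. diff_quot (T bs) x v t)
        \<longlongrightarrow> (\<Sum>bs\<leftarrow>chain_blocks vs. \<Sum>cs\<leftarrow>?step bs. T cs x)) (at 0)"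
      by (intro tendsto_sum_list_map T)
    moreover have "(\<Sum>bs\<leftarrow>B. (T bs y - T bs x) /\<^sub>R t)
        = ((\<Sum>bs\<leftarrow>B. T bs y) - (\<Sum>bs\<leftarrow>B. T bs x)) /\<^sub>R t" for B y and t :: real
      by (induction B) (simp_all add: scaleR_add_right scaleR_diff_right)
    ultimately show "((\<lambda>t. ((\<Sum>bs\<leftarrow>chain_blocks vs. T bs (x + t *\<^sub>R v)) - (\<Sum>bs\<leftarrow>chain_blocks vs. T bs x)) /\<^sub>R t)
        \<longlongrightarrow> (\<Sum>bs\<leftarrow>chain_blocks (v # vs). T bs x)) (at 0)"
      by (simp only: chain_blocks.simps sum_list_concat_map)
  next
    fix k x and v :: "nat \<Rightarrow> 'v" and F :: "('v \<times> (nat \<Rightarrow> 'v)) filter"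
    assume x: "x \<in> U" and *: "(fst \<longlongrightarrow> x) F" and v: "\<And>i. i < k \<Longrightarrow> ((\<lambda>z. snd z i) \<longlongrightarrow> v i) F"
    have fx: "f x \<in> V" using fUV x by auto
    have idx: "\<forall>bs\<in>set (chain_blocks is). \<forall>b\<in>set bs. set b \<subseteq> set is" for "is" :: "nat list"
    proof (induction "is")
      case (Cons i "is")
      then show ?case
        by (fastforce dest!: set_update_subset_insert[THEN subsetD] dest: nth_mem)
    qed simp
    have "((\<lambda>z. \<Sum>bs\<leftarrow>chain_blocks [0..<k]. T (map (map (snd z)) bs) (fst z))
        \<longlongrightarrow> (\<Sum>bs\<leftarrow>chain_blocks [0..<k]. T (map (map v) bs) x)) F"
    proof (rule tendsto_sum_list_map)
      fix bs assume bs: "bs \<in> set (chain_blocks [0..<k])"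
      have Dfb: "((\<lambda>z. Df (map (snd z) b) (fst z)) \<longlongrightarrow> Df (map v b) x) F" if "set b \<subseteq> {..<k}" for b
        using that by (intro smooth_family_tendsto[OF Df(1) x *]) (auto intro!: v simp: subset_iff)
      show "((\<lambda>z. T (map (map (snd z)) bs) (fst z)) \<longlongrightarrow> T (map (map v) bs) x) F"
        unfolding T_def
      proof (rule smooth_family_tendsto[OF Dg(1) fx])
        show "((\<lambda>z. f (fst z)) \<longlongrightarrow> f x) F"
          using Dfb[of "[]"] by (simp add: Df(2))
        fix i assume "i < length (map (\<lambda>b. Df b x) (map (map v) bs))"
        then show "((\<lambda>z. map (\<lambda>b. Df b (fst z)) (map (map (snd z)) bs) ! i)
            \<longlongrightarrow> map (\<lambda>b. Df b x) (map (map v) bs) ! i) F"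
          using idx[of "[0..<k]"] bs by (force intro: Dfb)
      qed simp
    qed
    then show "((\<lambda>z. \<Sum>bs\<leftarrow>chain_blocks (map (snd z) [0..<k]). T bs (fst z))
        \<longlongrightarrow> (\<Sum>bs\<leftarrow>chain_blocks (map v [0..<k]). T bs x)) F"
      by (simp only: chain_blocks_map map_map o_def)
  qed
  then show ?thesis unfolding smooth_on_iff_family by (force simp: T_def Dg(2))
qed

section \<open>Elementary smooth maps and the tangent map\<close>

lemma smooth_on_Pair:
  fixes f :: "'v::locally_convex_space \<Rightarrow> 'w::locally_convex_space"
    and g :: "'v \<Rightarrow> 'u::locally_convex_space"
  assumes f: "smooth U f" and g: "smooth U g"
  shows "smooth U (\<lambda>x. (f x, g x))"
proof -
  have Df: "smooth_family U (iter_deriv f)" and Dg: "smooth_family U (iter_deriv g)"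
    using f g smooth_on_iter_deriv by auto
  have "smooth_family U (\<lambda>vs x. (iter_deriv f vs x, iter_deriv g vs x))"
  proof (rule smooth_familyI)
    fix vs v x assume x: "x \<in> U"
    show "((\<lambda>t. ((iter_deriv f vs (x + t *\<^sub>R v), iter_deriv g vs (x + t *\<^sub>R v))
        - (iter_deriv f vs x, iter_deriv g vs x)) /\<^sub>R t)
        \<longlongrightarrow> (iter_deriv f (v # vs) x, iter_deriv g (v # vs) x)) (at 0)"
      using tendsto_Pair[OF smooth_family_deriv[OF Df x] smooth_family_deriv[OF Dg x]] by simp
  next
    fix k x and v :: "nat \<Rightarrow> 'v" and F :: "('v \<times> (nat \<Rightarrow> 'v)) filter"
    assume *: "x \<in> U" "(fst \<longlongrightarrow> x) F" "\<And>i. i < k \<Longrightarrow> ((\<lambda>z. snd z i) \<longlongrightarrow> v i) F"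
    show "((\<lambda>z. (iter_deriv f (map (snd z) [0..<k]) (fst z), iter_deriv g (map (snd z) [0..<k]) (fst z)))
        \<longlongrightarrow> (iter_deriv f (map v [0..<k]) x, iter_deriv g (map v [0..<k]) x)) F"
      by (intro tendsto_Pair smooth_family_tendsto[OF Df *(1,2)] smooth_family_tendsto[OF Dg *(1,2)])
        (use *(3) in auto)
  qed (rule smooth_on_open[OF f])
  then show ?thesis unfolding smooth_on_iff_family by force
qed

lemma smooth_on_linear:
  fixes L :: "'v::locally_convex_space \<Rightarrow> 'w::locally_convex_space"
  assumes L: "linear L" "continuous_on UNIV L" and "open U"
  shows "smooth U L"
proof -
  define D where "D vs x = (case vs of [] \<Rightarrow> L x | [v] \<Rightarrow> L v | _ \<Rightarrow> 0)" for vs x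
  have isCont: "isCont L y" for y
    using L(2) by (simp add: continuous_on_eq_continuous_at)
  have "smooth_family U D"
  proof (rule smooth_familyI)
    fix vs v x
    show "((\<lambda>t. diff_quot (D vs) x v t) \<longlongrightarrow> D (v # vs) x) (at 0)"
    proof (cases vs)
      case Nil
      have "\<forall>\<^sub>F t in at 0. L v = diff_quot (D vs) x v t"
        using Nil by (simp add: D_def eventually_at_filter linear_add[OF L(1)] linear_scale[OF L(1)])
      then show ?thesis
        using Nil by (intro Lim_transform_eventually[OF tendsto_const]) (simp add: D_def)
    qed (auto simp: D_def split: list.splits)
  next
    fix k x and v :: "nat \<Rightarrow> 'v" and F :: "('v \<times> (nat \<Rightarrow> 'v)) filter"
    assume *: "(fst \<longlongrightarrow> x) F" "\<And>i. i < k \<Longrightarrow> ((\<lambda>z. snd z i) \<longlongrightarrow> v i) F"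
    consider "k = 0" | "k = 1" | m where "k = Suc (Suc m)"
      by (metis One_nat_def not0_implies_Suc)
    then show "((\<lambda>z. D (map (snd z) [0..<k]) (fst z)) \<longlongrightarrow> D (map v [0..<k]) x) F"
    proof cases
      case 1
      then show ?thesis
        by (simp add: D_def isCont_tendsto_compose[OF isCont *(1)])
    next
      case 2
      then show ?thesis
        using isCont_tendsto_compose[OF isCont *(2)[of 0]] by (simp add: D_def)
    next
      case 3
      then show ?thesis
        by (simp add: D_def upt_conv_Cons del: upt_Suc)
    qed
  qed fact
  then show ?thesis unfolding smooth_on_iff_family by (force simp: D_def)
qed

lemma smooth_on_bilinear:
  fixes b :: "'v::locally_convex_space \<Rightarrow> 'w::locally_convex_space \<Rightarrow> 'u::locally_convex_space"
  assumes b1: "\<And>y. linear (\<lambda>x. b x y)" and b2: "\<And>x. linear (\<lambda>y. b x y)"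
    and cont: "continuous_on UNIV (\<lambda>p. b (fst p) (snd p))"
  shows "smooth UNIV (\<lambda>p. b (fst p) (snd p))"
proof -
  define D where "D vs p = (case vs of [] \<Rightarrow> b (fst p) (snd p)
    | [v] \<Rightarrow> b (fst v) (snd p) + b (fst p) (snd v)
    | [w, v] \<Rightarrow> b (fst v) (snd w) + b (fst w) (snd v) | _ \<Rightarrow> 0)" for vs p
  have lim: "((\<lambda>z. b (x z) (y z)) \<longlongrightarrow> b x0 y0) F" if "(x \<longlongrightarrow> x0) F" "(y \<longlongrightarrow> y0) F" for x y x0 y0 F
  proof -
    have "isCont (\<lambda>p. b (fst p) (snd p)) (x0, y0)"
      using cont by (simp add: continuous_on_eq_continuous_at)
    from isCont_tendsto_compose[OF this tendsto_Pair[OF that]] show ?thesis by simp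
  qed
  note lin = linear_add[OF b1] linear_add[OF b2] linear_scale[OF b1] linear_scale[OF b2]
  have "smooth_family UNIV D"
  proof (rule smooth_familyI)
    fix vs :: "('v \<times> 'w) list" and v x :: "'v \<times> 'w"
    consider "vs = []" | w where "vs = [w]" | w w' where "vs = [w, w']" | w w' w'' ws where "vs = w # w' # w'' # ws"
      by (metis list.exhaust)
    then show "((\<lambda>t. diff_quot (D vs) x v t) \<longlongrightarrow> D (v # vs) x) (at 0)"
    proof cases
      case 1
      have "((\<lambda>t. (b (fst v) (snd x) + b (fst x) (snd v)) + t *\<^sub>R b (fst v) (snd v))
          \<longlongrightarrow> b (fst v) (snd x) + b (fst x) (snd v)) (at 0)"
        by (rule tendsto_add_scaled[OF at_zero_ident]) auto
      moreover have "\<forall>\<^sub>F t in at 0. (b (fst v) (snd x) + b (fst x) (snd v)) + t *\<^sub>R b (fst v) (snd v)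
          = diff_quot (D vs) x v t"
        using 1 by (simp add: D_def eventually_at_filter lin scaleR_add_right)
      ultimately have "((\<lambda>t. diff_quot (D vs) x v t)
          \<longlongrightarrow> b (fst v) (snd x) + b (fst x) (snd v)) (at 0)"
        by (rule Lim_transform_eventually)
      then show ?thesis using 1 by (simp add: D_def)
    next
      case 2
      have "\<forall>\<^sub>F t in at 0. b (fst w) (snd v) + b (fst v) (snd w) = diff_quot (D vs) x v t"
        using 2 by (simp add: D_def eventually_at_filter lin scaleR_add_right)
      then show ?thesis
        using 2 by (intro Lim_transform_eventually[OF tendsto_const]) (simp add: D_def)
    qed (auto simp: D_def)
  next
    fix k x and v :: "nat \<Rightarrow> 'v \<times> 'w" and F :: "(('v \<times> 'w) \<times> (nat \<Rightarrow> 'v \<times> 'w)) filter"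
    assume *: "(fst \<longlongrightarrow> x) F" "\<And>i. i < k \<Longrightarrow> ((\<lambda>z. snd z i) \<longlongrightarrow> v i) F"
    consider "k = 0" | "k = 1" | "k = 2" | m where "k = Suc (Suc (Suc m))"
      by (metis One_nat_def not0_implies_Suc numeral_2_eq_2)
    then show "((\<lambda>z. D (map (snd z) [0..<k]) (fst z)) \<longlongrightarrow> D (map v [0..<k]) x) F"
    proof cases
      case 1
      then show ?thesis
        by (simp add: D_def lim tendsto_fst[OF *(1)] tendsto_snd[OF *(1)])
    next
      case 2
      then have "(\<lambda>z. D (map (snd z) [0..<k]) (fst z)) =
          (\<lambda>z. b (fst (snd z 0)) (snd (fst z)) + b (fst (fst z)) (snd (snd z 0)))"
        by (simp add: D_def)
      moreover have "((\<lambda>z. b (fst (snd z 0)) (snd (fst z)) + b (fst (fst z)) (snd (snd z 0)))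
          \<longlongrightarrow> b (fst (v 0)) (snd x) + b (fst x) (snd (v 0))) F"
        using 2 by (intro tendsto_add lim tendsto_fst tendsto_snd *) auto
      ultimately show ?thesis using 2 by (simp add: D_def)
    next
      case 3
      then have "(\<lambda>z. D (map (snd z) [0..<k]) (fst z)) =
          (\<lambda>z. b (fst (snd z 1)) (snd (snd z 0)) + b (fst (snd z 0)) (snd (snd z 1)))"
        by (simp add: D_def upt_rec numeral_2_eq_2)
      moreover have "((\<lambda>z. b (fst (snd z 1)) (snd (snd z 0)) + b (fst (snd z 0)) (snd (snd z 1)))
          \<longlongrightarrow> b (fst (v 1)) (snd (v 0)) + b (fst (v 0)) (snd (v 1))) F"
        using 3 by (intro tendsto_add lim tendsto_fst tendsto_snd *) auto
      ultimately show ?thesis using 3 by (simp add: D_def upt_rec numeral_2_eq_2)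
    next
      case 4
      then show ?thesis
        by (simp add: D_def upt_conv_Cons del: upt_Suc)
    qed
  qed simp
  then show ?thesis unfolding smooth_on_iff_family by (force simp: D_def)
qed

lemma smooth_on_add:
  fixes f g :: "'v::locally_convex_space \<Rightarrow> 'w::locally_convex_space"
  assumes "smooth U f" "smooth U g"
  shows "smooth U (\<lambda>x. f x + g x)"
proof -
  have "smooth UNIV (\<lambda>p :: 'w \<times> 'w. fst p + snd p)"
    by (rule smooth_on_linear) (auto intro!: linearI continuous_intros simp: scaleR_add_right)
  from smooth_on_compose[OF smooth_on_Pair[OF assms] this] show ?thesis by simp
qed

lemma smooth_on_scaleR:
  fixes f :: "'v::locally_convex_space \<Rightarrow> 'w::locally_convex_space"
  assumes "smooth U f"
  shows "smooth U (\<lambda>x. r *\<^sub>R f x)"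
proof -
  have "smooth UNIV (\<lambda>y :: 'w. r *\<^sub>R y)"
    by (rule smooth_on_linear) (auto intro!: linearI continuous_on_scaleR_lcs continuous_intros simp: scaleR_add_right)
  from smooth_on_compose[OF assms this] show ?thesis by simp
qed

text \<open>The value \<open>dir_deriv f x u\<close> is the derivative of \<open>f(x + s u)\<close> with respect to \<open>s\<close> at 0. So it comes
  from a smooth map of \<open>((x, u), s)\<close> by differentiation in the fixed direction \<open>(0, 1)\<close>, which
  preserves smoothness.\<close>

lemma smooth_on_tangent:
  fixes f :: "'v::locally_convex_space \<Rightarrow> 'w::locally_convex_space"
  assumes f: "smooth U f"
  shows "smooth (U \<times> UNIV) (\<lambda>p. dir_deriv f (fst p) (snd p))"
proof -
  define \<phi> where "\<phi> q = fst (fst q) + snd q *\<^sub>R snd (fst q)" for q :: "('v \<times> 'v) \<times> real"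
  have "smooth UNIV (\<lambda>p :: real \<times> 'v. fst p *\<^sub>R snd p)"
  proof (rule smooth_on_bilinear)
    show "continuous_on UNIV (\<lambda>p :: real \<times> 'v. fst p *\<^sub>R snd p)"
      by (intro continuous_on_scaleR_lcs continuous_intros)
  qed (auto intro!: linearI simp: scaleR_add_left scaleR_add_right)
  then have "smooth UNIV (\<lambda>q :: ('v \<times> 'v) \<times> real. fst (snd q, snd (fst q)) *\<^sub>R snd (snd q, snd (fst q)))"
    by (rule smooth_on_compose[rotated])
      (auto intro!: smooth_on_linear linearI continuous_intros simp: scaleR_add_right)
  then have sc: "smooth UNIV (\<lambda>q :: ('v \<times> 'v) \<times> real. snd q *\<^sub>R snd (fst q))" by simp
  have "smooth UNIV (\<lambda>q :: ('v \<times> 'v) \<times> real. fst (fst q))"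
    by (intro smooth_on_linear linearI) (auto intro!: continuous_intros)
  from smooth_on_Pair[OF this sc]
  have "smooth UNIV (\<lambda>q :: ('v \<times> 'v) \<times> real. (fst (fst q), snd q *\<^sub>R snd (fst q)))" .
  then have "smooth UNIV (\<lambda>q :: ('v \<times> 'v) \<times> real.
      fst (fst (fst q), snd q *\<^sub>R snd (fst q)) + snd (fst (fst q), snd q *\<^sub>R snd (fst q)))"
    by (rule smooth_on_compose[where g = "\<lambda>p. fst p + snd p" and V = UNIV])
      (auto intro!: smooth_on_linear linearI continuous_intros simp: scaleR_add_right)
  then have \<phi>: "smooth UNIV \<phi>" by (simp add: \<phi>_def[abs_def])
  let ?O = "\<phi> -` U"
  have U: "open U" using f by (rule smooth_on_open)
  have O: "open ?O"
    using smooth_on_continuous_on[OF \<phi>] U by (simp add: continuous_on_open_vimage)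
  have "smooth ?O (\<lambda>q. f (\<phi> q))"
    by (rule smooth_on_compose[OF smooth_on_subset[OF \<phi> O] f]) auto
  then have "smooth ?O (\<lambda>q. dir_deriv (\<lambda>q. f (\<phi> q)) q (0, 1))"
    by (rule smooth_on_dir_deriv)
  then have "smooth (U \<times> UNIV) (\<lambda>p. dir_deriv (\<lambda>q. f (\<phi> q)) (p, 0) (0, 1))"
    by (rule smooth_on_compose[rotated])
      (auto intro!: smooth_on_linear linearI continuous_intros open_Times U simp: \<phi>_def)
  moreover have "dir_deriv (\<lambda>q. f (\<phi> q)) (p, 0) (0, 1) = dir_deriv f (fst p) (snd p)" for p
    by (simp add: dir_deriv_def \<phi>_def)
  ultimately show ?thesis by simp
qed

section \<open>Tangent maps of manifolds\<close>

definition chart_rep ::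
  "('m \<Rightarrow> 'm) \<Rightarrow> ('m, 'e) chart \<Rightarrow> ('m, 'e) chart \<Rightarrow> 'e \<Rightarrow> 'e"
  where "chart_rep f c d = (\<lambda>x. snd d (f (chart_inv c x)))"

text \<open>For the self-maps whose tangent maps are used, namely compositions of translations, first-order
  differentiability in charts suffices for the chain rule.\<close>

definition strictly_differentiable_map ::
  "'m topology \<Rightarrow> ('m, 'e::locally_convex_space) chart set \<Rightarrow> ('m \<Rightarrow> 'm) \<Rightarrow> bool" where
  "strictly_differentiable_map T A f \<longleftrightarrow> continuous_map T T f \<and>
     (\<forall>c\<in>A. \<forall>d\<in>A. \<forall>p\<in>fst c. f p \<in> fst d \<longrightarrow>
        strict_deriv (chart_rep f c d) (dir_deriv (chart_rep f c d) (snd c p)) (snd c p))"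

lemma strict_deriv_imp_dir_deriv:
  assumes "strict_deriv f f' x"
  shows "strict_deriv f (dir_deriv f x) x"
proof -
  have "dir_deriv f x = f'" using strict_deriv_dir_deriv[OF assms] by auto
  then show ?thesis using assms by simp
qed

locale manifold =
  fixes T :: "'m topology" and A :: "('m, 'e::locally_convex_space) chart set"
  assumes manifold: "smooth_manifold T A"
begin

lemma chart_openin: "c \<in> A \<Longrightarrow> openin T (fst c)"
  and chart_image_open: "c \<in> A \<Longrightarrow> open (snd c ` fst c)"
  and chart_homeomorphic:
    "c \<in> A \<Longrightarrow> homeomorphic_map (subtopology T (fst c)) (top_of_set (snd c ` fst c)) (snd c)"
  and transition_smooth: "c \<in> A \<Longrightarrow> d \<in> A \<Longrightarrow>
    smooth (snd c ` (fst c \<inter> fst d)) (snd d \<circ> chart_inv c)"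
  using manifold unfolding smooth_manifold_def by auto

lemma chart_at:
  assumes "p \<in> topspace T"
  obtains c where "c \<in> A" "p \<in> fst c"
proof -
  have "p \<in> \<Union> (fst ` A)" using assms manifold unfolding smooth_manifold_def by simp
  then show ?thesis using that by blast
qed

lemma chart_subset: "c \<in> A \<Longrightarrow> fst c \<subseteq> topspace T"
  using chart_openin openin_subset by blast

lemma chart_inj: "c \<in> A \<Longrightarrow> inj_on (snd c) (fst c)"
  using homeomorphic_imp_injective_map[OF chart_homeomorphic] chart_subset
  by (simp add: Int_absorb1)

lemma chart_inv_left [simp]: "c \<in> A \<Longrightarrow> p \<in> fst c \<Longrightarrow> chart_inv c (snd c p) = p"
  using chart_inj by simp

lemma chart_inv_in: "x \<in> snd c ` fst c \<Longrightarrow> chart_inv c x \<in> fst c"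
  by (rule inv_into_into)

lemma chart_inv_right: "x \<in> snd c ` fst c \<Longrightarrow> snd c (chart_inv c x) = x"
  by (rule f_inv_into_f)

lemma chart_continuous: "c \<in> A \<Longrightarrow> continuous_map (subtopology T (fst c)) euclidean (snd c)"
  using homeomorphic_imp_continuous_map[OF chart_homeomorphic]
  by (simp add: continuous_map_in_subtopology)

lemma chart_inv_continuous:
  assumes "c \<in> A"
  shows "continuous_map (top_of_set (snd c ` fst c)) T (chart_inv c)"
proof -
  have "homeomorphic_maps (subtopology T (fst c)) (top_of_set (snd c ` fst c)) (snd c) (chart_inv c)"
  proof -
    obtain g where g: "homeomorphic_maps (subtopology T (fst c)) (top_of_set (snd c ` fst c)) (snd c) g"
      using chart_homeomorphic[OF assms] homeomorphic_map_maps by blast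
    then have "g x = chart_inv c x" if "x \<in> snd c ` fst c" for x
      using that chart_subset[OF assms] chart_inv_left[OF assms]
      unfolding homeomorphic_maps_def by auto
    then show ?thesis
      using g by (elim homeomorphic_maps_eq) auto
  qed
  then show ?thesis
    by (simp add: homeomorphic_maps_def continuous_map_in_subtopology)
qed

lemma open_chart_preimage:
  assumes "c \<in> A" "openin T V"
  shows "open {x \<in> snd c ` fst c. chart_inv c x \<in> V}"
proof -
  have "openin (top_of_set (snd c ` fst c)) {x \<in> topspace (top_of_set (snd c ` fst c)). chart_inv c x \<in> V}"
    using chart_inv_continuous[OF assms(1)] assms(2) by (rule openin_continuous_map_preimage)
  then show ?thesis
    using chart_image_open[OF assms(1)] openin_open_trans by fastforce
qed

lemma chart_rep_domain_open:
  assumes "continuous_map T T f" "c \<in> A" "d \<in> A"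
  shows "open {x \<in> snd c ` fst c. f (chart_inv c x) \<in> fst d}"
proof -
  have "openin T {p \<in> topspace T. f p \<in> fst d}"
    using assms(1) chart_openin[OF assms(3)] by (rule openin_continuous_map_preimage)
  from open_chart_preimage[OF assms(2) this]
  have "open {x \<in> snd c ` fst c. chart_inv c x \<in> {p \<in> topspace T. f p \<in> fst d}}" .
  also have "{x \<in> snd c ` fst c. chart_inv c x \<in> {p \<in> topspace T. f p \<in> fst d}}
      = {x \<in> snd c ` fst c. f (chart_inv c x) \<in> fst d}"
    using chart_subset[OF assms(2)] chart_inv_in[of _ c] by blast
  finally show ?thesis .
qed

lemma strictly_differentiable_id: "strictly_differentiable_map T A (\<lambda>x. x)"
  unfolding strictly_differentiable_map_def
proof (intro conjI ballI impI)
  fix c d p assume *: "c \<in> A" "d \<in> A" "p \<in> fst c" "p \<in> fst d"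
  then have "snd c p \<in> snd c ` (fst c \<inter> fst d)" by auto
  from smooth_on_strict_deriv[OF transition_smooth[OF *(1,2)] this]
  show "strict_deriv (chart_rep (\<lambda>x. x) c d) (dir_deriv (chart_rep (\<lambda>x. x) c d) (snd c p)) (snd c p)"
    by (simp add: chart_rep_def o_def)
qed simp

lemma chart_rep_compose_deriv:
  assumes f: "strictly_differentiable_map T A f" and g: "strictly_differentiable_map T A g"
    and c: "c \<in> A" "p \<in> fst c" and d: "d \<in> A" "g p \<in> fst d" and e: "e \<in> A" "f (g p) \<in> fst e"
  shows "strict_deriv (chart_rep (\<lambda>x. f (g x)) c e)
    (\<lambda>u. dir_deriv (chart_rep f d e) (snd d (g p)) (dir_deriv (chart_rep g c d) (snd c p) u)) (snd c p)"
proof (rule strict_deriv_cong)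
  let ?U = "{x \<in> snd c ` fst c. g (chart_inv c x) \<in> fst d}"
  show "open ?U"
    using g c(1) d(1) by (intro chart_rep_domain_open) (auto simp: strictly_differentiable_map_def)
  show "snd c p \<in> ?U" using c d by simp
  show "chart_rep f d e (chart_rep g c d x) = chart_rep (\<lambda>x. f (g x)) c e x" if "x \<in> ?U" for x
    using that d by (simp add: chart_rep_def)
  have "strict_deriv (chart_rep g c d) (dir_deriv (chart_rep g c d) (snd c p)) (snd c p)"
    using g c d unfolding strictly_differentiable_map_def by blast
  moreover have "strict_deriv (chart_rep f d e) (dir_deriv (chart_rep f d e) (snd d (g p)))
      (chart_rep g c d (snd c p))"
    using f c d e unfolding strictly_differentiable_map_def by (simp add: chart_rep_def)
  ultimately show "strict_deriv (\<lambda>x. chart_rep f d e (chart_rep g c d x))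
    (\<lambda>u. dir_deriv (chart_rep f d e) (snd d (g p)) (dir_deriv (chart_rep g c d) (snd c p) u)) (snd c p)"
    by (rule strict_deriv_compose)
qed

lemmas chart_rep_compose = strict_deriv_dir_deriv[OF chart_rep_compose_deriv]

lemma strictly_differentiable_compose:
  assumes f: "strictly_differentiable_map T A f" and g: "strictly_differentiable_map T A g"
  shows "strictly_differentiable_map T A (\<lambda>x. f (g x))"
  unfolding strictly_differentiable_map_def
proof (intro conjI ballI impI)
  have cf: "continuous_map T T f" and cg: "continuous_map T T g"
    using f g by (simp_all add: strictly_differentiable_map_def)
  show "continuous_map T T (\<lambda>x. f (g x))"
    using continuous_map_compose[OF cg cf] by (simp add: o_def)
  fix c d p assume *: "c \<in> A" "d \<in> A" "p \<in> fst c" "f (g p) \<in> fst d"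
  have "g p \<in> topspace T"
    using cg chart_subset[OF *(1)] *(3) continuous_map_image_subset_topspace by blast
  then obtain b where "b \<in> A" "g p \<in> fst b" by (rule chart_at)
  from strict_deriv_imp_dir_deriv[OF chart_rep_compose_deriv[OF f g *(1,3) this *(2,4)]]
  show "strict_deriv (chart_rep (\<lambda>x. f (g x)) c d)
      (dir_deriv (chart_rep (\<lambda>x. f (g x)) c d) (snd c p)) (snd c p)" .
qed

lemma tangent_space_coord:
  "v \<in> tangent_space A p \<Longrightarrow> c \<in> A \<Longrightarrow> d \<in> A \<Longrightarrow> p \<in> fst c \<Longrightarrow> p \<in> fst d \<Longrightarrow>
    v d = dir_deriv (chart_rep (\<lambda>x. x) c d) (snd c p) (v c)"
  unfolding tangent_space_def chart_rep_def o_def by blast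

lemma tangent_space_outside:
  "v \<in> tangent_space A p \<Longrightarrow> \<not> (c \<in> A \<and> p \<in> fst c) \<Longrightarrow> v c = 0"
  unfolding tangent_space_def by blast

lemma tangent_eqI:
  assumes "v \<in> tangent_space A p" "w \<in> tangent_space A p" "c \<in> A" "p \<in> fst c" "v c = w c"
  shows "v = w"
proof
  fix d
  show "v d = w d"
    using assms tangent_space_coord[of _ p c d] tangent_space_outside[of _ p d] by metis
qed

text \<open>The definition of \<^const>\<open>tangent_map\<close> uses an arbitrarily chosen chart at \<open>p\<close>. The chain rule
  with the identity as inner map shows that any other chart gives the same vector.\<close>

lemma tangent_map_chart:
  assumes f: "strictly_differentiable_map T A f" and v: "v \<in> tangent_space A p"
    and c: "c \<in> A" "p \<in> fst c" and d: "d \<in> A" "f p \<in> fst d"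
  shows "tangent_map A A f p v d = dir_deriv (chart_rep f c d) (snd c p) (v c)"
proof -
  define b where "b = (SOME c. c \<in> A \<and> p \<in> fst c)"
  have b: "b \<in> A" "p \<in> fst b"
    using someI[of "\<lambda>c. c \<in> A \<and> p \<in> fst c" c] c by (auto simp: b_def)
  have "tangent_map A A f p v d = dir_deriv (chart_rep f b d) (snd b p) (v b)"
    using d by (simp add: tangent_map_def chart_rep_def o_def b_def[symmetric])
  also have "v b = dir_deriv (chart_rep (\<lambda>x. x) c b) (snd c p) (v c)"
    by (rule tangent_space_coord[OF v c(1) b(1) c(2) b(2)])
  also have "dir_deriv (chart_rep f b d) (snd b p) \<dots> = dir_deriv (chart_rep f c d) (snd c p) (v c)"
    using chart_rep_compose[OF f strictly_differentiable_id c b d] by simp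
  finally show ?thesis .
qed

lemma tangent_map_outside: "\<not> (d \<in> A \<and> f p \<in> fst d) \<Longrightarrow> tangent_map A A f p v d = 0"
  unfolding tangent_map_def Let_def by (rule if_not_P)

lemma tangent_map_in:
  assumes f: "strictly_differentiable_map T A f" and p: "p \<in> topspace T" and v: "v \<in> tangent_space A p"
  shows "tangent_map A A f p v \<in> tangent_space A (f p)"
proof -
  obtain b where b: "b \<in> A" "p \<in> fst b" using chart_at[OF p] .
  show ?thesis
    unfolding tangent_space_def
  proof (intro CollectI conjI ballI allI impI)
    fix c d assume c: "c \<in> A" "f p \<in> fst c" and d: "d \<in> A" "f p \<in> fst d"
    show "tangent_map A A f p v d = dir_deriv (snd d \<circ> chart_inv c) (snd c (f p)) (tangent_map A A f p v c)"
      using chart_rep_compose[OF strictly_differentiable_id f b c d]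
      by (simp add: tangent_map_chart[OF f v b c] tangent_map_chart[OF f v b d] chart_rep_def o_def)
  qed (rule tangent_map_outside)
qed

lemma tangent_map_compose:
  assumes f: "strictly_differentiable_map T A f" and g: "strictly_differentiable_map T A g"
    and p: "p \<in> topspace T" and v: "v \<in> tangent_space A p"
  shows "tangent_map A A f (g p) (tangent_map A A g p v) = tangent_map A A (\<lambda>x. f (g x)) p v"
proof -
  obtain c where c: "c \<in> A" "p \<in> fst c" using chart_at[OF p] .
  have "g p \<in> topspace T"
    using g p continuous_map_image_subset_topspace unfolding strictly_differentiable_map_def by blast
  then obtain d where d: "d \<in> A" "g p \<in> fst d" by (rule chart_at)
  then have "f (g p) \<in> topspace T"
    using f chart_subset continuous_map_image_subset_topspace
    unfolding strictly_differentiable_map_def by blast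
  then obtain e where e: "e \<in> A" "f (g p) \<in> fst e" by (rule chart_at)
  show ?thesis
  proof (rule tangent_eqI[OF _ _ e])
    show "tangent_map A A f (g p) (tangent_map A A g p v) \<in> tangent_space A (f (g p))"
      by (intro tangent_map_in f g p v \<open>g p \<in> topspace T\<close>)
    show "tangent_map A A (\<lambda>x. f (g x)) p v \<in> tangent_space A (f (g p))"
      using tangent_map_in[OF strictly_differentiable_compose[OF f g] p v] by simp
    show "tangent_map A A f (g p) (tangent_map A A g p v) e = tangent_map A A (\<lambda>x. f (g x)) p v e"
      using chart_rep_compose[OF f g c d e]
      by (simp add: tangent_map_chart[OF f tangent_map_in[OF g p v] d e]
          tangent_map_chart[OF g v c d] tangent_map_chart[OF strictly_differentiable_compose[OF f g] v c e])
  qed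
qed

lemma tangent_map_cong:
  assumes p: "p \<in> topspace T" and eq: "\<And>x. x \<in> topspace T \<Longrightarrow> f x = g x"
  shows "tangent_map A A f p v = tangent_map A A g p v"
proof -
  define b where "b = (SOME c. c \<in> A \<and> p \<in> fst c)"
  have b: "b \<in> A" "p \<in> fst b"
    using someI_ex[of "\<lambda>c. c \<in> A \<and> p \<in> fst c"] chart_at[OF p] by (metis b_def)+
  have "dir_deriv (snd d \<circ> f \<circ> chart_inv b) (snd b p) u = dir_deriv (snd d \<circ> g \<circ> chart_inv b) (snd b p) u"
    for d :: "('m, 'e) chart" and u
    by (rule dir_deriv_cong[OF chart_image_open[OF b(1)]])
      (use b chart_subset[OF b(1)] chart_inv_in[of _ b] in \<open>auto simp: eq subset_iff\<close>)
  then show ?thesis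
    unfolding tangent_map_def Let_def b_def[symmetric] using eq[OF p] by auto
qed

lemma tangent_map_id:
  assumes p: "p \<in> topspace T" and v: "v \<in> tangent_space A p"
  shows "tangent_map A A (\<lambda>x. x) p v = v"
proof -
  obtain c where c: "c \<in> A" "p \<in> fst c" using chart_at[OF p] .
  show ?thesis
    by (rule tangent_eqI[OF tangent_map_in[OF strictly_differentiable_id p v] v c])
      (use tangent_map_chart[OF strictly_differentiable_id v c c] tangent_space_coord[OF v c(1) c(1) c(2) c(2)] in simp)
qed

lemma transition_linear:
  assumes "c \<in> A" "d \<in> A" "p \<in> fst c" "p \<in> fst d"
  shows "linear (dir_deriv (chart_rep (\<lambda>x. x) c d) (snd c p))"
  using strictly_differentiable_id assms strict_deriv_linear unfolding strictly_differentiable_map_def by blast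

lemma tangent_space_subspace: "subspace (tangent_space A p)"
proof (rule subspaceI)
  note tr = transition_linear[unfolded chart_rep_def]
  show "0 \<in> tangent_space A p"
    by (simp add: tangent_space_def o_def linear_0[OF tr])
  fix v w assume v: "v \<in> tangent_space A p" and w: "w \<in> tangent_space A p"
  show "v + w \<in> tangent_space A p"
    unfolding tangent_space_def
  proof (intro CollectI conjI allI ballI impI)
    fix c d assume c: "c \<in> A" "p \<in> fst c" and d: "d \<in> A" "p \<in> fst d"
    show "(v + w) d = dir_deriv (snd d \<circ> chart_inv c) (snd c p) ((v + w) c)"
      using linear_add[OF tr[OF c(1) d(1) c(2) d(2)]]
        tangent_space_coord[OF v c(1) d(1) c(2) d(2)] tangent_space_coord[OF w c(1) d(1) c(2) d(2)]
      by (simp add: chart_rep_def o_def)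
  qed (simp add: tangent_space_outside[OF v] tangent_space_outside[OF w])
  fix r
  show "r *\<^sub>R v \<in> tangent_space A p"
    unfolding tangent_space_def
  proof (intro CollectI conjI allI ballI impI)
    fix c d assume c: "c \<in> A" "p \<in> fst c" and d: "d \<in> A" "p \<in> fst d"
    show "(r *\<^sub>R v) d = dir_deriv (snd d \<circ> chart_inv c) (snd c p) ((r *\<^sub>R v) c)"
      using linear_scale[OF tr[OF c(1) d(1) c(2) d(2)]] tangent_space_coord[OF v c(1) d(1) c(2) d(2)]
      by (simp add: chart_rep_def o_def)
  qed (simp add: tangent_space_outside[OF v])
qed

lemma tvec_of_chart:
  assumes "c \<in> A" "p \<in> fst c" "d \<in> A" "p \<in> fst d"
  shows "tvec_of A c p u d = dir_deriv (chart_rep (\<lambda>x. x) c d) (snd c p) u"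
  using assms by (simp add: tvec_of_def chart_rep_def o_def)

lemma tvec_of_self:
  assumes c: "c \<in> A" "p \<in> fst c"
  shows "tvec_of A c p u c = u"
proof -
  have "strict_deriv (chart_rep (\<lambda>x. x) c c) (\<lambda>x. x) (snd c p)"
    by (rule strict_deriv_cong[OF strict_deriv_ident chart_image_open[OF c(1)]])
      (use c in \<open>auto simp: chart_rep_def chart_inv_right\<close>)
  then show ?thesis
    using tvec_of_chart[OF c c] strict_deriv_dir_deriv by metis
qed

lemma tvec_of_in:
  assumes c: "c \<in> A" "p \<in> fst c"
  shows "tvec_of A c p u \<in> tangent_space A p"
  unfolding tangent_space_def
proof (intro CollectI conjI ballI allI impI)
  fix d e assume d: "d \<in> A" "p \<in> fst d" and e: "e \<in> A" "p \<in> fst e"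
  show "tvec_of A c p u e = dir_deriv (snd e \<circ> chart_inv d) (snd d p) (tvec_of A c p u d)"
    using chart_rep_compose[OF strictly_differentiable_id strictly_differentiable_id c d e]
    by (simp add: tvec_of_chart[OF c d] tvec_of_chart[OF c e]) (simp add: chart_rep_def o_def)
qed (auto simp: tvec_of_def)

lemma tvec_of_coord:
  assumes c: "c \<in> A" "p \<in> fst c" and v: "v \<in> tangent_space A p"
  shows "tvec_of A c p (v c) = v"
  by (rule tangent_eqI[OF tvec_of_in[OF c] v c tvec_of_self[OF c]])

lemma tvec_of_linear:
  assumes c: "c \<in> A" "p \<in> fst c"
  shows "linear (tvec_of A c p)"
proof (rule linearI)
  note sub = tangent_space_subspace[of p] and self = tvec_of_self[OF c] and in' = tvec_of_in[OF c]
  show "tvec_of A c p (u + w) = tvec_of A c p u + tvec_of A c p w" for u w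
    by (rule tangent_eqI[OF _ _ c]) (auto simp: self intro: in' subspace_add[OF sub])
  show "tvec_of A c p (r *\<^sub>R u) = r *\<^sub>R tvec_of A c p u" for r u
    by (rule tangent_eqI[OF _ _ c]) (auto simp: self intro: in' subspace_scale[OF sub])
qed

lemma tangent_map_linear:
  assumes f: "strictly_differentiable_map T A f" and p: "p \<in> topspace T"
    and v: "v \<in> tangent_space A p" and w: "w \<in> tangent_space A p"
  shows "tangent_map A A f p (v + w) = tangent_map A A f p v + tangent_map A A f p w"
    and "tangent_map A A f p (r *\<^sub>R v) = r *\<^sub>R tangent_map A A f p v"
proof -
  obtain c where c: "c \<in> A" "p \<in> fst c" using chart_at[OF p] .
  have "f p \<in> topspace T"
    using f p continuous_map_image_subset_topspace unfolding strictly_differentiable_map_def by blast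
  then obtain d where d: "d \<in> A" "f p \<in> fst d" by (rule chart_at)
  note sub = tangent_space_subspace[of p] and sub' = tangent_space_subspace[of "f p"]
  have lin: "linear (dir_deriv (chart_rep f c d) (snd c p))"
    using f c d strict_deriv_linear unfolding strictly_differentiable_map_def by blast
  show "tangent_map A A f p (v + w) = tangent_map A A f p v + tangent_map A A f p w"
    by (rule tangent_eqI[OF tangent_map_in[OF f p subspace_add[OF sub v w]]
          subspace_add[OF sub' tangent_map_in[OF f p v] tangent_map_in[OF f p w]] d])
      (simp add: tangent_map_chart[OF f _ c d] v w subspace_add[OF sub] linear_add[OF lin])
  show "tangent_map A A f p (r *\<^sub>R v) = r *\<^sub>R tangent_map A A f p v"
    by (rule tangent_eqI[OF tangent_map_in[OF f p subspace_scale[OF sub v]]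
          subspace_scale[OF sub' tangent_map_in[OF f p v]] d])
      (simp add: tangent_map_chart[OF f _ c d] v subspace_scale[OF sub] linear_scale[OF lin])
qed

text \<open>Together with continuity of evaluation at \<open>c\<close> this makes \<open>v \<mapsto> v c\<close> a homeomorphism from the tangent
  space, with the product topology of the function type, to the model space.\<close>

lemma tvec_of_continuous:
  assumes c: "c \<in> A" "p \<in> fst c"
  shows "continuous_on UNIV (tvec_of A c p)"
proof (rule continuous_on_coordinatewise_then_product)
  fix d
  show "continuous_on UNIV (\<lambda>u. tvec_of A c p u d)"
  proof (cases "d \<in> A \<and> p \<in> fst d")
    case True
    then have "snd c p \<in> snd c ` (fst c \<inter> fst d)" using c by auto
    from dir_deriv_tendsto[OF transition_smooth[OF c(1)] this tendsto_const tendsto_ident_at]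
    have "((\<lambda>u. tvec_of A c p u d) \<longlongrightarrow> tvec_of A c p w d) (at w)" for w
      using True by (simp add: tvec_of_def tendsto_ident_at)
    then show ?thesis by (simp add: continuous_on_def)
  next
    case False
    then have "tvec_of A c p u d = 0" for u unfolding tvec_of_def by (rule if_not_P)
    then show ?thesis by simp
  qed
qed

end

section \<open>Translations in a Lie group\<close>

locale lie_group_manifold =
  fixes G :: "('g, 'x) monoid_scheme" (structure)
    and T :: "'g topology" and A :: "('g, 'e::locally_convex_space) chart set"
  assumes lie_group: "lie_group G T A"
begin

sublocale group G
  using lie_group by (simp add: lie_group_def)

sublocale manifold T A
  using lie_group by unfold_locales (simp add: lie_group_def)

lemma carrier_eq: "carrier G = topspace T"
  using lie_group by (simp add: lie_group_def)

lemma chart_carrier: "c \<in> A \<Longrightarrow> x \<in> fst c \<Longrightarrow> x \<in> carrier G"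
  using chart_subset carrier_eq by blast

lemma chart_inv_carrier: "c \<in> A \<Longrightarrow> x \<in> snd c ` fst c \<Longrightarrow> chart_inv c x \<in> carrier G"
  by (rule chart_carrier[OF _ chart_inv_in])

lemma mult_continuous: "continuous_map (prod_topology T T) T (\<lambda>(x, y). x \<otimes> y)"
  using lie_group unfolding lie_group_def smooth_map_def by blast

lemma mult_smooth:
  assumes c: "c \<in> A" and d: "d \<in> A" and k: "k \<in> A"
  shows "smooth
    {q \<in> (snd c ` fst c) \<times> (snd d ` fst d). chart_inv c (fst q) \<otimes> chart_inv d (snd q) \<in> fst k}
    (\<lambda>q. snd k (chart_inv c (fst q) \<otimes> chart_inv d (snd q)))"
proof -
  let ?C = "(fst c \<times> fst d, map_prod (snd c) (snd d))"
  have "?C \<in> prod_atlas A A" using c d unfolding prod_atlas_def by blast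
  then have "smooth_into euclidean (snd ?C ` fst ?C) T A ((\<lambda>(x, y). x \<otimes> y) \<circ> chart_inv ?C)"
    using lie_group unfolding lie_group_def smooth_map_def by blast
  then have sm: "smooth
      {x \<in> snd ?C ` fst ?C. ((\<lambda>(x, y). x \<otimes> y) \<circ> chart_inv ?C) x \<in> fst k}
      (snd k \<circ> ((\<lambda>(x, y). x \<otimes> y) \<circ> chart_inv ?C))"
    using k unfolding smooth_into_def by blast
  have im: "snd ?C ` fst ?C = (snd c ` fst c) \<times> (snd d ` fst d)"
    by (auto simp: map_prod_def image_iff)
  have inv: "chart_inv ?C q = (chart_inv c (fst q), chart_inv d (snd q))"
    if "q \<in> (snd c ` fst c) \<times> (snd d ` fst d)" for q
  proof (rule inv_into_f_eq)
    show "inj_on (snd ?C) (fst ?C)"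
      using chart_inj[OF c] chart_inj[OF d] by (auto intro: map_prod_inj_on)
    show "(chart_inv c (fst q), chart_inv d (snd q)) \<in> fst ?C"
      using that chart_inv_in[of "fst q" c] chart_inv_in[of "snd q" d] by (simp add: mem_Times_iff)
    show "snd ?C (chart_inv c (fst q), chart_inv d (snd q)) = q"
      using that chart_inv_right[of "fst q" c] chart_inv_right[of "snd q" d] by (simp add: mem_Times_iff)
  qed
  have eq: "{x \<in> snd ?C ` fst ?C. ((\<lambda>(x, y). x \<otimes> y) \<circ> chart_inv ?C) x \<in> fst k}
      = {q \<in> (snd c ` fst c) \<times> (snd d ` fst d). chart_inv c (fst q) \<otimes> chart_inv d (snd q) \<in> fst k}"
    unfolding im using inv by (intro Collect_cong conj_cong refl) simp
  from sm show ?thesis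
    unfolding eq
  proof (rule smooth_on_cong)
    fix q assume "q \<in> {q \<in> (snd c ` fst c) \<times> (snd d ` fst d). chart_inv c (fst q) \<otimes> chart_inv d (snd q) \<in> fst k}"
    then have q: "q \<in> (snd c ` fst c) \<times> (snd d ` fst d)" by blast
    show "(snd k \<circ> ((\<lambda>(x, y). x \<otimes> y) \<circ> chart_inv ?C)) q = snd k (chart_inv c (fst q) \<otimes> chart_inv d (snd q))"
      unfolding o_def inv[OF q] by simp
  qed
qed

lemma inv_smooth:
  assumes c: "c \<in> A" and k: "k \<in> A"
  shows "smooth {x \<in> snd c ` fst c. inv (chart_inv c x) \<in> fst k}
    (\<lambda>x. snd k (inv (chart_inv c x)))"
proof -
  have "smooth_into euclidean (snd c ` fst c) T A ((\<lambda>x. inv x) \<circ> chart_inv c)"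
    using lie_group c unfolding lie_group_def smooth_map_def by blast
  then have "smooth {x \<in> snd c ` fst c. ((\<lambda>x. inv x) \<circ> chart_inv c) x \<in> fst k}
      (snd k \<circ> ((\<lambda>x. inv x) \<circ> chart_inv c))"
    using k unfolding smooth_into_def by blast
  then show ?thesis by (simp add: o_def)
qed

lemma strictly_differentiable_left_mult:
  assumes g: "g \<in> carrier G"
  shows "strictly_differentiable_map T A (\<lambda>x. g \<otimes> x)"
  unfolding strictly_differentiable_map_def
proof (intro conjI ballI impI)
  have "continuous_map T (prod_topology T T) (\<lambda>x. (g, x))"
    using g by (intro continuous_map_pairedI) (auto simp: carrier_eq)
  from continuous_map_compose[OF this mult_continuous]
  show "continuous_map T T (\<lambda>x. g \<otimes> x)" by (simp add: o_def)
  fix c d p assume c: "c \<in> A" and d: "d \<in> A" and p: "p \<in> fst c" "g \<otimes> p \<in> fst d"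
  obtain b where b: "b \<in> A" "g \<in> fst b" using g unfolding carrier_eq by (rule chart_at)
  let ?m = "\<lambda>q. snd d (chart_inv b (fst q) \<otimes> chart_inv c (snd q))"
  have 1: "strict_deriv (\<lambda>x. (snd b g, x)) (\<lambda>x. (0, x)) (snd c p)"
    by (rule strict_deriv_Pair[OF strict_deriv_const strict_deriv_ident])
  have "strict_deriv ?m (dir_deriv ?m (snd b g, snd c p)) (snd b g, snd c p)"
    by (rule smooth_on_strict_deriv[OF mult_smooth[OF b(1) c d]]) (use b c p in auto)
  from strict_deriv_imp_dir_deriv[OF strict_deriv_compose[OF 1 this]]
  show "strict_deriv (chart_rep (\<lambda>x. g \<otimes> x) c d) (dir_deriv (chart_rep (\<lambda>x. g \<otimes> x) c d) (snd c p)) (snd c p)"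
    using b by (simp add: chart_rep_def)
qed

lemma strictly_differentiable_right_mult:
  assumes g: "g \<in> carrier G"
  shows "strictly_differentiable_map T A (\<lambda>x. x \<otimes> g)"
  unfolding strictly_differentiable_map_def
proof (intro conjI ballI impI)
  have "continuous_map T (prod_topology T T) (\<lambda>x. (x, g))"
    using g by (intro continuous_map_pairedI) (auto simp: carrier_eq)
  from continuous_map_compose[OF this mult_continuous]
  show "continuous_map T T (\<lambda>x. x \<otimes> g)" by (simp add: o_def)
  fix c d p assume c: "c \<in> A" and d: "d \<in> A" and p: "p \<in> fst c" "p \<otimes> g \<in> fst d"
  obtain b where b: "b \<in> A" "g \<in> fst b" using g unfolding carrier_eq by (rule chart_at)
  let ?m = "\<lambda>q. snd d (chart_inv c (fst q) \<otimes> chart_inv b (snd q))"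
  have 1: "strict_deriv (\<lambda>x. (x, snd b g)) (\<lambda>x. (x, 0)) (snd c p)"
    by (rule strict_deriv_Pair[OF strict_deriv_ident strict_deriv_const])
  have "strict_deriv ?m (dir_deriv ?m (snd c p, snd b g)) (snd c p, snd b g)"
    by (rule smooth_on_strict_deriv[OF mult_smooth[OF c b(1) d]]) (use b c p in auto)
  from strict_deriv_imp_dir_deriv[OF strict_deriv_compose[OF 1 this]]
  show "strict_deriv (chart_rep (\<lambda>x. x \<otimes> g) c d) (dir_deriv (chart_rep (\<lambda>x. x \<otimes> g) c d) (snd c p)) (snd c p)"
    using b by (simp add: chart_rep_def)
qed

abbreviation "lalg \<equiv> lie_algebra G A"

abbreviation "dL g \<equiv> tangent_map A A (\<lambda>x. g \<otimes> x)"
abbreviation "dR g \<equiv> tangent_map A A (\<lambda>x. x \<otimes> g)"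

lemma dL_in:
  assumes "g \<in> carrier G" "p \<in> carrier G" "v \<in> tangent_space A p"
  shows "dL g p v \<in> tangent_space A (g \<otimes> p)"
  using tangent_map_in[OF strictly_differentiable_left_mult[OF assms(1)] _ assms(3)] assms(2) carrier_eq by simp

lemma dR_in:
  assumes "g \<in> carrier G" "p \<in> carrier G" "v \<in> tangent_space A p"
  shows "dR g p v \<in> tangent_space A (p \<otimes> g)"
  using tangent_map_in[OF strictly_differentiable_right_mult[OF assms(1)] _ assms(3)] assms(2) carrier_eq by simp

lemma dL_lalg: "g \<in> carrier G \<Longrightarrow> v \<in> lalg \<Longrightarrow> dL g \<one> v \<in> tangent_space A g"
  using dL_in[of g \<one> v] by (simp add: lie_algebra_def)

lemma dR_lalg: "g \<in> carrier G \<Longrightarrow> v \<in> lalg \<Longrightarrow> dR g \<one> v \<in> tangent_space A g"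
  using dR_in[of g \<one> v] by (simp add: lie_algebra_def)

lemma dL_dL:
  assumes "g \<in> carrier G" "h \<in> carrier G" "p \<in> carrier G" "v \<in> tangent_space A p"
  shows "dL g (h \<otimes> p) (dL h p v) = dL (g \<otimes> h) p v"
  using tangent_map_compose[OF strictly_differentiable_left_mult[OF assms(1)] strictly_differentiable_left_mult[OF assms(2)] _ assms(4)]
    tangent_map_cong[of p "\<lambda>x. g \<otimes> (h \<otimes> x)" "\<lambda>x. g \<otimes> h \<otimes> x"] assms
  by (simp add: carrier_eq[symmetric] m_assoc)

lemma dL_dR:
  assumes "g \<in> carrier G" "h \<in> carrier G" "p \<in> carrier G" "v \<in> tangent_space A p"
  shows "dL g (p \<otimes> h) (dR h p v) = dR h (g \<otimes> p) (dL g p v)"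
  using tangent_map_compose[OF strictly_differentiable_left_mult[OF assms(1)] strictly_differentiable_right_mult[OF assms(2)] _ assms(4)]
    tangent_map_compose[OF strictly_differentiable_right_mult[OF assms(2)] strictly_differentiable_left_mult[OF assms(1)] _ assms(4)]
    tangent_map_cong[of p "\<lambda>x. g \<otimes> (x \<otimes> h)" "\<lambda>x. g \<otimes> x \<otimes> h"] assms
  by (simp add: carrier_eq[symmetric] m_assoc)

lemma dR_dR:
  assumes "g \<in> carrier G" "h \<in> carrier G" "p \<in> carrier G" "v \<in> tangent_space A p"
  shows "dR h (p \<otimes> g) (dR g p v) = dR (g \<otimes> h) p v"
  using tangent_map_compose[OF strictly_differentiable_right_mult[OF assms(2)] strictly_differentiable_right_mult[OF assms(1)] _ assms(4)]
    tangent_map_cong[of p "\<lambda>x. x \<otimes> g \<otimes> h" "\<lambda>x. x \<otimes> (g \<otimes> h)"] assms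
  by (simp add: carrier_eq[symmetric] m_assoc)

lemma dL_one:
  assumes "p \<in> carrier G" "v \<in> tangent_space A p"
  shows "dL \<one> p v = v"
  using tangent_map_cong[of p "\<lambda>x. \<one> \<otimes> x" "\<lambda>x. x"] tangent_map_id[of p v] assms
  by (simp add: carrier_eq[symmetric])

lemma dR_one:
  assumes "p \<in> carrier G" "v \<in> tangent_space A p"
  shows "dR \<one> p v = v"
  using tangent_map_cong[of p "\<lambda>x. x \<otimes> \<one>" "\<lambda>x. x"] tangent_map_id[of p v] assms
  by (simp add: carrier_eq[symmetric])

lemma dL_inverse:
  assumes "p \<in> carrier G" "v \<in> tangent_space A p"
  shows "dL (inv p) p v \<in> lalg" "dL p \<one> (dL (inv p) p v) = v"
  using dL_in[of "inv p" p v] dL_dL[of p "inv p" p v] dL_one[of p v] assms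
  by (simp_all add: lie_algebra_def)

end

section \<open>The Lie bracket\<close>

context lie_group_manifold
begin

lemma lie_bracket_antisym: "lie_bracket G A v w = - lie_bracket G A w v"
  by (simp add: lie_bracket_def vf_bracket_def fun_eq_iff)

end

text \<open>Computations at the identity are carried out in a fixed chart \<open>k\<close> around it.\<close>

locale lie_group_with_chart = lie_group_manifold G T A
  for G :: "('g, 'x) monoid_scheme" (structure)
    and T :: "'g topology" and A :: "('g, 'e::locally_convex_space) chart set" +
  fixes k :: "('g, 'e) chart"
  assumes k: "k \<in> A" and one_k: "\<one> \<in> fst k"
begin

abbreviation "U \<equiv> snd k ` fst k"
abbreviation "\<epsilon> \<equiv> snd k \<one>"
abbreviation "K \<equiv> chart_inv k"

definition mult_chart :: "'e \<times> 'e \<Rightarrow> 'e"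
  where "mult_chart q = snd k (K (fst q) \<otimes> K (snd q))"

abbreviation "mult_domain \<equiv> {q \<in> U \<times> U. K (fst q) \<otimes> K (snd q) \<in> fst k}"

lemma eps_in: "\<epsilon> \<in> U" using one_k by simp

lemma K_eps [simp]: "K \<epsilon> = \<one>" using k one_k by simp

lemma K_in: "x \<in> U \<Longrightarrow> K x \<in> fst k" by (rule chart_inv_in)

lemma K_carrier: "x \<in> U \<Longrightarrow> K x \<in> carrier G" by (rule chart_inv_carrier[OF k])

lemma mult_chart_smooth: "smooth mult_domain mult_chart"
  using mult_smooth[OF k k k] by (simp add: mult_chart_def[abs_def])

lemma mult_domain_left: "x \<in> U \<Longrightarrow> (x, \<epsilon>) \<in> mult_domain"
  using eps_in K_in K_carrier by simp

lemma dL_chart: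
  assumes x: "x \<in> U" and v: "v \<in> lalg"
  shows "dL (K x) \<one> v k = dir_deriv mult_chart (x, \<epsilon>) (0, v k)"
proof -
  have "dL (K x) \<one> v k = dir_deriv (chart_rep (\<lambda>y. K x \<otimes> y) k k) \<epsilon> (v k)"
    using v x K_carrier K_in k one_k
    by (intro tangent_map_chart strictly_differentiable_left_mult) (auto simp: lie_algebra_def)
  also have "\<dots> = dir_deriv mult_chart (x, \<epsilon>) (0, v k)"
    by (simp add: chart_rep_def dir_deriv_def mult_chart_def)
  finally show ?thesis .
qed

lemma dR_chart:
  assumes x: "x \<in> U" and v: "v \<in> lalg"
  shows "dR (K x) \<one> v k = dir_deriv mult_chart (\<epsilon>, x) (v k, 0)"
proof -
  have "dR (K x) \<one> v k = dir_deriv (chart_rep (\<lambda>y. y \<otimes> K x) k k) \<epsilon> (v k)"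
    using v x K_carrier K_in k one_k
    by (intro tangent_map_chart strictly_differentiable_right_mult) (auto simp: lie_algebra_def)
  also have "\<dots> = dir_deriv mult_chart (\<epsilon>, x) (v k, 0)"
    by (simp add: chart_rep_def dir_deriv_def mult_chart_def)
  finally show ?thesis .
qed

definition mult_deriv2 :: "'e \<times> 'e \<Rightarrow> 'e \<times> 'e \<Rightarrow> 'e"
  where "mult_deriv2 a b = dir_deriv (\<lambda>q. dir_deriv mult_chart q b) (\<epsilon>, \<epsilon>) a"

lemma mult_deriv2_symmetric: "mult_deriv2 a b = mult_deriv2 b a"
  unfolding mult_deriv2_def
  by (rule dir_deriv_symmetric[OF mult_chart_smooth mult_domain_left[OF eps_in]])

text \<open>The function differentiated here gives the coordinates of a left-invariant vector field.\<close>

lemma strict_deriv_dL: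
  "strict_deriv (\<lambda>x. dir_deriv mult_chart (x, \<epsilon>) (0, v)) (\<lambda>u. mult_deriv2 (u, 0) (0, v)) \<epsilon>"
proof -
  have 1: "strict_deriv (\<lambda>x. (x, \<epsilon>)) (\<lambda>x. (x, 0)) \<epsilon>"
    by (rule strict_deriv_Pair[OF strict_deriv_ident strict_deriv_const])
  have "strict_deriv (\<lambda>q. dir_deriv mult_chart q (0, v)) (\<lambda>a. mult_deriv2 a (0, v)) (\<epsilon>, \<epsilon>)"
    using smooth_on_strict_deriv[OF smooth_on_dir_deriv[OF mult_chart_smooth] mult_domain_left[OF eps_in]]
    by (simp add: mult_deriv2_def)
  from strict_deriv_compose[OF 1 this] show ?thesis .
qed

lemma strict_deriv_dR:
  "strict_deriv (\<lambda>x. dir_deriv mult_chart (\<epsilon>, x) (v, 0)) (\<lambda>u. mult_deriv2 (0, u) (v, 0)) \<epsilon>"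
proof -
  have 1: "strict_deriv (\<lambda>x. (\<epsilon>, x)) (\<lambda>x. (0, x)) \<epsilon>"
    by (rule strict_deriv_Pair[OF strict_deriv_const strict_deriv_ident])
  have "strict_deriv (\<lambda>q. dir_deriv mult_chart q (v, 0)) (\<lambda>a. mult_deriv2 a (v, 0)) (\<epsilon>, \<epsilon>)"
    using smooth_on_strict_deriv[OF smooth_on_dir_deriv[OF mult_chart_smooth] mult_domain_left[OF eps_in]]
    by (simp add: mult_deriv2_def)
  from strict_deriv_compose[OF 1 this] show ?thesis .
qed

lemma lie_bracket_chart:
  assumes v: "v \<in> lalg" and w: "w \<in> lalg"
  shows "lie_bracket G A v w k = mult_deriv2 (v k, 0) (0, w k) - mult_deriv2 (w k, 0) (0, v k)"
proof -
  have field: "dir_deriv (\<lambda>x. left_invariant_field G A z (K x) k) \<epsilon> u = mult_deriv2 (u, 0) (0, z k)"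
    if z: "z \<in> lalg" for z u
  proof -
    have "dir_deriv (\<lambda>x. left_invariant_field G A z (K x) k) \<epsilon> u
        = dir_deriv (\<lambda>x. dir_deriv mult_chart (x, \<epsilon>) (0, z k)) \<epsilon> u"
      by (rule dir_deriv_cong[OF chart_image_open[OF k] eps_in])
        (simp add: left_invariant_field_def dL_chart z)
    also have "\<dots> = mult_deriv2 (u, 0) (0, z k)"
      by (rule strict_deriv_dir_deriv[OF strict_deriv_dL])
    finally show ?thesis .
  qed
  have "left_invariant_field G A z \<one> = z" if "z \<in> lalg" for z
    using that dL_one[of \<one> z] by (simp add: left_invariant_field_def lie_algebra_def)
  then show ?thesis
    using k one_k v w by (simp add: lie_bracket_def vf_bracket_def field)
qed

text \<open>Expressing a left-invariant field in another chart \<open>d\<close> and differentiating it produces a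
  second derivative of the transition map, evaluated at the values of both fields. It is symmetric, so it
  cancels in the bracket, which therefore transforms like a tangent vector.\<close>

lemma lie_bracket_in:
  assumes v: "v \<in> lalg" and w: "w \<in> lalg"
  shows "lie_bracket G A v w \<in> lalg"
proof -
  let ?b = "lie_bracket G A v w"
  have "?b d = tvec_of A k \<one> (?b k) d" for d
  proof (cases "d \<in> A \<and> \<one> \<in> fst d")
    case True
    then have d: "d \<in> A" "\<one> \<in> fst d" by auto
    define \<phi> where "\<phi> = chart_rep (\<lambda>x. x) k d"
    define \<psi> where "\<psi> = chart_rep (\<lambda>x. x) d k"
    let ?V = "snd k ` (fst k \<inter> fst d)"
    have \<phi>: "smooth ?V \<phi>"
      using transition_smooth[OF k d(1)] by (simp add: \<phi>_def chart_rep_def o_def)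
    have eV: "\<epsilon> \<in> ?V" using one_k d by auto
    have lin\<phi>: "linear (dir_deriv \<phi> \<epsilon>)" by (rule dir_deriv_linear[OF \<phi> eV])
    have tan: "strict_deriv (\<lambda>p. dir_deriv \<phi> (fst p) (snd p)) (dir_deriv (\<lambda>p. dir_deriv \<phi> (fst p) (snd p)) (\<epsilon>, u)) (\<epsilon>, u)" for u
      using smooth_on_strict_deriv[OF smooth_on_tangent[OF \<phi>]] eV by simp
    have field: "dir_deriv (\<lambda>y. left_invariant_field G A z (chart_inv d y) d) (snd d \<one>) (u d)
        = dir_deriv (\<lambda>x. dir_deriv \<phi> x (z k)) \<epsilon> (u k) + dir_deriv \<phi> \<epsilon> (mult_deriv2 (u k, 0) (0, z k))"
      if z: "z \<in> lalg" and u: "u \<in> lalg" for z u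
    proof -
      let ?N = "\<lambda>x. dir_deriv mult_chart (x, \<epsilon>) (0, z k)"
      let ?B = "\<lambda>u. mult_deriv2 (u, 0) (0, z k)"
      let ?P = "\<lambda>x. dir_deriv \<phi> x (?N x)"
      let ?t = "dir_deriv (\<lambda>p. dir_deriv \<phi> (fst p) (snd p)) (\<epsilon>, z k)"
      have Neps: "?N \<epsilon> = z k"
        using dL_chart[OF eps_in z] dL_one[of \<one> z] z by (simp add: lie_algebra_def)
      have pair: "strict_deriv (\<lambda>x. (x, ?N x)) (\<lambda>u. (u, ?B u)) \<epsilon>"
        by (rule strict_deriv_Pair[OF strict_deriv_ident strict_deriv_dL])
      have P: "strict_deriv ?P (\<lambda>u. ?t (u, ?B u)) \<epsilon>"
        using strict_deriv_compose[OF pair, of "\<lambda>p. dir_deriv \<phi> (fst p) (snd p)" ?t] tan[of "z k"] Neps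
        by simp
      have t1: "?t (a, 0) = dir_deriv (\<lambda>x. dir_deriv \<phi> x (z k)) \<epsilon> a" for a
        by (simp add: dir_deriv_def[of "\<lambda>p. dir_deriv \<phi> (fst p) (snd p)"]
            dir_deriv_def[of "\<lambda>x. dir_deriv \<phi> x (z k)"])
      have t2: "?t (0, b) = dir_deriv \<phi> \<epsilon> b" for b
      proof (rule dir_deriv_eq)
        have "\<forall>\<^sub>F t in at 0. dir_deriv \<phi> \<epsilon> b
            = (dir_deriv \<phi> \<epsilon> (z k + t *\<^sub>R b) - dir_deriv \<phi> \<epsilon> (z k)) /\<^sub>R t"
          by (simp add: eventually_at_filter linear_add[OF lin\<phi>] linear_scale[OF lin\<phi>])
        from Lim_transform_eventually[OF tendsto_const this]
        show "((\<lambda>t. (dir_deriv \<phi> (fst ((\<epsilon>, z k) + t *\<^sub>R (0, b))) (snd ((\<epsilon>, z k) + t *\<^sub>R (0, b)))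
            - dir_deriv \<phi> (fst (\<epsilon>, z k)) (snd (\<epsilon>, z k))) /\<^sub>R t) \<longlongrightarrow> dir_deriv \<phi> \<epsilon> b) (at 0)"
          by simp
      qed
      have t: "?t (a, b) = dir_deriv (\<lambda>x. dir_deriv \<phi> x (z k)) \<epsilon> a + dir_deriv \<phi> \<epsilon> b" for a b
        using linear_add[OF strict_deriv_linear[OF tan[of "z k"]], of "(a, 0)" "(0, b)"]
        by (simp add: t1 t2)
      have \<psi>: "strict_deriv \<psi> (dir_deriv \<psi> (snd d \<one>)) (snd d \<one>)"
        using strictly_differentiable_id k one_k d unfolding strictly_differentiable_map_def \<psi>_def by blast
      have \<psi>1: "\<psi> (snd d \<one>) = \<epsilon>" using d by (simp add: \<psi>_def chart_rep_def)
      let ?W = "{y \<in> snd d ` fst d. chart_inv d y \<in> fst k}"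
      have W: "open ?W" by (rule open_chart_preimage[OF d(1) chart_openin[OF k]])
      have "left_invariant_field G A z (chart_inv d y) d = ?P (\<psi> y)" if y: "y \<in> ?W" for y
      proof -
        let ?g = "chart_inv d y"
        have g: "?g \<in> fst d" "?g \<in> fst k" "?g \<in> carrier G"
          using y chart_inv_in[of y d] chart_carrier[OF k] by blast+
        have \<psi>y: "\<psi> y = snd k ?g" by (simp add: \<psi>_def chart_rep_def)
        have "\<psi> y \<in> U" "K (\<psi> y) = ?g" using g k \<psi>y by auto
        have "dL ?g \<one> z d = dir_deriv \<phi> (snd k ?g) (dL ?g \<one> z k)"
          unfolding \<phi>_def
          by (rule tangent_space_coord[OF dL_lalg[OF g(3) z] k d(1) g(2,1)])
        also have "dL ?g \<one> z k = ?N (\<psi> y)"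
          using dL_chart[OF \<open>\<psi> y \<in> U\<close> z] \<open>K (\<psi> y) = ?g\<close> by simp
        finally show ?thesis by (simp add: left_invariant_field_def \<psi>y)
      qed
      then have "dir_deriv (\<lambda>y. left_invariant_field G A z (chart_inv d y) d) (snd d \<one>) (u d)
          = dir_deriv (\<lambda>y. ?P (\<psi> y)) (snd d \<one>) (u d)"
        using d k one_k by (intro dir_deriv_cong[OF W]) auto
      also have "\<dots> = ?t (dir_deriv \<psi> (snd d \<one>) (u d), ?B (dir_deriv \<psi> (snd d \<one>) (u d)))"
        using strict_deriv_dir_deriv[OF strict_deriv_compose[OF \<psi>, of ?P]] P \<psi>1 by simp
      also have "dir_deriv \<psi> (snd d \<one>) (u d) = u k"
        using tangent_space_coord[of u \<one> d k] u k one_k d by (simp add: \<psi>_def lie_algebra_def)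
      finally show ?thesis by (simp only: t)
    qed
    have one: "left_invariant_field G A z \<one> = z" if "z \<in> lalg" for z
      using that dL_one[of \<one> z] by (simp add: left_invariant_field_def lie_algebra_def)
    have "?b d = dir_deriv \<phi> \<epsilon> (mult_deriv2 (v k, 0) (0, w k)) - dir_deriv \<phi> \<epsilon> (mult_deriv2 (w k, 0) (0, v k))"
      using d by (simp add: lie_bracket_def vf_bracket_def one v w field
          dir_deriv_symmetric[OF \<phi> eV, of "w k" "v k"])
    also have "\<dots> = dir_deriv \<phi> \<epsilon> (?b k)"
      by (simp add: lie_bracket_chart v w linear_diff[OF lin\<phi>])
    also have "\<dots> = tvec_of A k \<one> (?b k) d"
      using tvec_of_chart[OF k one_k d] by (simp add: \<phi>_def)
    finally show ?thesis .
  next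
    case False
    then have "?b d = 0" unfolding lie_bracket_def vf_bracket_def by (rule if_not_P)
    moreover have "tvec_of A k \<one> (?b k) d = 0" unfolding tvec_of_def using False by (rule if_not_P)
    ultimately show ?thesis by simp
  qed
  then have "?b = tvec_of A k \<one> (?b k)" ..
  then show ?thesis using tvec_of_in[OF k one_k] by (metis lie_algebra_def)
qed

end

section \<open>Alternating forms\<close>

lemma alternating_skew:
  assumes B: "alternating_bilinear_on V (+) s B" and a: "a \<in> V" and b: "b \<in> V" and ab: "a + b \<in> V"
  shows "B a b = - B b a"
proof -
  have "B (a + b) (a + b) = (B a a + B a b) + (B b a + B b b)"
    using B a b ab unfolding alternating_bilinear_on_def by metis
  moreover have "B (a + b) (a + b) = 0" "B a a = 0" "B b b = 0"
    using B a b ab unfolding alternating_bilinear_on_def by blast+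
  ultimately show ?thesis by simp
qed

lemma alternating_add:
  assumes "alternating_bilinear_on V p s B" "alternating_bilinear_on V p s B'"
  shows "alternating_bilinear_on V p s (B + B')"
  using assms unfolding alternating_bilinear_on_def by (simp add: algebra_simps)

lemma alternating_scale:
  assumes "alternating_bilinear_on V p s B"
  shows "alternating_bilinear_on V p s (r *\<^sub>R B)"
  using assms unfolding alternating_bilinear_on_def by (simp add: algebra_simps)

lemma alternating_zero: "alternating_bilinear_on V p s 0"
  by (simp add: alternating_bilinear_on_def)

section \<open>Left-invariant 2-forms\<close>

context lie_group_manifold
begin

lemma two_form_alternating:
  assumes "\<eta> \<in> two_forms T A" "p \<in> carrier G"
  shows "alternating_bilinear_on (tangent_space A p) (+) (*\<^sub>R) (\<eta> p)"
  using assms by (simp add: two_forms_def carrier_eq)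

lemma two_form_smooth:
  assumes "\<eta> \<in> two_forms T A" "c \<in> A"
  shows "smooth ((snd c ` fst c) \<times> UNIV \<times> UNIV)
    (\<lambda>(x, u, w). \<eta> (chart_inv c x) (tvec_of A c (chart_inv c x) u) (tvec_of A c (chart_inv c x) w))"
  using assms by (simp add: two_forms_def)

lemma pullback_eq_iff:
  assumes "\<eta> \<in> two_forms T A"
  shows "pullback T A f \<eta> = \<eta> \<longleftrightarrow>
    (\<forall>p\<in>carrier G. \<forall>a\<in>tangent_space A p. \<forall>b\<in>tangent_space A p.
      \<eta> (f p) (tangent_map A A f p a) (tangent_map A A f p b) = \<eta> p a b)"
proof -
  have out: "\<eta> p a b = 0" if "\<not> (p \<in> carrier G \<and> a \<in> tangent_space A p \<and> b \<in> tangent_space A p)" for p a b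
    using that assms unfolding two_forms_def alternating_bilinear_on_def carrier_eq by fastforce
  show ?thesis
  proof
    assume eq: "pullback T A f \<eta> = \<eta>"
    show "\<forall>p\<in>carrier G. \<forall>a\<in>tangent_space A p. \<forall>b\<in>tangent_space A p.
        \<eta> (f p) (tangent_map A A f p a) (tangent_map A A f p b) = \<eta> p a b"
    proof (intro ballI)
      fix p a b assume "p \<in> carrier G" "a \<in> tangent_space A p" "b \<in> tangent_space A p"
      moreover have "pullback T A f \<eta> p a b = \<eta> p a b" by (simp add: eq)
      ultimately show "\<eta> (f p) (tangent_map A A f p a) (tangent_map A A f p b) = \<eta> p a b"
        by (simp add: pullback_def carrier_eq)
    qed
  next
    assume eq: "\<forall>p\<in>carrier G. \<forall>a\<in>tangent_space A p. \<forall>b\<in>tangent_space A p.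
        \<eta> (f p) (tangent_map A A f p a) (tangent_map A A f p b) = \<eta> p a b"
    show "pullback T A f \<eta> = \<eta>"
    proof (intro ext)
      fix p a b
      show "pullback T A f \<eta> p a b = \<eta> p a b"
        using eq out[of p a b] unfolding pullback_def carrier_eq by (cases "p \<in> topspace T \<and> a \<in> tangent_space A p \<and> b \<in> tangent_space A p") auto
    qed
  qed
qed

definition left_invariant_form :: "('g \<Rightarrow> ('g, 'e) tvec \<Rightarrow> ('g, 'e) tvec \<Rightarrow> real) \<Rightarrow> bool"
  where "left_invariant_form \<eta> \<longleftrightarrow> \<eta> \<in> two_forms T A \<and>
    (\<forall>g\<in>carrier G. \<forall>p\<in>carrier G. \<forall>a\<in>tangent_space A p. \<forall>b\<in>tangent_space A p.
      \<eta> (g \<otimes> p) (dL g p a) (dL g p b) = \<eta> p a b)"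

lemma left_invariant_form_two_form: "left_invariant_form \<eta> \<Longrightarrow> \<eta> \<in> two_forms T A"
  by (simp add: left_invariant_form_def)

lemma left_invariant_formD:
  assumes "left_invariant_form \<eta>" "g \<in> carrier G" "p \<in> carrier G"
    "a \<in> tangent_space A p" "b \<in> tangent_space A p"
  shows "\<eta> (g \<otimes> p) (dL g p a) (dL g p b) = \<eta> p a b"
  using assms by (simp add: left_invariant_form_def)

lemma bi_invariant_iff:
  "\<eta> \<in> bi_invariant_two_forms G T A \<longleftrightarrow> left_invariant_form \<eta> \<and>
    (\<forall>g\<in>carrier G. \<forall>p\<in>carrier G. \<forall>a\<in>tangent_space A p. \<forall>b\<in>tangent_space A p.
      \<eta> (p \<otimes> g) (dR g p a) (dR g p b) = \<eta> p a b)"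
  unfolding bi_invariant_two_forms_def left_invariant_form_def
  using pullback_eq_iff by (auto simp: carrier_eq)

text \<open>Constancy of this function in \<open>h\<close>, for all \<open>v\<close> and \<open>w\<close>, is right invariance of a left-invariant
  form.\<close>

definition right_transport ::
  "('g \<Rightarrow> ('g, 'e) tvec \<Rightarrow> ('g, 'e) tvec \<Rightarrow> real) \<Rightarrow> ('g, 'e) tvec \<Rightarrow> ('g, 'e) tvec \<Rightarrow> 'g \<Rightarrow> real"
  where "right_transport \<eta> v w h = \<eta> h (dR h \<one> v) (dR h \<one> w)"

lemma right_transport_one: "v \<in> lalg \<Longrightarrow> w \<in> lalg \<Longrightarrow> right_transport \<eta> v w \<one> = \<eta> \<one> v w"
  using dR_one[of \<one>] by (simp add: right_transport_def lie_algebra_def)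

text \<open>Write \<open>h = g r\<close>. Left and right translations commute, so the differential of \<open>R\<^sub>h\<close> is that of \<open>L\<^sub>g\<close>
  after that of \<open>R\<^sub>r\<close> applied to \<open>Ad(g\<^sup>-\<^sup>1) v\<close>, and left invariance removes \<open>L\<^sub>g\<close>.\<close>

lemma right_transport_translate:
  assumes \<eta>: "left_invariant_form \<eta>" and g: "g \<in> carrier G" and h: "h \<in> carrier G"
    and v: "v \<in> lalg" and w: "w \<in> lalg"
  defines "Ad \<equiv> \<lambda>v. dL (inv g) g (dR g \<one> v)"
  shows "right_transport \<eta> v w h = right_transport \<eta> (Ad v) (Ad w) (inv g \<otimes> h)"
    and "Ad v \<in> lalg"
proof -
  let ?r = "inv g \<otimes> h"
  have r: "?r \<in> carrier G" "g \<otimes> ?r = h" using g h by (simp_all add: m_assoc[symmetric])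
  have Ad_in: "Ad z \<in> lalg" if "z \<in> lalg" for z
    unfolding Ad_def using dL_inverse(1)[OF g dR_lalg[OF g that]] .
  then show "Ad v \<in> lalg" using v .
  have "dL g ?r (dR ?r \<one> (Ad z)) = dR h \<one> z" if z: "z \<in> lalg" for z
  proof -
    have "dL g (\<one> \<otimes> ?r) (dR ?r \<one> (Ad z)) = dR ?r (g \<otimes> \<one>) (dL g \<one> (Ad z))"
      using dL_dR[OF g r(1) one_closed] Ad_in[OF z] by (simp add: lie_algebra_def)
    also have "dL g \<one> (Ad z) = dR g \<one> z"
      unfolding Ad_def using dL_inverse(2)[OF g dR_lalg[OF g z]] .
    also have "dR ?r (g \<otimes> \<one>) (dR g \<one> z) = dR h \<one> z"
      using dR_dR[OF g r(1) one_closed, of z] z g r by (simp add: lie_algebra_def)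
    finally show ?thesis using r by simp
  qed
  then show "right_transport \<eta> v w h = right_transport \<eta> (Ad v) (Ad w) ?r"
    using left_invariant_formD[OF \<eta> g r(1) dR_lalg[OF r(1) Ad_in[OF v]] dR_lalg[OF r(1) Ad_in[OF w]]]
    by (simp add: right_transport_def r v w)
qed

end

context lie_group_with_chart
begin

definition form_chart :: "('g \<Rightarrow> ('g, 'e) tvec \<Rightarrow> ('g, 'e) tvec \<Rightarrow> real) \<Rightarrow> 'e \<times> 'e \<times> 'e \<Rightarrow> real"
  where "form_chart \<eta> = (\<lambda>(x, u, w). \<eta> (K x) (tvec_of A k (K x) u) (tvec_of A k (K x) w))"

lemma form_chart_smooth: "\<eta> \<in> two_forms T A \<Longrightarrow> smooth (U \<times> UNIV \<times> UNIV) (form_chart \<eta>)"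
  unfolding form_chart_def by (rule two_form_smooth[OF _ k])

lemma form_chart_coord:
  assumes "x \<in> U" "a \<in> tangent_space A (K x)" "b \<in> tangent_space A (K x)"
  shows "form_chart \<eta> (x, a k, b k) = \<eta> (K x) a b"
  using assms K_in k by (simp add: form_chart_def tvec_of_coord)

lemma form_chart_bilinear:
  assumes "\<eta> \<in> two_forms T A" "x \<in> U"
  shows "form_chart \<eta> (x, u + u', w) = form_chart \<eta> (x, u, w) + form_chart \<eta> (x, u', w)"
    and "form_chart \<eta> (x, u, w + w') = form_chart \<eta> (x, u, w) + form_chart \<eta> (x, u, w')"
    and "form_chart \<eta> (x, r *\<^sub>R u, w) = r * form_chart \<eta> (x, u, w)"
    and "form_chart \<eta> (x, u, r *\<^sub>R w) = r * form_chart \<eta> (x, u, w)"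
proof -
  have alt: "alternating_bilinear_on (tangent_space A (K x)) (+) (*\<^sub>R) (\<eta> (K x))"
    by (rule two_form_alternating[OF assms(1) K_carrier[OF assms(2)]])
  note lin = tvec_of_linear[OF k K_in[OF assms(2)]] and in' = tvec_of_in[OF k K_in[OF assms(2)]]
  show "form_chart \<eta> (x, u + u', w) = form_chart \<eta> (x, u, w) + form_chart \<eta> (x, u', w)"
    "form_chart \<eta> (x, u, w + w') = form_chart \<eta> (x, u, w) + form_chart \<eta> (x, u, w')"
    "form_chart \<eta> (x, r *\<^sub>R u, w) = r * form_chart \<eta> (x, u, w)"
    "form_chart \<eta> (x, u, r *\<^sub>R w) = r * form_chart \<eta> (x, u, w)"
    using alt in' unfolding alternating_bilinear_on_def
    by (simp_all add: form_chart_def linear_add[OF lin] linear_scale[OF lin])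
qed

lemma form_chart_fibre_deriv:
  assumes \<eta>: "\<eta> \<in> two_forms T A"
  shows "dir_deriv (form_chart \<eta>) (\<epsilon>, u, w) (0, a, b) = form_chart \<eta> (\<epsilon>, a, w) + form_chart \<eta> (\<epsilon>, u, b)"
proof (rule dir_deriv_eq)
  note bil = form_chart_bilinear[OF \<eta> eps_in]
  let ?l = "form_chart \<eta> (\<epsilon>, a, w) + form_chart \<eta> (\<epsilon>, u, b)"
  have "((\<lambda>t. ?l + t *\<^sub>R form_chart \<eta> (\<epsilon>, a, b)) \<longlongrightarrow> ?l) (at 0)"
    by (rule tendsto_add_scaled[OF at_zero_ident]) auto
  moreover have "\<forall>\<^sub>F t in at 0. ?l + t *\<^sub>R form_chart \<eta> (\<epsilon>, a, b) =
      (form_chart \<eta> ((\<epsilon>, u, w) + t *\<^sub>R (0, a, b)) - form_chart \<eta> (\<epsilon>, u, w)) /\<^sub>R t"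
    by (simp add: eventually_at_filter bil) (simp add: field_simps)
  ultimately show "((\<lambda>t. (form_chart \<eta> ((\<epsilon>, u, w) + t *\<^sub>R (0, a, b)) - form_chart \<eta> (\<epsilon>, u, w)) /\<^sub>R t)
      \<longlongrightarrow> ?l) (at 0)"
    by (rule Lim_transform_eventually)
qed

lemma form_chart_chain:
  assumes \<eta>: "\<eta> \<in> two_forms T A" and a: "strict_deriv a a' \<epsilon>" and b: "strict_deriv b b' \<epsilon>"
  shows "strict_deriv (\<lambda>x. form_chart \<eta> (x, a x, b x))
    (\<lambda>u. dir_deriv (form_chart \<eta>) (\<epsilon>, a \<epsilon>, b \<epsilon>) (u, a' u, b' u)) \<epsilon>"
  by (rule strict_deriv_compose[OF strict_deriv_Pair[OF strict_deriv_ident strict_deriv_Pair[OF a b]]])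
    (intro smooth_on_strict_deriv[OF form_chart_smooth[OF \<eta>]], use eps_in in auto)

text \<open>Transporting \<open>v\<close> and \<open>w\<close> by left and by right translations gives two families of vectors at \<open>K x\<close> that
  agree at the identity. The derivatives of \<open>\<eta>\<close> along them differ only in the fibre directions, by mixed
  second derivatives of the multiplication; these are brackets. The derivative along the left
  translations is zero.\<close>

lemma right_transport_strict_deriv:
  assumes \<eta>: "left_invariant_form \<eta>" and v: "v \<in> lalg" and w: "w \<in> lalg"
  shows "strict_deriv (\<lambda>x. right_transport \<eta> v w (K x))
    (\<lambda>u. \<eta> \<one> (lie_bracket G A v (tvec_of A k \<one> u)) w + \<eta> \<one> v (lie_bracket G A w (tvec_of A k \<one> u))) \<epsilon>"
proof -
  have form: "\<eta> \<in> two_forms T A" using \<eta> by (rule left_invariant_form_two_form)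
  let ?E = "dir_deriv (form_chart \<eta>) (\<epsilon>, v k, w k)"
  let ?M = "\<lambda>z x. dir_deriv mult_chart (\<epsilon>, x) (z k, 0)"
  let ?N = "\<lambda>z x. dir_deriv mult_chart (x, \<epsilon>) (0, z k)"
  have linE: "linear ?E"
    by (rule dir_deriv_linear[OF form_chart_smooth[OF form]]) (use eps_in in auto)
  have eps: "?M z \<epsilon> = z k" "?N z \<epsilon> = z k" if "z \<in> lalg" for z
    using dR_chart[OF eps_in that] dL_chart[OF eps_in that] dR_one[of \<one> z] dL_one[of \<one> z] that
    by (simp_all add: lie_algebra_def)
  \<comment> \<open>Along left translations the form is constant, so the derivative vanishes.\<close>
  have "strict_deriv (\<lambda>x. form_chart \<eta> (x, ?N v x, ?N w x))
      (\<lambda>u. ?E (u, mult_deriv2 (u, 0) (0, v k), mult_deriv2 (u, 0) (0, w k))) \<epsilon>"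
    using form_chart_chain[OF form strict_deriv_dL[of "v k"] strict_deriv_dL[of "w k"]] eps v w by simp
  moreover have "form_chart \<eta> (x, ?N v x, ?N w x) = \<eta> \<one> v w" if x: "x \<in> U" for x
    using form_chart_coord[OF x dL_lalg[OF K_carrier[OF x] v] dL_lalg[OF K_carrier[OF x] w]]
      left_invariant_formD[OF \<eta> K_carrier[OF x] one_closed, of v w] v w K_carrier[OF x]
    by (simp add: dL_chart[OF x] lie_algebra_def)
  ultimately have "strict_deriv (\<lambda>x. \<eta> \<one> v w)
      (\<lambda>u. ?E (u, mult_deriv2 (u, 0) (0, v k), mult_deriv2 (u, 0) (0, w k))) \<epsilon>"
    by (rule strict_deriv_cong[OF _ chart_image_open[OF k] eps_in])
  from strict_deriv_dir_deriv[OF this] strict_deriv_dir_deriv[OF strict_deriv_const]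
  have left: "?E (u, mult_deriv2 (u, 0) (0, v k), mult_deriv2 (u, 0) (0, w k)) = 0" for u
    by metis
  have "strict_deriv (\<lambda>x. form_chart \<eta> (x, ?M v x, ?M w x))
      (\<lambda>u. ?E (u, mult_deriv2 (0, u) (v k, 0), mult_deriv2 (0, u) (w k, 0))) \<epsilon>"
    using form_chart_chain[OF form strict_deriv_dR[of "v k"] strict_deriv_dR[of "w k"]] eps v w by simp
  moreover have "?E (u, mult_deriv2 (0, u) (v k, 0), mult_deriv2 (0, u) (w k, 0))
      = \<eta> \<one> (lie_bracket G A v (tvec_of A k \<one> u)) w + \<eta> \<one> v (lie_bracket G A w (tvec_of A k \<one> u))" for u
  proof -
    let ?u = "tvec_of A k \<one> u"
    have u: "?u \<in> lalg" "?u k = u"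
      using tvec_of_in[OF k one_k] tvec_of_self[OF k one_k] by (simp_all add: lie_algebra_def)
    have br: "lie_bracket G A z ?u k = mult_deriv2 (0, u) (z k, 0) - mult_deriv2 (u, 0) (0, z k)"
      if "z \<in> lalg" for z
      using lie_bracket_chart[OF that u(1)] mult_deriv2_symmetric[of "(z k, 0)"] by (simp add: u(2))
    have "?E (u, mult_deriv2 (0, u) (v k, 0), mult_deriv2 (0, u) (w k, 0))
        = ?E (0, lie_bracket G A v ?u k, lie_bracket G A w ?u k)"
      using linear_diff[OF linE, of "(u, mult_deriv2 (0, u) (v k, 0), mult_deriv2 (0, u) (w k, 0))"
          "(u, mult_deriv2 (u, 0) (0, v k), mult_deriv2 (u, 0) (0, w k))"] left[of u]
      by (simp add: br v w)
    also have "\<dots> = form_chart \<eta> (\<epsilon>, lie_bracket G A v ?u k, w k) + form_chart \<eta> (\<epsilon>, v k, lie_bracket G A w ?u k)"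
      by (rule form_chart_fibre_deriv[OF form])
    also have "\<dots> = \<eta> \<one> (lie_bracket G A v ?u) w + \<eta> \<one> v (lie_bracket G A w ?u)"
      using lie_bracket_in[OF v u(1)] lie_bracket_in[OF w u(1)] v w form_chart_coord[OF eps_in, of _ _ \<eta>]
      by (simp add: lie_algebra_def)
    finally show ?thesis .
  qed
  ultimately have "strict_deriv (\<lambda>x. form_chart \<eta> (x, ?M v x, ?M w x))
      (\<lambda>u. \<eta> \<one> (lie_bracket G A v (tvec_of A k \<one> u)) w + \<eta> \<one> v (lie_bracket G A w (tvec_of A k \<one> u))) \<epsilon>"
    by simp
  then show ?thesis
  proof (rule strict_deriv_cong[OF _ chart_image_open[OF k] eps_in])
    fix x assume x: "x \<in> U"
    show "form_chart \<eta> (x, ?M v x, ?M w x) = right_transport \<eta> v w (K x)"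
      using form_chart_coord[OF x dR_lalg[OF K_carrier[OF x] v] dR_lalg[OF K_carrier[OF x] w]]
      by (simp add: dR_chart[OF x] v w right_transport_def)
  qed
qed

lemma bi_invariant_infinitesimal:
  assumes \<eta>: "\<eta> \<in> bi_invariant_two_forms G T A" and v: "v \<in> lalg" and w: "w \<in> lalg" and u: "u \<in> lalg"
  shows "\<eta> \<one> (lie_bracket G A v u) w + \<eta> \<one> v (lie_bracket G A w u) = 0"
proof -
  have left: "left_invariant_form \<eta>" using \<eta> by (simp add: bi_invariant_iff)
  have const: "right_transport \<eta> v w (K x) = \<eta> \<one> v w" if x: "x \<in> U" for x
  proof -
    have "\<eta> (\<one> \<otimes> K x) (dR (K x) \<one> v) (dR (K x) \<one> w) = \<eta> \<one> v w"
      using \<eta> K_carrier[OF x] v w one_closed unfolding bi_invariant_iff lie_algebra_def by blast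
    then show ?thesis using K_carrier[OF x] by (simp add: right_transport_def)
  qed
  from strict_deriv_cong[OF right_transport_strict_deriv[OF left v w] chart_image_open[OF k] eps_in const]
  have "strict_deriv (\<lambda>_. \<eta> \<one> v w) (\<lambda>u. \<eta> \<one> (lie_bracket G A v (tvec_of A k \<one> u)) w
      + \<eta> \<one> v (lie_bracket G A w (tvec_of A k \<one> u))) \<epsilon>" .
  from strict_deriv_dir_deriv[OF this, of "u k"] strict_deriv_dir_deriv[OF strict_deriv_const, of "\<eta> \<one> v w" \<epsilon> "u k"]
  show ?thesis
    using tvec_of_coord[OF k one_k, of u] u by (simp add: lie_algebra_def)
qed

text \<open>A point other than the identity is moved to it by \<open>right_transport_translate\<close>.\<close>

lemma right_transport_deriv_zero:
  assumes \<eta>: "left_invariant_form \<eta>"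
    and kills: "\<And>x y z. x \<in> lalg \<Longrightarrow> y \<in> lalg \<Longrightarrow> z \<in> lalg \<Longrightarrow> \<eta> \<one> (lie_bracket G A x y) z = 0"
      "\<And>x y z. x \<in> lalg \<Longrightarrow> y \<in> lalg \<Longrightarrow> z \<in> lalg \<Longrightarrow> \<eta> \<one> z (lie_bracket G A x y) = 0"
    and v: "v \<in> lalg" and w: "w \<in> lalg" and c: "c \<in> A" and x: "x \<in> snd c ` fst c"
  shows "strict_deriv (\<lambda>x. right_transport \<eta> v w (chart_inv c x)) (\<lambda>_. 0) x"
proof -
  let ?g = "chart_inv c x"
  have gc: "?g \<in> fst c" and g: "?g \<in> carrier G" and gx: "snd c ?g = x"
    using chart_inv_in[OF x] chart_inv_carrier[OF c x] chart_inv_right[OF x] by auto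
  define v' where "v' = dL (inv ?g) ?g (dR ?g \<one> v)"
  define w' where "w' = dL (inv ?g) ?g (dR ?g \<one> w)"
  have v': "v' \<in> lalg" and w': "w' \<in> lalg"
    unfolding v'_def w'_def using right_transport_translate(2)[OF \<eta> g g] v w by auto
  have u: "tvec_of A k \<one> u \<in> lalg" for u
    using tvec_of_in[OF k one_k] by (simp add: lie_algebra_def)
  have 1: "strict_deriv (\<lambda>x. right_transport \<eta> v' w' (K x)) (\<lambda>_. 0) \<epsilon>"
    using right_transport_strict_deriv[OF \<eta> v' w'] kills v' w' u by simp
  let ?f = "\<lambda>h. inv ?g \<otimes> h"
  have sdm: "strictly_differentiable_map T A ?f" using g by (intro strictly_differentiable_left_mult) simp
  then have 2: "strict_deriv (chart_rep ?f c k) (dir_deriv (chart_rep ?f c k) x) x"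
    using c k gc one_k g gx unfolding strictly_differentiable_map_def by (metis l_inv)
  have "chart_rep ?f c k x = \<epsilon>" using g by (simp add: chart_rep_def)
  then have "strict_deriv (\<lambda>y. right_transport \<eta> v' w' (K (chart_rep ?f c k y))) (\<lambda>_. 0) x"
    using strict_deriv_compose[OF 2, of "\<lambda>x. right_transport \<eta> v' w' (K x)" "\<lambda>_. 0"] 1 by simp
  then show ?thesis
  proof (rule strict_deriv_cong)
    show "open {y \<in> snd c ` fst c. ?f (chart_inv c y) \<in> fst k}"
      using sdm by (intro chart_rep_domain_open c k) (simp add: strictly_differentiable_map_def)
    show "x \<in> {y \<in> snd c ` fst c. ?f (chart_inv c y) \<in> fst k}"
      using x g one_k by simp
    fix y assume y: "y \<in> {y \<in> snd c ` fst c. ?f (chart_inv c y) \<in> fst k}"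
    then have h: "chart_inv c y \<in> carrier G" using chart_inv_carrier[OF c] by blast
    show "right_transport \<eta> v' w' (K (chart_rep ?f c k y)) = right_transport \<eta> v w (chart_inv c y)"
      using right_transport_translate(1)[OF \<eta> g h v w] y k
      by (simp add: chart_rep_def v'_def w'_def)
  qed
qed

text \<open>A zero derivative makes the function constant on convex subsets of charts, hence locally constant,
  and connectedness does the rest.\<close>

lemma right_transport_constant:
  assumes conn: "connected_space T" and \<eta>: "left_invariant_form \<eta>"
    and kills: "\<And>x y z. x \<in> lalg \<Longrightarrow> y \<in> lalg \<Longrightarrow> z \<in> lalg \<Longrightarrow> \<eta> \<one> (lie_bracket G A x y) z = 0"
      "\<And>x y z. x \<in> lalg \<Longrightarrow> y \<in> lalg \<Longrightarrow> z \<in> lalg \<Longrightarrow> \<eta> \<one> z (lie_bracket G A x y) = 0"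
    and v: "v \<in> lalg" and w: "w \<in> lalg" and h: "h \<in> carrier G"
  shows "right_transport \<eta> v w h = \<eta> \<one> v w"
proof -
  let ?f = "right_transport \<eta> v w"
  have loc: "\<exists>V. openin T V \<and> p \<in> V \<and> (\<forall>q\<in>V. ?f q = ?f p)" if p: "p \<in> topspace T" for p
  proof -
    obtain c where c: "c \<in> A" "p \<in> fst c" using chart_at[OF p] .
    obtain C where C: "convex C" "open C" "snd c p \<in> C" "C \<subseteq> snd c ` fst c"
      using convex_nhd[OF chart_image_open[OF c(1)], of "snd c p"] c(2) by blast
    let ?V = "{q \<in> topspace (subtopology T (fst c)). snd c q \<in> C}"
    have "openin (subtopology T (fst c)) ?V"
      by (rule openin_continuous_map_preimage[OF chart_continuous[OF c(1)]]) (use C in simp)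
    then have V: "openin T ?V" using openin_trans_full chart_openin[OF c(1)] by blast
    have "?f q = ?f p" if q: "q \<in> ?V" for q
    proof -
      have "?f (chart_inv c (snd c q)) = ?f (chart_inv c (snd c p))"
      proof (rule strict_deriv_zero_imp_constant[OF C(1), of "\<lambda>x. ?f (chart_inv c x)"])
        fix x assume "x \<in> C"
        then have x: "x \<in> snd c ` fst c" using C(4) by blast
        show "strict_deriv (\<lambda>x. ?f (chart_inv c x)) (\<lambda>_. 0) x"
          by (rule right_transport_deriv_zero[OF \<eta> _ _ v w c(1) x]) (fact kills)+
      qed (use C(3) q in simp_all)
      then show ?thesis using c q by simp
    qed
    moreover have "p \<in> ?V" using c p C by simp
    ultimately show ?thesis using V by blast
  qed
  have one: "\<one> \<in> topspace T" using carrier_eq by auto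
  let ?S = "{p \<in> topspace T. ?f p = ?f \<one>}"
  have "openin T ?S"
    unfolding openin_subopen[of T ?S]
  proof
    fix p assume p: "p \<in> ?S"
    obtain V where V: "openin T V" "p \<in> V" "\<forall>q\<in>V. ?f q = ?f p" using loc p by blast
    have "q \<in> ?S" if "q \<in> V" for q
      using trans[OF bspec[OF V(3) that], of "?f \<one>"] p that openin_subset[OF V(1)] by blast
    then show "\<exists>V. openin T V \<and> p \<in> V \<and> V \<subseteq> ?S" using V(1,2) by blast
  qed
  moreover have "openin T (topspace T - ?S)"
    unfolding openin_subopen[of T "topspace T - ?S"]
  proof
    fix p assume p: "p \<in> topspace T - ?S"
    obtain V where V: "openin T V" "p \<in> V" "\<forall>q\<in>V. ?f q = ?f p" using loc p by blast
    have "q \<in> topspace T - ?S" if "q \<in> V" for q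
      using trans[OF bspec[OF V(3) that, symmetric], of "?f \<one>"] p that openin_subset[OF V(1)] by blast
    then show "\<exists>V. openin T V \<and> p \<in> V \<and> V \<subseteq> topspace T - ?S" using V(1,2) by blast
  qed
  then have "closedin T ?S" by (simp add: closedin_def)
  ultimately have "?S = {} \<or> ?S = topspace T"
    using conn unfolding connected_space_clopen_in by blast
  then have "?S = topspace T" using one by blast
  then have "?f h = ?f \<one>" using h carrier_eq by blast
  then show ?thesis by (simp add: right_transport_one v w)
qed

text \<open>Left translation reduces right invariance at a point \<open>p\<close> to constancy of \<open>right_transport\<close>.\<close>

lemma left_invariant_imp_bi_invariant:
  assumes conn: "connected_space T" and \<eta>: "left_invariant_form \<eta>"
    and kills: "\<And>x y z. x \<in> lalg \<Longrightarrow> y \<in> lalg \<Longrightarrow> z \<in> lalg \<Longrightarrow> \<eta> \<one> (lie_bracket G A x y) z = 0"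
      "\<And>x y z. x \<in> lalg \<Longrightarrow> y \<in> lalg \<Longrightarrow> z \<in> lalg \<Longrightarrow> \<eta> \<one> z (lie_bracket G A x y) = 0"
  shows "\<eta> \<in> bi_invariant_two_forms G T A"
  unfolding bi_invariant_iff
proof (intro conjI ballI \<eta>)
  fix g p a b
  assume g: "g \<in> carrier G" and p: "p \<in> carrier G" and a: "a \<in> tangent_space A p" and b: "b \<in> tangent_space A p"
  let ?a = "dL (inv p) p a" and ?b = "dL (inv p) p b"
  note la = dL_inverse[OF p a] and lb = dL_inverse[OF p b]
  have R: "dR g p (dL p \<one> z) = dL p g (dR g \<one> z)" if "z \<in> lalg" for z
    using dL_dR[OF p g one_closed, of z] that p g by (simp add: lie_algebra_def)
  have "\<eta> (p \<otimes> g) (dR g p a) (dR g p b) = \<eta> (p \<otimes> g) (dL p g (dR g \<one> ?a)) (dL p g (dR g \<one> ?b))"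
    using R[OF la(1)] R[OF lb(1)] la(2) lb(2) by simp
  also have "\<dots> = right_transport \<eta> ?a ?b g"
    using left_invariant_formD[OF \<eta> p g dR_lalg[OF g la(1)] dR_lalg[OF g lb(1)]]
    by (simp add: right_transport_def)
  also have "\<dots> = \<eta> \<one> ?a ?b"
    by (rule right_transport_constant[OF conn \<eta> kills la(1) lb(1) g])
  also have "\<dots> = \<eta> p a b"
    using left_invariant_formD[OF \<eta> p one_closed, of ?a ?b] la lb p by (simp add: lie_algebra_def)
  finally show "\<eta> (p \<otimes> g) (dR g p a) (dR g p b) = \<eta> p a b" .
qed

text \<open>The form \<open>f a b c = \<omega>([a,b], c)\<close> changes sign under exchange of \<open>a, b\<close> and is invariant under exchange
  of \<open>a, c\<close>. The product of the two exchanges is a cyclic permutation of order three under which \<open>f\<close> changes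
  sign; its third power is the identity, so \<open>f = - f\<close>.\<close>

lemma bi_invariant_kills_brackets:
  assumes \<eta>: "\<eta> \<in> bi_invariant_two_forms G T A" and x: "x \<in> lalg" and y: "y \<in> lalg" and z: "z \<in> lalg"
  shows "\<eta> \<one> (lie_bracket G A x y) z = 0"
proof -
  have "\<eta> \<in> two_forms T A" using \<eta> by (simp add: bi_invariant_two_forms_def)
  from two_form_alternating[OF this one_closed]
  have alt: "alternating_bilinear_on lalg (+) (*\<^sub>R) (\<eta> \<one>)" by (simp add: lie_algebra_def)
  have skew: "\<eta> \<one> a b = - \<eta> \<one> b a" if "a \<in> lalg" "b \<in> lalg" for a b
  proof -
    have "a + b \<in> lalg" using that tangent_space_subspace[of \<one>] by (simp add: lie_algebra_def subspace_add)
    then show ?thesis using alternating_skew[OF alt] that by blast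
  qed
  define f where "f a b c = \<eta> \<one> (lie_bracket G A a b) c" for a b c
  have f1: "f a b c = - f b a c" if "a \<in> lalg" "b \<in> lalg" "c \<in> lalg" for a b c
  proof -
    have "\<eta> \<one> ((-1) *\<^sub>R lie_bracket G A b a) c = (-1) * \<eta> \<one> (lie_bracket G A b a) c"
      using alt lie_bracket_in[OF that(2,1)] that(3) unfolding alternating_bilinear_on_def by blast
    then show ?thesis unfolding f_def lie_bracket_antisym[of a b] by simp
  qed
  have f2: "f a b c = f c b a" if "a \<in> lalg" "b \<in> lalg" "c \<in> lalg" for a b c
    using bi_invariant_infinitesimal[OF \<eta> that(1,3,2)] skew[OF that(1) lie_bracket_in[OF that(3,2)]]
    by (simp add: f_def)
  \<comment> \<open>Apply the two exchanges alternately, three times each.\<close>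
  have "f x y z = - f x y z"
    using f1[OF x y z] f2[OF y x z] f1[OF z x y] f2[OF x z y] f1[OF y z x] f2[OF z y x] by simp
  then show ?thesis by (simp add: f_def)
qed

end

section \<open>Left-invariant extension\<close>

context lie_group_with_chart
begin

text \<open>In coordinates, the differential of left translation by \<open>g\<^sup>-\<^sup>1\<close> at \<open>g\<close> depends smoothly on \<open>g\<close> as well: it is
  the tangent map of \<open>(g, h) \<mapsto> g\<^sup>-\<^sup>1 h\<close>, restricted to the diagonal and to vectors \<open>(0, u)\<close>.\<close>

lemma left_translation_chart_smooth:
  assumes c: "c \<in> A"
  shows "smooth ((snd c ` fst c) \<times> UNIV)
    (\<lambda>p. dir_deriv (chart_rep (\<lambda>h. inv (chart_inv c (fst p)) \<otimes> h) c k) (fst p) (snd p))"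
proof (rule smooth_on_locally)
  let ?C = "snd c ` fst c"
  let ?F = "\<lambda>p. dir_deriv (chart_rep (\<lambda>h. inv (chart_inv c (fst p)) \<otimes> h) c k) (fst p) (snd p)"
  show "open (?C \<times> (UNIV :: 'e set))" using chart_image_open[OF c] by (intro open_Times) auto
  fix p0 :: "'e \<times> 'e" assume p0: "p0 \<in> ?C \<times> UNIV"
  define x0 where "x0 = fst p0"
  have x0: "x0 \<in> ?C" using p0 by (auto simp: x0_def)
  have g0: "inv (chart_inv c x0) \<in> topspace T"
    using chart_inv_carrier[OF c x0] by (simp add: carrier_eq[symmetric])
  obtain d where d: "d \<in> A" "inv (chart_inv c x0) \<in> fst d" using chart_at[OF g0] .
  let ?I = "{x \<in> ?C. inv (chart_inv c x) \<in> fst d}"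
  let ?i = "\<lambda>x. snd d (inv (chart_inv c x))"
  let ?j = "\<lambda>q :: 'e \<times> 'e. (?i (fst q), snd q)"
  let ?O = "{q \<in> (snd d ` fst d) \<times> ?C. chart_inv d (fst q) \<otimes> chart_inv c (snd q) \<in> fst k}"
  let ?m = "\<lambda>q. snd k (chart_inv d (fst q) \<otimes> chart_inv c (snd q))"
  let ?M = "\<lambda>q :: 'e \<times> 'e. snd k (inv (chart_inv c (fst q)) \<otimes> chart_inv c (snd q))"
  have i: "smooth ?I ?i" by (rule inv_smooth[OF c d(1)])
  have m: "smooth ?O ?m" by (rule mult_smooth[OF d(1) c k])
  have oI: "open (?I \<times> ?C)"
    using smooth_on_open[OF i] chart_image_open[OF c] by (rule open_Times)
  have i': "smooth (?I \<times> ?C) (\<lambda>q :: 'e \<times> 'e. ?i (fst q))"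
    by (rule smooth_on_compose[OF smooth_on_linear[OF _ _ oI] i])
      (auto intro!: linearI continuous_intros)
  have "smooth (?I \<times> ?C) (\<lambda>q :: 'e \<times> 'e. snd q)"
    by (rule smooth_on_linear[OF _ _ oI]) (auto intro!: linearI continuous_intros)
  from smooth_on_Pair[OF i' this]
  have j: "smooth (?I \<times> ?C) ?j" .
  let ?D = "(?I \<times> ?C) \<inter> ?j -` ?O"
  have oD: "open ?D"
    by (rule continuous_open_preimage[OF smooth_on_continuous_on[OF j] oI smooth_on_open[OF m]])
  have "smooth ?D (\<lambda>q. ?m (?j q))"
    by (rule smooth_on_compose[OF smooth_on_subset[OF j oD] m]) auto
  then have M: "smooth ?D ?M"
  proof (rule smooth_on_cong)
    fix q assume "q \<in> ?D"
    then have "inv (chart_inv c (fst q)) \<in> fst d" by (simp add: mem_Times_iff)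
    then show "?m (?j q) = ?M q" using d(1) by simp
  qed
  have l: "smooth (?I \<times> UNIV) (\<lambda>p :: 'e \<times> 'e. ((fst p, fst p), (0 :: 'e, snd p)))"
    by (rule smooth_on_linear)
      (auto intro!: linearI continuous_intros open_Times smooth_on_open[OF i])
  have "smooth (?I \<times> UNIV)
      (\<lambda>p :: 'e \<times> 'e. dir_deriv ?M (fst ((fst p, fst p), (0 :: 'e, snd p))) (snd ((fst p, fst p), (0 :: 'e, snd p))))"
  proof (rule smooth_on_compose[OF l smooth_on_tangent[OF M]])
    show "(\<lambda>p :: 'e \<times> 'e. ((fst p, fst p), (0 :: 'e, snd p))) ` (?I \<times> UNIV) \<subseteq> ?D \<times> UNIV"
    proof
      fix z assume "z \<in> (\<lambda>p :: 'e \<times> 'e. ((fst p, fst p), (0 :: 'e, snd p))) ` (?I \<times> UNIV)"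
      then obtain x u where z: "z = ((x, x), (0, u))" and x: "x \<in> ?C" "inv (chart_inv c x) \<in> fst d"
        by auto
      have "chart_inv d (?i x) \<otimes> chart_inv c x \<in> fst k"
        using x d chart_inv_carrier[OF c x(1)] one_k by simp
      then show "z \<in> ?D \<times> UNIV" using x z by simp
    qed
  qed
  then have "smooth (?I \<times> UNIV) ?F"
    by (rule smooth_on_cong) (simp add: dir_deriv_def chart_rep_def)
  moreover have "p0 \<in> ?I \<times> UNIV"
    using x0 d by (simp add: x0_def mem_Times_iff)
  ultimately show "\<exists>V. p0 \<in> V \<and> smooth V ?F"
    by (intro exI[of _ "?I \<times> UNIV"] conjI)
qed

definition left_extension ::
  "(('g, 'e) tvec \<Rightarrow> ('g, 'e) tvec \<Rightarrow> real) \<Rightarrow> 'g \<Rightarrow> ('g, 'e) tvec \<Rightarrow> ('g, 'e) tvec \<Rightarrow> real"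
  where "left_extension \<omega> p a b =
    (if p \<in> carrier G \<and> a \<in> tangent_space A p \<and> b \<in> tangent_space A p
     then \<omega> (dL (inv p) p a) (dL (inv p) p b) else 0)"

lemma dL_add:
  assumes "g \<in> carrier G" "p \<in> carrier G" "v \<in> tangent_space A p" "w \<in> tangent_space A p"
  shows "dL g p (v + w) = dL g p v + dL g p w" "dL g p (r *\<^sub>R v) = r *\<^sub>R dL g p v"
  using tangent_map_linear[OF strictly_differentiable_left_mult[OF assms(1)] _ assms(3,4)] assms(2) carrier_eq by auto

lemma left_extension_one:
  assumes "v \<in> lalg" "w \<in> lalg"
  shows "left_extension \<omega> \<one> v w = \<omega> v w"
  using assms dL_one[of \<one>] by (simp add: left_extension_def lie_algebra_def)

lemma left_extension_left_invariant:
  assumes alt: "alternating_bilinear_on lalg (+) (*\<^sub>R) \<omega>"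
    and cont: "continuous_on UNIV (\<lambda>p. \<omega> (tvec_of A k \<one> (fst p)) (tvec_of A k \<one> (snd p)))"
  shows "left_invariant_form (left_extension \<omega>)"
proof -
  let ?\<eta> = "left_extension \<omega>"
  have "alternating_bilinear_on (tangent_space A p) (+) (*\<^sub>R) (?\<eta> p)" if p: "p \<in> carrier G" for p
  proof -
    note sub = tangent_space_subspace[of p] and p' = inv_closed[OF p]
    note in' = dL_inverse(1)[OF p]
    show ?thesis
      unfolding alternating_bilinear_on_def
    proof (intro conjI allI ballI impI)
      fix x y z assume *: "x \<in> tangent_space A p" "y \<in> tangent_space A p" "z \<in> tangent_space A p"
      show "?\<eta> p (x + y) z = ?\<eta> p x z + ?\<eta> p y z" "?\<eta> p z (x + y) = ?\<eta> p z x + ?\<eta> p z y"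
        using * alt in'[OF *(1)] in'[OF *(2)] in'[OF *(3)] unfolding alternating_bilinear_on_def
        by (simp_all add: left_extension_def p subspace_add[OF sub] dL_add(1)[OF p' p])
    next
      fix r x y assume *: "x \<in> tangent_space A p" "y \<in> tangent_space A p"
      show "?\<eta> p (r *\<^sub>R x) y = r * ?\<eta> p x y" "?\<eta> p x (r *\<^sub>R y) = r * ?\<eta> p x y"
        using * alt in'[OF *(1)] in'[OF *(2)] unfolding alternating_bilinear_on_def
        by (simp_all add: left_extension_def p subspace_scale[OF sub] dL_add(2)[OF p' p])
    next
      fix x assume "x \<in> tangent_space A p"
      then show "?\<eta> p x x = 0"
        using alt in' unfolding alternating_bilinear_on_def by (simp add: left_extension_def)
    next
      fix x y assume "\<not> (x \<in> tangent_space A p \<and> y \<in> tangent_space A p)"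
      then show "?\<eta> p x y = 0" by (auto simp: left_extension_def)
    qed
  qed
  moreover have "?\<eta> p = 0" if "p \<notin> topspace T" for p
    using that by (intro ext) (simp add: left_extension_def carrier_eq)
  moreover have "smooth ((snd c ` fst c) \<times> UNIV \<times> UNIV)
      (\<lambda>(x, u, w). ?\<eta> (chart_inv c x) (tvec_of A c (chart_inv c x) u) (tvec_of A c (chart_inv c x) w))"
    if c: "c \<in> A" for c
  proof -
    let ?C = "snd c ` fst c"
    let ?F = "\<lambda>p. dir_deriv (chart_rep (\<lambda>h. inv (chart_inv c (fst p)) \<otimes> h) c k) (fst p) (snd p)"
    let ?b = "\<lambda>u w. \<omega> (tvec_of A k \<one> u) (tvec_of A k \<one> w)"
    note lin = tvec_of_linear[OF k one_k]
    have in1: "tvec_of A k \<one> u \<in> lalg" for u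
      using tvec_of_in[OF k one_k] by (simp add: lie_algebra_def)
    have b: "smooth UNIV (\<lambda>p. ?b (fst p) (snd p))"
    proof (rule smooth_on_bilinear[OF _ _ cont])
      show "linear (\<lambda>x. ?b x y)" "linear (\<lambda>y. ?b x y)" for x y
        using alt in1 unfolding alternating_bilinear_on_def
        by (auto intro!: linearI simp: linear_add[OF lin] linear_scale[OF lin])
    qed
    have oC: "open (?C \<times> (UNIV :: ('e \<times> 'e) set))"
      using chart_image_open[OF c] by (intro open_Times) auto
    have F1: "smooth (?C \<times> UNIV \<times> UNIV) (\<lambda>z :: 'e \<times> 'e \<times> 'e. ?F (fst z, fst (snd z)))"
      by (rule smooth_on_compose[OF smooth_on_linear left_translation_chart_smooth[OF c]])
        (use oC in \<open>auto intro!: linearI continuous_intros\<close>)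
    have F2: "smooth (?C \<times> UNIV \<times> UNIV) (\<lambda>z :: 'e \<times> 'e \<times> 'e. ?F (fst z, snd (snd z)))"
      by (rule smooth_on_compose[OF smooth_on_linear left_translation_chart_smooth[OF c]])
        (use oC in \<open>auto intro!: linearI continuous_intros\<close>)
    have eq: "tvec_of A k \<one> (?F (x, u)) = dL (inv (chart_inv c x)) (chart_inv c x) (tvec_of A c (chart_inv c x) u)"
      if x: "x \<in> ?C" for x u
    proof -
      let ?g = "chart_inv c x"
      note g = chart_inv_in[OF x] chart_inv_carrier[OF c x]
      let ?v = "tvec_of A c ?g u"
      have v: "?v \<in> tangent_space A ?g" "?v c = u"
        using tvec_of_in[OF c g(1)] tvec_of_self[OF c g(1)] by auto
      have "dL (inv ?g) ?g ?v k = ?F (x, u)"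
        using tangent_map_chart[OF strictly_differentiable_left_mult[OF inv_closed[OF g(2)]] v(1) c g(1) k] one_k g(2)
        by (simp add: v(2) chart_inv_right[OF x])
      then show ?thesis
        using tvec_of_coord[OF k one_k, of "dL (inv ?g) ?g ?v"] dL_inverse(1)[OF g(2) v(1)]
        by (simp add: lie_algebra_def)
    qed
    have "smooth (?C \<times> UNIV \<times> UNIV) (\<lambda>z :: 'e \<times> 'e \<times> 'e.
        ?b (fst (?F (fst z, fst (snd z)), ?F (fst z, snd (snd z)))) (snd (?F (fst z, fst (snd z)), ?F (fst z, snd (snd z)))))"
      by (rule smooth_on_compose[OF smooth_on_Pair[OF F1 F2] b]) simp
    then show ?thesis
    proof (rule smooth_on_cong)
      fix z :: "'e \<times> 'e \<times> 'e" assume z: "z \<in> ?C \<times> UNIV \<times> UNIV"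
      obtain x u w where zx: "z = (x, u, w)" by (cases z)
      with z have x: "x \<in> ?C" by simp
      show "?b (fst (?F (fst z, fst (snd z)), ?F (fst z, snd (snd z)))) (snd (?F (fst z, fst (snd z)), ?F (fst z, snd (snd z))))
          = (case z of (x, u, w) \<Rightarrow> ?\<eta> (chart_inv c x) (tvec_of A c (chart_inv c x) u) (tvec_of A c (chart_inv c x) w))"
        using eq[OF x] tvec_of_in[OF c chart_inv_in[OF x]] chart_inv_carrier[OF c x]
        by (simp add: zx left_extension_def)
    qed
  qed
  ultimately have "?\<eta> \<in> two_forms T A"
    by (simp add: two_forms_def carrier_eq)
  moreover have "?\<eta> (g \<otimes> p) (dL g p a) (dL g p b) = ?\<eta> p a b"
    if g: "g \<in> carrier G" and p: "p \<in> carrier G" and a: "a \<in> tangent_space A p" and b: "b \<in> tangent_space A p"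
    for g p a b
  proof -
    have "dL (inv (g \<otimes> p)) (g \<otimes> p) (dL g p v) = dL (inv p) p v" if "v \<in> tangent_space A p" for v
      using dL_dL[of "inv (g \<otimes> p)" g p v] g p that by (simp add: inv_mult_group m_assoc)
    then show ?thesis
      using g p a b dL_in[OF g p] by (simp add: left_extension_def)
  qed
  ultimately show ?thesis by (simp add: left_invariant_form_def)
qed

end

section \<open>The abelianisation\<close>

text \<open>In general a product of quotient maps is not a quotient map; openness of \<open>q\<close> repairs this.\<close>

lemma continuous_map_quotient_prod:
  assumes op: "\<And>V. openin X V \<Longrightarrow> openin (quotient_topology X q) (q ` V)"
    and b: "continuous_map (prod_topology X X) Z (\<lambda>(v, w). b v w)"
    and B: "\<And>v w. v \<in> topspace X \<Longrightarrow> w \<in> topspace X \<Longrightarrow> B (q v) (q w) = b v w"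
  shows "continuous_map (prod_topology (quotient_topology X q) (quotient_topology X q)) Z (\<lambda>(x, y). B x y)"
  unfolding continuous_map_def
proof (intro conjI allI impI funcsetI)
  let ?Q = "quotient_topology X q"
  fix z assume "z \<in> topspace (prod_topology ?Q ?Q)"
  then obtain v w where vw: "v \<in> topspace X" "w \<in> topspace X" "z = (q v, q w)" by auto
  then show "(case z of (x, y) \<Rightarrow> B x y) \<in> topspace Z"
    using continuous_map_image_subset_topspace[OF b] B by fastforce
next
  let ?Q = "quotient_topology X q"
  fix S assume S: "openin Z S"
  let ?P = "{p \<in> topspace (prod_topology X X). (case p of (v, w) \<Rightarrow> b v w) \<in> S}"
  have P: "openin (prod_topology X X) ?P"
    using b S by (rule openin_continuous_map_preimage)
  have pre: "\<exists>V W. openin X V \<and> openin X W \<and> v \<in> V \<and> w \<in> W \<and> (\<forall>v'\<in>V. \<forall>w'\<in>W. b v' w' \<in> S)"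
    if "v \<in> topspace X" "w \<in> topspace X" "b v w \<in> S" for v w
  proof -
    have "(v, w) \<in> ?P" using that by simp
    then obtain V W where VW: "openin X V" "openin X W" "v \<in> V" "w \<in> W" "V \<times> W \<subseteq> ?P"
      using P unfolding openin_prod_topology_alt by meson
    have "b v' w' \<in> S" if "v' \<in> V" "w' \<in> W" for v' w'
      using subsetD[OF VW(5), of "(v', w')"] that by simp
    then show ?thesis using VW(1-4) by blast
  qed
  show "openin (prod_topology ?Q ?Q) {z \<in> topspace (prod_topology ?Q ?Q). (case z of (x, y) \<Rightarrow> B x y) \<in> S}"
    unfolding openin_prod_topology_alt
  proof (intro allI impI)
    fix x y assume "(x, y) \<in> {z \<in> topspace (prod_topology ?Q ?Q). (case z of (x, y) \<Rightarrow> B x y) \<in> S}"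
    then obtain v w where vw: "v \<in> topspace X" "w \<in> topspace X" "x = q v" "y = q w" "b v w \<in> S"
      using B by auto
    from pre[OF vw(1,2,5)] obtain V W where V: "openin X V" "v \<in> V" and W: "openin X W" "w \<in> W"
      and VW: "\<And>v' w'. v' \<in> V \<Longrightarrow> w' \<in> W \<Longrightarrow> b v' w' \<in> S" by blast
    have sub: "V \<subseteq> topspace X" "W \<subseteq> topspace X" using V W openin_subset by auto
    have "q ` V \<times> q ` W \<subseteq> {z \<in> topspace (prod_topology ?Q ?Q). (case z of (x, y) \<Rightarrow> B x y) \<in> S}"
      using sub VW B by (auto simp: subset_iff)
    then show "\<exists>U V. openin ?Q U \<and> openin ?Q V \<and> x \<in> U \<and> y \<in> V \<and>
        U \<times> V \<subseteq> {z \<in> topspace (prod_topology ?Q ?Q). (case z of (x, y) \<Rightarrow> B x y) \<in> S}"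
      using op[OF V(1)] op[OF W(1)] V(2) W(2) vw(3,4) by (intro exI[of _ "q ` V"] exI[of _ "q ` W"]) auto
  qed
qed

lemma vcoset_eq_iff:
  assumes "subspace N"
  shows "vcoset N x = vcoset N y \<longleftrightarrow> x - y \<in> N"
proof
  assume "vcoset N x = vcoset N y"
  moreover have "x \<in> vcoset N x" using subspace_0[OF assms] by (auto simp: vcoset_def)
  ultimately show "x - y \<in> N" by (auto simp: vcoset_def)
next
  have sub: "vcoset N x \<subseteq> vcoset N y" if "x - y \<in> N" for x y
  proof
    fix z assume "z \<in> vcoset N x"
    then obtain n where "n \<in> N" "z = x + n" by (auto simp: vcoset_def)
    then have "z = y + ((x - y) + n)" "(x - y) + n \<in> N"
      using that subspace_add[OF assms] by auto
    then show "z \<in> vcoset N y" unfolding vcoset_def by blast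
  qed
  assume "x - y \<in> N"
  moreover have "y - x \<in> N" using subspace_neg[OF assms \<open>x - y \<in> N\<close>] by simp
  ultimately show "vcoset N x = vcoset N y" using sub by blast
qed

context lie_group_with_chart
begin

lemma lalg_subspace: "subspace lalg"
  unfolding lie_algebra_def by (rule tangent_space_subspace)

lemma tvec_lalg: "tvec_of A k \<one> u \<in> lalg"
  using tvec_of_in[OF k one_k] by (simp add: lie_algebra_def)

lemma tvec_coord: "v \<in> lalg \<Longrightarrow> tvec_of A k \<one> (v k) = v"
  using tvec_of_coord[OF k one_k] by (simp add: lie_algebra_def)

lemma coord_homeomorphic: "homeomorphic_map (top_of_set lalg) euclidean (\<lambda>v. v k)"
proof -
  have "homeomorphic_maps (top_of_set lalg) euclidean (\<lambda>v. v k) (tvec_of A k \<one>)"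
    unfolding homeomorphic_maps_def
  proof (intro conjI ballI)
    show "continuous_map (top_of_set lalg) euclidean (\<lambda>v. v k)"
      by (simp add: continuous_on_subset[OF continuous_on_product_coordinates])
    show "continuous_map euclidean (top_of_set lalg) (tvec_of A k \<one>)"
      using tvec_of_continuous[OF k one_k] tvec_lalg by (auto simp: continuous_map_in_subtopology)
  qed (use tvec_coord tvec_of_self[OF k one_k] in auto)
  then show ?thesis using homeomorphic_maps_map by blast
qed

abbreviation "brackets \<equiv> {lie_bracket G A v w | v w. v \<in> lalg \<and> w \<in> lalg}"
abbreviation "\<N> \<equiv> derived_ideal G A"

lemma span_brackets: "span brackets \<subseteq> lalg"
  using lie_bracket_in by (intro span_minimal lalg_subspace) auto

lemma derived_ideal_subset: "\<N> \<subseteq> lalg"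
  using closure_of_subset_topspace[of "top_of_set lalg"] by (simp add: derived_ideal_def)

text \<open>The closure is computed in the coordinates of the chart \<open>k\<close>, where the topology is that of a
  locally convex space.\<close>

lemma derived_ideal_iff: "v \<in> \<N> \<longleftrightarrow> v \<in> lalg \<and> v k \<in> closure ((\<lambda>v. v k) ` span brackets)"
proof -
  have "euclidean closure_of ((\<lambda>v. v k) ` span brackets) = (\<lambda>v. v k) ` \<N>"
    unfolding derived_ideal_def
    by (rule homeomorphic_map_closure_of[OF coord_homeomorphic]) (use span_brackets in simp)
  then have eq: "closure ((\<lambda>v. v k) ` span brackets) = (\<lambda>v. v k) ` \<N>" by simp
  show ?thesis
  proof
    assume "v \<in> lalg \<and> v k \<in> closure ((\<lambda>v. v k) ` span brackets)"
    then obtain n where "v \<in> lalg" "n \<in> \<N>" "n k = v k" unfolding eq by force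
    then show "v \<in> \<N>" using tvec_coord[of v] tvec_coord[of n] derived_ideal_subset by auto
  qed (use eq derived_ideal_subset in auto)
qed

lemma derived_ideal_subspace: "subspace \<N>"
proof -
  have "linear (\<lambda>v :: ('g, 'e) tvec. v k)" by (rule linearI) auto
  then have "subspace ((\<lambda>v. v k) ` span brackets)"
    using subspace_span by (rule linear_subspace_image)
  note cl = closure_subspace_lcs[OF this]
  show ?thesis
  proof (rule subspaceI)
    show "0 \<in> \<N>"
      unfolding derived_ideal_iff using subspace_0[OF cl] subspace_0[OF lalg_subspace] by simp
    show "x + y \<in> \<N>" if "x \<in> \<N>" "y \<in> \<N>" for x y
      using that subspace_add[OF cl] subspace_add[OF lalg_subspace] unfolding derived_ideal_iff by simp
    show "r *\<^sub>R x \<in> \<N>" if "x \<in> \<N>" for r x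
      using that subspace_scale[OF cl] subspace_scale[OF lalg_subspace] unfolding derived_ideal_iff by simp
  qed
qed

lemma brackets_derived_ideal: "v \<in> lalg \<Longrightarrow> w \<in> lalg \<Longrightarrow> lie_bracket G A v w \<in> \<N>"
  unfolding derived_ideal_iff
  by (intro conjI lie_bracket_in subsetD[OF closure_subset] imageI span_base) auto

abbreviation "proj \<equiv> vcoset \<N>"

lemma topspace_abelianisation [simp]: "topspace (abelianisation G A) = proj ` lalg"
  by (simp add: abelianisation_def)

text \<open>The saturation of an open set is a union of its translates by elements of the derived ideal.\<close>

lemma proj_open:
  assumes "openin (top_of_set lalg) V"
  shows "openin (quotient_topology (top_of_set lalg) proj) (proj ` V)"
  unfolding openin_quotient_topology
proof
  have V: "V \<subseteq> lalg" using openin_subset[OF assms] by simp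
  then show "proj ` V \<subseteq> proj ` topspace (top_of_set lalg)" by auto
  have "{x \<in> topspace (top_of_set lalg). proj x \<in> proj ` V}
      = (\<Union>n\<in>\<N>. {x \<in> topspace (top_of_set lalg). x + n \<in> V})"
  proof (intro equalityI subsetI)
    fix x assume "x \<in> {x \<in> topspace (top_of_set lalg). proj x \<in> proj ` V}"
    then obtain v where x: "x \<in> lalg" and v: "v \<in> V" "proj v = proj x" by force
    then have "v - x \<in> \<N>" by (simp add: vcoset_eq_iff[OF derived_ideal_subspace])
    then show "x \<in> (\<Union>n\<in>\<N>. {x \<in> topspace (top_of_set lalg). x + n \<in> V})"
      using x v(1) by (intro UN_I[of "v - x"]) auto
  next
    fix x assume "x \<in> (\<Union>n\<in>\<N>. {x \<in> topspace (top_of_set lalg). x + n \<in> V})"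
    then obtain n where n: "n \<in> \<N>" "x \<in> lalg" "x + n \<in> V" by auto
    then have "proj (x + n) = proj x" by (simp add: vcoset_eq_iff[OF derived_ideal_subspace])
    then show "x \<in> {x \<in> topspace (top_of_set lalg). proj x \<in> proj ` V}"
      using n by (auto intro: image_eqI[of _ _ "x + n"])
  qed
  moreover have "openin (top_of_set lalg) {x \<in> topspace (top_of_set lalg). x + n \<in> V}" if n: "n \<in> \<N>" for n
  proof (rule openin_continuous_map_preimage[OF _ assms])
    have "continuous_on lalg (\<lambda>x. (x + n) c)" for c
      by (auto intro!: continuous_intros continuous_on_subset[OF continuous_on_product_coordinates])
    then have "continuous_on lalg (\<lambda>x. x + n)" by (rule continuous_on_coordinatewise_then_product)
    then show "continuous_map (top_of_set lalg) (top_of_set lalg) (\<lambda>x. x + n)"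
      using n derived_ideal_subset subspace_add[OF lalg_subspace]
      by (auto simp: continuous_map_in_subtopology)
  qed
  ultimately show "openin (top_of_set lalg) {x \<in> topspace (top_of_set lalg). proj x \<in> proj ` V}"
    by auto
qed

lemma two_form_one_continuous:
  assumes \<eta>: "\<eta> \<in> two_forms T A"
  shows "continuous_on (lalg \<times> lalg) (\<lambda>(v, w). \<eta> \<one> v w)"
proof -
  have "continuous_on (lalg \<times> lalg) (\<lambda>p. form_chart \<eta> (\<epsilon>, fst p k, snd p k))"
  proof (rule continuous_on_compose2[OF smooth_on_continuous_on[OF form_chart_smooth[OF \<eta>]]])
    show "continuous_on (lalg \<times> lalg) (\<lambda>p. (\<epsilon>, fst p k, snd p k))"
      by (intro continuous_intros continuous_on_compose2[OF continuous_on_product_coordinates[of k] continuous_on_fst]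
          continuous_on_compose2[OF continuous_on_product_coordinates[of k] continuous_on_snd]) auto
  qed (use eps_in in auto)
  then show ?thesis
  proof (rule continuous_on_eq)
    fix p assume "p \<in> lalg \<times> lalg"
    then show "form_chart \<eta> (\<epsilon>, fst p k, snd p k) = (case p of (v, w) \<Rightarrow> \<eta> \<one> v w)"
      using form_chart_coord[OF eps_in] by (auto simp: lie_algebra_def)
  qed
qed

lemma bi_invariant_kills_derived_ideal:
  assumes \<eta>: "\<eta> \<in> bi_invariant_two_forms G T A" and n: "n \<in> \<N>" and w: "w \<in> lalg"
  shows "\<eta> \<one> n w = 0"
proof -
  have form: "\<eta> \<in> two_forms T A" using \<eta> by (simp add: bi_invariant_two_forms_def)
  from two_form_alternating[OF this one_closed]
  have alt: "alternating_bilinear_on lalg (+) (*\<^sub>R) (\<eta> \<one>)" by (simp add: lie_algebra_def)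
  let ?Z = "{v \<in> topspace (top_of_set lalg). \<eta> \<one> v w \<in> {0}}"
  have "subspace ?Z"
  proof (rule subspaceI)
    have "\<eta> \<one> (0 *\<^sub>R w) w = 0 * \<eta> \<one> w w"
      using alt w unfolding alternating_bilinear_on_def by blast
    then show "0 \<in> ?Z" using subspace_0[OF lalg_subspace] by simp
    show "x + y \<in> ?Z" if "x \<in> ?Z" "y \<in> ?Z" for x y
      using that alt w subspace_add[OF lalg_subspace] unfolding alternating_bilinear_on_def by simp
    show "r *\<^sub>R x \<in> ?Z" if "x \<in> ?Z" for r x
      using that alt w subspace_scale[OF lalg_subspace] unfolding alternating_bilinear_on_def by simp
  qed
  then have "span brackets \<subseteq> ?Z"
    using bi_invariant_kills_brackets[OF \<eta> _ _ w] lie_bracket_in by (intro span_minimal) auto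
  moreover have "closedin (top_of_set lalg) ?Z"
  proof (rule closedin_continuous_map_preimage)
    have "continuous_on lalg (\<lambda>v. case (v, w) of (v, w) \<Rightarrow> \<eta> \<one> v w)"
      by (rule continuous_on_compose2[OF two_form_one_continuous[OF form]])
        (use w in \<open>auto intro!: continuous_intros\<close>)
    then show "continuous_map (top_of_set lalg) euclideanreal (\<lambda>v. \<eta> \<one> v w)" by simp
  qed simp
  ultimately have "\<N> \<subseteq> ?Z" unfolding derived_ideal_def by (rule closure_of_minimal)
  then show ?thesis using n by auto
qed

end

section \<open>The isomorphism\<close>

context lie_group_manifold
begin

lemma two_forms_subspace: "subspace (two_forms T A)"
proof (rule subspaceI)
  have "smooth ((snd c ` fst c) \<times> UNIV \<times> UNIV) (\<lambda>z :: 'e \<times> 'e \<times> 'e. 0 :: real)"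
    if "c \<in> A" for c
    using chart_image_open[OF that] by (intro smooth_on_linear linearI open_Times) auto
  then show "0 \<in> two_forms T A"
    by (simp add: two_forms_def alternating_zero case_prod_unfold)
next
  fix \<eta> \<theta> assume \<eta>: "\<eta> \<in> two_forms T A" and \<theta>: "\<theta> \<in> two_forms T A"
  have "\<eta> p + \<theta> p = 0" if "p \<notin> topspace T" for p
    using \<eta> \<theta> that by (simp add: two_forms_def)
  then show "\<eta> + \<theta> \<in> two_forms T A"
    using \<eta> \<theta> smooth_on_add[OF two_form_smooth[OF \<eta>] two_form_smooth[OF \<theta>]]
    by (simp add: two_forms_def alternating_add case_prod_unfold)
next
  fix r \<eta> assume \<eta>: "\<eta> \<in> two_forms T A"
  have "r *\<^sub>R \<eta> p = 0" if "p \<notin> topspace T" for p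
    using \<eta> that by (simp add: two_forms_def)
  then show "r *\<^sub>R \<eta> \<in> two_forms T A"
    using \<eta> smooth_on_scaleR[OF two_form_smooth[OF \<eta>], of _ r]
    by (simp add: two_forms_def alternating_scale case_prod_unfold)
qed

lemma bi_invariant_subspace: "subspace (bi_invariant_two_forms G T A)"
proof (rule subspaceI)
  note sub = two_forms_subspace
  show "0 \<in> bi_invariant_two_forms G T A"
    using subspace_0[OF sub] by (simp add: bi_invariant_iff left_invariant_form_def)
  show "\<eta> + \<theta> \<in> bi_invariant_two_forms G T A"
    if "\<eta> \<in> bi_invariant_two_forms G T A" "\<theta> \<in> bi_invariant_two_forms G T A" for \<eta> \<theta>
    using that subspace_add[OF sub] by (simp add: bi_invariant_iff left_invariant_form_def)
  show "r *\<^sub>R \<eta> \<in> bi_invariant_two_forms G T A" if "\<eta> \<in> bi_invariant_two_forms G T A" for r \<eta>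
    using that subspace_scale[OF sub] by (simp add: bi_invariant_iff left_invariant_form_def)
qed

lemma abelianisation_two_forms_subspace: "subspace (abelianisation_two_forms G A)"
proof (rule subspaceI)
  let ?X = "prod_topology (abelianisation G A) (abelianisation G A)"
  show "0 \<in> abelianisation_two_forms G A"
    by (simp add: abelianisation_two_forms_def alternating_zero case_prod_unfold)
  fix B B' assume B: "B \<in> abelianisation_two_forms G A" and B': "B' \<in> abelianisation_two_forms G A"
  have c: "continuous_map ?X euclideanreal (\<lambda>(X, Y). B X Y)"
    "continuous_map ?X euclideanreal (\<lambda>(X, Y). B' X Y)"
    using B B' by (simp_all add: abelianisation_two_forms_def)
  show "B + B' \<in> abelianisation_two_forms G A"
    using B B' continuous_map_add[OF c]
    by (simp add: abelianisation_two_forms_def alternating_add case_prod_unfold)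
  fix r
  show "r *\<^sub>R B \<in> abelianisation_two_forms G A"
    using B continuous_map_real_mult_left[OF c(1), of r]
    by (simp add: abelianisation_two_forms_def alternating_scale case_prod_unfold)
qed

end

context lie_group_with_chart
begin

text \<open>The value at two cosets, computed with chosen representatives. It does not depend on the choice if
  \<open>\<eta>\<close> is bi-invariant.\<close>

definition descend ::
  "('g \<Rightarrow> ('g, 'e) tvec \<Rightarrow> ('g, 'e) tvec \<Rightarrow> real) \<Rightarrow> ('g, 'e) tvec set \<Rightarrow> ('g, 'e) tvec set \<Rightarrow> real"
  where "descend \<eta> X Y = (if X \<in> proj ` lalg \<and> Y \<in> proj ` lalg
    then \<eta> \<one> (inv_into lalg proj X) (inv_into lalg proj Y) else 0)"

lemma bi_invariant_alternating:
  assumes "\<eta> \<in> bi_invariant_two_forms G T A"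
  shows "alternating_bilinear_on lalg (+) (*\<^sub>R) (\<eta> \<one>)"
  using assms two_form_alternating[OF _ one_closed] by (simp add: lie_algebra_def bi_invariant_two_forms_def)

lemma descend_proj:
  assumes \<eta>: "\<eta> \<in> bi_invariant_two_forms G T A" and v: "v \<in> lalg" and w: "w \<in> lalg"
  shows "descend \<eta> (proj v) (proj w) = \<eta> \<one> v w"
proof -
  note alt = bi_invariant_alternating[OF \<eta>]
  have shift: "\<eta> \<one> a c = \<eta> \<one> b c" if "a \<in> lalg" "b \<in> lalg" "c \<in> lalg" "proj a = proj b" for a b c
  proof -
    have n: "a - b \<in> \<N>" using that(4) by (simp add: vcoset_eq_iff[OF derived_ideal_subspace])
    then have "\<eta> \<one> (b + (a - b)) c = \<eta> \<one> b c + \<eta> \<one> (a - b) c"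
      using alt that derived_ideal_subset unfolding alternating_bilinear_on_def by blast
    then show ?thesis using bi_invariant_kills_derived_ideal[OF \<eta> n that(3)] by simp
  qed
  let ?v = "inv_into lalg proj (proj v)" and ?w = "inv_into lalg proj (proj w)"
  have v': "?v \<in> lalg" "proj ?v = proj v" and w': "?w \<in> lalg" "proj ?w = proj w"
    by (rule inv_into_into[OF imageI[OF v]] f_inv_into_f[OF imageI[OF v]]
        inv_into_into[OF imageI[OF w]] f_inv_into_f[OF imageI[OF w]])+
  have skew: "\<eta> \<one> a b = - \<eta> \<one> b a" if "a \<in> lalg" "b \<in> lalg" for a b
    using alternating_skew[OF alt that subspace_add[OF lalg_subspace that]] .
  have "descend \<eta> (proj v) (proj w) = \<eta> \<one> ?v ?w" using v w by (simp add: descend_def)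
  also have "\<dots> = \<eta> \<one> v ?w" by (rule shift[OF v'(1) v w'(1) v'(2)])
  also have "\<dots> = - \<eta> \<one> ?w v" by (rule skew[OF v w'(1)])
  also have "\<dots> = - \<eta> \<one> w v" using shift[OF w'(1) w v w'(2)] by simp
  also have "\<dots> = \<eta> \<one> v w" using skew[OF v w] by simp
  finally show ?thesis .
qed

lemma descend_in:
  assumes \<eta>: "\<eta> \<in> bi_invariant_two_forms G T A"
  shows "descend \<eta> \<in> abelianisation_two_forms G A"
proof -
  note alt = bi_invariant_alternating[OF \<eta>]
  note add = vcoset_add_vcoset[OF derived_ideal_subspace] and scale = vcoset_scale_vcoset[OF derived_ideal_subspace]
  note lalg = subspace_add[OF lalg_subspace] subspace_scale[OF lalg_subspace]
  have "alternating_bilinear_on (proj ` lalg) vcoset_add (vcoset_scale \<N>) (descend \<eta>)"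
    unfolding alternating_bilinear_on_def
  proof (intro conjI ballI allI impI)
    fix X Y Z assume "X \<in> proj ` lalg" "Y \<in> proj ` lalg" "Z \<in> proj ` lalg"
    then obtain x y z where xyz: "x \<in> lalg" "y \<in> lalg" "z \<in> lalg" "X = proj x" "Y = proj y" "Z = proj z"
      by blast
    show "descend \<eta> (vcoset_add X Y) Z = descend \<eta> X Z + descend \<eta> Y Z"
      "descend \<eta> Z (vcoset_add X Y) = descend \<eta> Z X + descend \<eta> Z Y"
      using xyz alt unfolding alternating_bilinear_on_def by (simp_all add: add descend_proj[OF \<eta>] lalg)
  next
    fix r X Y assume "X \<in> proj ` lalg" "Y \<in> proj ` lalg"
    then obtain x y where xy: "x \<in> lalg" "y \<in> lalg" "X = proj x" "Y = proj y" by blast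
    show "descend \<eta> (vcoset_scale \<N> r X) Y = r * descend \<eta> X Y"
      "descend \<eta> X (vcoset_scale \<N> r Y) = r * descend \<eta> X Y"
      using xy alt unfolding alternating_bilinear_on_def by (simp_all add: scale descend_proj[OF \<eta>] lalg)
  next
    fix X assume "X \<in> proj ` lalg"
    then obtain x where "x \<in> lalg" "X = proj x" by blast
    then show "descend \<eta> X X = 0"
      using alt unfolding alternating_bilinear_on_def by (simp add: descend_proj[OF \<eta>])
  next
    fix X Y assume "\<not> (X \<in> proj ` lalg \<and> Y \<in> proj ` lalg)"
    then show "descend \<eta> X Y = 0" unfolding descend_def by (rule if_not_P)
  qed
  moreover have "continuous_map (prod_topology (abelianisation G A) (abelianisation G A)) euclideanreal
      (\<lambda>(X, Y). descend \<eta> X Y)"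
    unfolding abelianisation_def
  proof (rule continuous_map_quotient_prod[OF proj_open])
    show "continuous_map (prod_topology (top_of_set lalg) (top_of_set lalg)) euclideanreal (\<lambda>(v, w). \<eta> \<one> v w)"
      using two_form_one_continuous[of \<eta>] \<eta> by (simp add: bi_invariant_two_forms_def)
  qed (simp_all add: descend_proj[OF \<eta>])
  ultimately show ?thesis by (simp add: abelianisation_two_forms_def)
qed

lemma descend_inj: "inj_on descend (bi_invariant_two_forms G T A)"
proof (rule inj_onI)
  fix \<eta> \<theta> assume \<eta>: "\<eta> \<in> bi_invariant_two_forms G T A" and \<theta>: "\<theta> \<in> bi_invariant_two_forms G T A"
    and eq: "descend \<eta> = descend \<theta>"
  have "\<eta> p a b = \<theta> p a b" for p a b
  proof (cases "p \<in> carrier G \<and> a \<in> tangent_space A p \<and> b \<in> tangent_space A p")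
    case True
    then have p: "p \<in> carrier G" and a: "a \<in> tangent_space A p" and b: "b \<in> tangent_space A p" by auto
    let ?a = "dL (inv p) p a" and ?b = "dL (inv p) p b"
    note la = dL_inverse[OF p a] and lb = dL_inverse[OF p b]
    have at_one: "\<zeta> p a b = descend \<zeta> (proj ?a) (proj ?b)" if "\<zeta> \<in> bi_invariant_two_forms G T A" for \<zeta>
    proof -
      have "left_invariant_form \<zeta>" using that by (simp add: bi_invariant_iff)
      from left_invariant_formD[OF this p one_closed, of ?a ?b] show ?thesis
        using la lb p descend_proj[OF that la(1) lb(1)] by (simp add: lie_algebra_def)
    qed
    show ?thesis using at_one[OF \<eta>] at_one[OF \<theta>] eq by simp
  next
    case False
    have zero: "\<zeta> p a b = 0" if "\<zeta> \<in> bi_invariant_two_forms G T A" for \<zeta>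
    proof (cases "p \<in> carrier G")
      case True
      have "alternating_bilinear_on (tangent_space A p) (+) (*\<^sub>R) (\<zeta> p)"
        using that two_form_alternating[OF _ True] by (simp add: bi_invariant_two_forms_def)
      then show ?thesis using True False unfolding alternating_bilinear_on_def by blast
    next
      case outside: False
      then show ?thesis using that by (simp add: bi_invariant_two_forms_def two_forms_def carrier_eq)
    qed
    show ?thesis using zero[OF \<eta>] zero[OF \<theta>] by simp
  qed
  then show "\<eta> = \<theta>" by blast
qed

text \<open>A form on the abelianisation is pulled back to the Lie algebra and extended by left translation. The
  result is right-invariant because the pulled-back form vanishes on brackets.\<close>

lemma descend_surj:
  assumes conn: "connected_space T" and B: "B \<in> abelianisation_two_forms G A"
  shows "B \<in> descend ` bi_invariant_two_forms G T A"
proof -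
  define \<omega> where "\<omega> v w = (if v \<in> lalg \<and> w \<in> lalg then B (proj v) (proj w) else 0)" for v w
  have altB: "alternating_bilinear_on (proj ` lalg) vcoset_add (vcoset_scale \<N>) B"
    and contB: "continuous_map (prod_topology (abelianisation G A) (abelianisation G A)) euclideanreal (\<lambda>(X, Y). B X Y)"
    using B by (simp_all add: abelianisation_two_forms_def)
  note add = vcoset_add_vcoset[OF derived_ideal_subspace, symmetric]
    and scale = vcoset_scale_vcoset[OF derived_ideal_subspace, symmetric]
  note lalg = subspace_add[OF lalg_subspace] subspace_scale[OF lalg_subspace]
  have alt: "alternating_bilinear_on lalg (+) (*\<^sub>R) \<omega>"
    unfolding alternating_bilinear_on_def
  proof (intro conjI ballI allI impI)
    fix x y z assume "x \<in> lalg" "y \<in> lalg" "z \<in> lalg"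
    then show "\<omega> (x + y) z = \<omega> x z + \<omega> y z" "\<omega> z (x + y) = \<omega> z x + \<omega> z y"
      using altB unfolding alternating_bilinear_on_def by (simp_all add: \<omega>_def lalg add)
  next
    fix r x y assume "x \<in> lalg" "y \<in> lalg"
    then show "\<omega> (r *\<^sub>R x) y = r * \<omega> x y" "\<omega> x (r *\<^sub>R y) = r * \<omega> x y"
      using altB unfolding alternating_bilinear_on_def by (simp_all add: \<omega>_def lalg scale)
  next
    fix x assume "x \<in> lalg"
    then show "\<omega> x x = 0" using altB unfolding alternating_bilinear_on_def by (simp add: \<omega>_def)
  next
    fix x y assume "\<not> (x \<in> lalg \<and> y \<in> lalg)"
    then show "\<omega> x y = 0" unfolding \<omega>_def by (rule if_not_P)
  qed
  have proj: "continuous_map euclidean (abelianisation G A) (\<lambda>u. proj (tvec_of A k \<one> u))"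
  proof -
    have "continuous_map euclidean (top_of_set lalg) (tvec_of A k \<one>)"
      using tvec_of_continuous[OF k one_k] tvec_lalg by (auto simp: continuous_map_in_subtopology)
    moreover have "continuous_map (top_of_set lalg) (abelianisation G A) proj"
      unfolding abelianisation_def by (rule quotient_imp_continuous_map[OF quotient_map_quotient_topology])
    ultimately show ?thesis using continuous_map_compose by (fastforce simp: o_def)
  qed
  have "continuous_map (prod_topology euclidean euclidean) (prod_topology (abelianisation G A) (abelianisation G A))
      (\<lambda>p. (proj (tvec_of A k \<one> (fst p)), proj (tvec_of A k \<one> (snd p))))"
    by (intro continuous_map_pairedI continuous_map_compose[OF continuous_map_fst proj, unfolded o_def]
        continuous_map_compose[OF continuous_map_snd proj, unfolded o_def])
  from continuous_map_compose[OF this contB]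
  have cont: "continuous_on UNIV (\<lambda>p. \<omega> (tvec_of A k \<one> (fst p)) (tvec_of A k \<one> (snd p)))"
    by (simp add: o_def \<omega>_def tvec_lalg)
  let ?\<eta> = "left_extension \<omega>"
  have left: "left_invariant_form ?\<eta>"
    by (rule left_extension_left_invariant[OF alt cont])
  have zero: "\<omega> (lie_bracket G A x y) z = 0" if "x \<in> lalg" "y \<in> lalg" "z \<in> lalg" for x y z
  proof -
    have "proj (lie_bracket G A x y) = proj (0 *\<^sub>R z)"
      using brackets_derived_ideal[OF that(1,2)] by (simp add: vcoset_eq_iff[OF derived_ideal_subspace])
    then have "\<omega> (lie_bracket G A x y) z = \<omega> (0 *\<^sub>R z) z"
      using lie_bracket_in[OF that(1,2)] lalg(2)[OF that(3)] that(3) by (simp only: \<omega>_def)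
    also have "\<dots> = 0 * \<omega> z z"
      using alt that(3) unfolding alternating_bilinear_on_def by blast
    finally show ?thesis by simp
  qed
  have zero': "\<omega> z (lie_bracket G A x y) = 0" if "x \<in> lalg" "y \<in> lalg" "z \<in> lalg" for x y z
    using alternating_skew[OF alt that(3) lie_bracket_in[OF that(1,2)]
        subspace_add[OF lalg_subspace that(3) lie_bracket_in[OF that(1,2)]]] zero[OF that] by simp
  have bi: "?\<eta> \<in> bi_invariant_two_forms G T A"
    by (rule left_invariant_imp_bi_invariant[OF conn left])
      (simp_all add: left_extension_one lie_bracket_in zero zero')
  have "descend ?\<eta> X Y = B X Y" for X Y
  proof (cases "X \<in> proj ` lalg \<and> Y \<in> proj ` lalg")
    case True
    then obtain v w where "v \<in> lalg" "w \<in> lalg" "X = proj v" "Y = proj w" by blast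
    then show ?thesis by (simp add: descend_proj[OF bi] left_extension_one \<omega>_def)
  next
    case False
    then have "descend ?\<eta> X Y = 0" unfolding descend_def by (rule if_not_P)
    moreover have "B X Y = 0" using altB False unfolding alternating_bilinear_on_def by blast
    ultimately show ?thesis by simp
  qed
  then have "B = descend ?\<eta>" by (intro ext) simp
  then show ?thesis using bi by (rule image_eqI)
qed

lemma bi_invariant_isomorphic:
  assumes "connected_space T"
  shows "isomorphic_subspaces (bi_invariant_two_forms G T A) (abelianisation_two_forms G A)"
  unfolding isomorphic_subspaces_def
proof (intro conjI exI[of _ descend] ballI allI)
  show "subspace (bi_invariant_two_forms G T A)" by (rule bi_invariant_subspace)
  show "subspace (abelianisation_two_forms G A)" by (rule abelianisation_two_forms_subspace)
  show "bij_betw descend (bi_invariant_two_forms G T A) (abelianisation_two_forms G A)"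
    unfolding bij_betw_def using descend_inj descend_in descend_surj[OF assms] by blast
  show "descend (\<eta> + \<theta>) = descend \<eta> + descend \<theta>" for \<eta> \<theta>
    by (intro ext) (simp add: descend_def)
  show "descend (r *\<^sub>R \<eta>) = r *\<^sub>R descend \<eta>" for r \<eta>
    by (intro ext) (simp add: descend_def)
qed

end

theorem theorem2:
  fixes G :: "('g, 'x) monoid_scheme"
    and T :: "'g topology"
    and A :: "('g, 'e::locally_convex_space) chart set"
  assumes "lie_group G T A"
    and "connected_space T"
    and "milnor_regular G T A"
  shows "isomorphic_subspaces (bi_invariant_two_forms G T A) (abelianisation_two_forms G A)"
proof -
  interpret lie_group_manifold G T A using assms(1) by unfold_locales
  have "\<one>\<^bsub>G\<^esub> \<in> topspace T" using one_closed by (simp add: carrier_eq)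
  then obtain k where "k \<in> A" "\<one>\<^bsub>G\<^esub> \<in> fst k" by (rule chart_at)
  then interpret lie_group_with_chart G T A k by unfold_locales
  show ?thesis using assms(2) by (rule bi_invariant_isomorphic)
qed

end
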